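(* Let $(H,\mathcal R)$ be a finite-dimensional factorisable quasitriangular Hopf algebra over a field $k$, with nonzero left integral $\Lambda\in H$ satisfying $S\Lambda=\Lambda$. Let $\underline H$ be its transmutation, a Hopf algebra in the braided category $\mathcal C$ of $H$-modules. Then $\underline H$ has invertible antipode, $\Lambda$ defines a morphism $k\to\underline H$ in $\mathcal C$ which is a left integral, and there is a morphism $\underline{\int}:\underline H\to k$ in $\mathcal C$ which is a right integral on $\underline H$ with $\underline{\int}\Lambda=1$. Consequently $\underline H$ extends to a braided F-Hopf algebra in $\mathcal C$, i.e. there exist in $\mathcal C$ a Frobenius algebra structure $(\cup_r,g_r)$ on the algebra of $\underline H$ and a Frobenius coalgebra structure $(\cup_g,g_g)$ on the coalgebra of $\underline H$ with $\underline S=(\cup_g\otimes\mathrm{id})(\mathrm{id}\otimes g_r)$; and then, with the associated structures $\mu_g,1_g,\Delta_r,\epsilon_r$ and with $(\mu_r,1_r,\Delta_g,\epsilon_g)$ denoting the structure maps of $\underline H$, the maps $(\mu_r,1_r,\Delta_r,\epsilon_r)$ and $(\mu_g,1_g,\Delta_g,\epsilon_g)$ are F-algebras, and $(\mu_r,1_r,\Delta_g,\epsilon_g)$ and $(\mu_g\circ\Psi,1_g,\Delta_r,\epsilon_r)$ are Hopf algebras in $\mathcal C$.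
   Context: Notation: $\Delta h=h_1\otimes h_2$, $\mathcal R=\mathcal R^1\otimes\mathcal R^2$ (sums understood). A left integral in $H$ is $\Lambda\in H$ with $h\Lambda=\epsilon(h)\Lambda$ for all $h$. $(H,\mathcal R)$ is factorisable if $\mathcal Q=\mathcal R_{21}\mathcal R\in H\otimes H$ is invertible when viewed as a linear map $H^*\to H$ by evaluation against its first factor. The category $\mathcal C$ of $H$-modules is braided by $\Psi(v\otimes w)=\mathcal R^2\triangleright w\otimes\mathcal R^1\triangleright v$. The transmutation $\underline H$ is $H$ as an algebra and with the same counit, an object of $\mathcal C$ by the adjoint action $h\triangleright h'=h_1h'Sh_2$, with coproduct and antipode $$\underline\Delta h=h_1S\mathcal R^2\otimes\mathcal R^1\triangleright h_2,\qquad\underline S h=\mathcal R^2S(\mathcal R^1\triangleright h).$$ It is a known fact that this is a Hopf algebra in $\mathcal C$ (i.e. with $\underline\Delta$ an algebra map to the braided tensor product algebra $\underline H\otimes\underline H$ with product $(\mu\otimes\mu)(\mathrm{id}\otimes\Psi\otimes\mathrm{id})$). Integrals on a Hopf algebra $(B,\mu,1,\Delta,\epsilon,S)$ in $\mathcal C$: a left integral is a morphism $\Lambda:k\to B$ with $\mu(\mathrm{id}\otimes\Lambda)=\Lambda\epsilon$; a right integral is a morphism $\int:B\to k$ with $(\int\otimes\mathrm{id})\Delta=1\int$. A Frobenius algebra in $\mathcal C$ is an algebra $(B,\mu_r,1_r)$ with morphisms $\cup_r:B\otimes B\to k$, $g_r:k\to B\otimes B$ such that $\cup_r(\mu_r\otimes\mathrm{id})=\cup_r(\mathrm{id}\otimes\mu_r)$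 and $(\cup_r\otimes\mathrm{id})(\mathrm{id}\otimes g_r)=\mathrm{id}=(\mathrm{id}\otimes\cup_r)(g_r\otimes\mathrm{id})$. A Frobenius coalgebra is a coalgebra $(B,\Delta_g,\epsilon_g)$ with morphisms $\cup_g,g_g$ inverse in the same sense and $(\Delta_g\otimes\mathrm{id})g_g=(\mathrm{id}\otimes\Delta_g)g_g$. Associated structures: $\Delta_r=(\mathrm{id}\otimes\mu_r)(g_r\otimes\mathrm{id})$, $\epsilon_r=\cup_r(\mathrm{id}\otimes1_r)$, $\mu_g=(\mathrm{id}\otimes\cup_g)(\Delta_g\otimes\mathrm{id})$, $1_g=(\mathrm{id}\otimes\epsilon_g)g_g$. An F-algebra is an algebra $(\mu,1)$ and coalgebra $(\Delta,\epsilon)$ on the same object with $(\mathrm{id}\otimes\mu)(\Delta\otimes\mathrm{id})=\Delta\mu=(\mu\otimes\mathrm{id})(\mathrm{id}\otimes\Delta)$. *)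

theory Defs
  imports Complex_Main "HOL-Library.FuncSet" "HOL-Library.Function_Algebras"
begin

section \<open>Vector spaces and their tensor products\<close>

text \<open>
  A vector space is a subspace of an ambient type carrying a scalar multiplication. The carrier is
  needed because a tensor product is only a subspace of the function type that hosts it.
\<close>

record ('k, 'v) vspace =
  car :: "'v set"
  scl :: "'k \<Rightarrow> 'v \<Rightarrow> 'v"

definition is_vspace :: "('k::field, 'v::ab_group_add, 'x) vspace_scheme \<Rightarrow> bool" where
  "is_vspace V \<longleftrightarrow> vector_space (scl V) \<and> module.subspace (scl V) (car V)"

definition linear_on ::
  "('k::field, 'v::ab_group_add, 'x) vspace_scheme \<Rightarrow> ('k, 'w::ab_group_add, 'y) vspace_scheme
    \<Rightarrow> ('v \<Rightarrow> 'w) \<Rightarrow> bool" where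
  "linear_on V W f \<longleftrightarrow>
     (\<forall>x\<in>car V. f x \<in> car W) \<and>
     (\<forall>x\<in>car V. \<forall>y\<in>car V. f (x + y) = f x + f y) \<and>
     (\<forall>c. \<forall>x\<in>car V. f (scl V c x) = scl W c (f x))"

definition bilinear_on ::
  "('k::field, 'v::ab_group_add, 'x) vspace_scheme \<Rightarrow> ('k, 'w::ab_group_add, 'y) vspace_scheme
    \<Rightarrow> ('k, 'u::ab_group_add, 'z) vspace_scheme \<Rightarrow> ('v \<Rightarrow> 'w \<Rightarrow> 'u) \<Rightarrow> bool" where
  "bilinear_on V W U \<beta> \<longleftrightarrow>
     (\<forall>v\<in>car V. linear_on W U (\<beta> v)) \<and> (\<forall>w\<in>car W. linear_on V U (\<lambda>v. \<beta> v w))"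

definition kspace :: "('k::field, 'k) vspace" where
  "kspace = \<lparr>car = UNIV, scl = (*)\<rparr>"

text \<open>
  \<open>V \<otimes> W\<close> is realised inside the dual of the space of bilinear forms on \<open>V \<times> W\<close>: the pure tensor
  \<open>v \<otimes> w\<close> is evaluation at \<open>(v, w)\<close>, and \<open>V \<otimes> W\<close> consists of the finite sums of pure tensors.
  Over a field this is the tensor product, for all \<open>V\<close> and \<open>W\<close>; lemma \<open>tsum_tens\<close> below gives the
  universal property.
\<close>

type_synonym ('v, 'w, 'k) tensor = "('v \<Rightarrow> 'w \<Rightarrow> 'k) \<Rightarrow> 'k"

definition tens ::
  "('k::field, 'v::ab_group_add, 'x) vspace_scheme \<Rightarrow> ('k, 'w::ab_group_add, 'y) vspace_scheme
    \<Rightarrow> 'v \<Rightarrow> 'w \<Rightarrow> ('v, 'w, 'k) tensor" where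
  "tens V W v w = (\<lambda>\<beta>. if bilinear_on V W kspace \<beta> then \<beta> v w else 0)"

definition tprod ::
  "('k::field, 'v::ab_group_add, 'x) vspace_scheme \<Rightarrow> ('k, 'w::ab_group_add, 'y) vspace_scheme
    \<Rightarrow> ('k, ('v, 'w, 'k) tensor) vspace" where
  "tprod V W =
     \<lparr>car = {\<Sum>(v, w)\<leftarrow>ps. tens V W v w |ps. set ps \<subseteq> car V \<times> car W},
      scl = (\<lambda>c t \<beta>. c * t \<beta>)\<rparr>"

text \<open>
  \<open>tsum V W t (\<lambda>v w. \<beta> v w)\<close> is Sweedler notation: writing \<open>t = \<Sum>\<^sub>i v\<^sub>i \<otimes> w\<^sub>i\<close>, it is
  \<open>\<Sum>\<^sub>i \<beta> v\<^sub>i w\<^sub>i\<close>. For bilinear \<open>\<beta>\<close> the choice of the representation of \<open>t\<close> is immaterial.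
\<close>

definition tsum ::
  "('k::field, 'v::ab_group_add, 'x) vspace_scheme \<Rightarrow> ('k, 'w::ab_group_add, 'y) vspace_scheme
    \<Rightarrow> ('v, 'w, 'k) tensor \<Rightarrow> ('v \<Rightarrow> 'w \<Rightarrow> 'u::ab_group_add) \<Rightarrow> 'u" where
  "tsum V W t \<beta> =
     (let ps = (SOME ps. set ps \<subseteq> car V \<times> car W \<and> t = (\<Sum>(v, w)\<leftarrow>ps. tens V W v w))
      in \<Sum>(v, w)\<leftarrow>ps. \<beta> v w)"

lemma tsum_tens:
  fixes V :: "('k::field, 'v::ab_group_add, 'x) vspace_scheme"
    and W :: "('k, 'w::ab_group_add, 'y) vspace_scheme"
    and U :: "('k, 'u::ab_group_add, 'z) vspace_scheme"
  assumes U: "is_vspace U" and bil: "bilinear_on V W U \<beta>" and ps: "set ps \<subseteq> car V \<times> car W"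
  shows "tsum V W (\<Sum>(v, w)\<leftarrow>ps. tens V W v w) \<beta> = (\<Sum>(v, w)\<leftarrow>ps. \<beta> v w)"
proof -
  define qs where "qs = (SOME qs. set qs \<subseteq> car V \<times> car W \<and>
    (\<Sum>(v, w)\<leftarrow>ps. tens V W v w) = (\<Sum>(v, w)\<leftarrow>qs. tens V W v w))"
  have "set qs \<subseteq> car V \<times> car W \<and>
      (\<Sum>(v, w)\<leftarrow>ps. tens V W v w) = (\<Sum>(v, w)\<leftarrow>qs. tens V W v w)"
    unfolding qs_def by (rule someI[of _ ps]) (use ps in simp)
  then have eq: "(\<Sum>(v, w)\<leftarrow>ps. tens V W v w) = (\<Sum>(v, w)\<leftarrow>qs. tens V W v w)" by blast
  interpret U: vector_space "scl U" using U by (simp add: is_vspace_def)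
  interpret P: vector_space_pair "scl U" "(*) :: 'k \<Rightarrow> 'k \<Rightarrow> 'k"
    by unfold_locales (auto simp: algebra_simps)
  have ev: "(\<Sum>(v, w)\<leftarrow>rs. tens V W v w) (\<lambda>v w. \<phi> (\<beta> v w)) = \<phi> (\<Sum>(v, w)\<leftarrow>rs. \<beta> v w)"
    if \<phi>: "Vector_Spaces.linear (scl U) (*) \<phi>" for \<phi> rs
  proof -
    interpret \<phi>: Vector_Spaces.linear "scl U" "(*)" \<phi> by (rule \<phi>)
    have b: "bilinear_on V W kspace (\<lambda>v w. \<phi> (\<beta> v w))"
      using bil by (auto simp: bilinear_on_def linear_on_def kspace_def \<phi>.add \<phi>.scale)
    show ?thesis
      by (induction rs) (auto simp: tens_def b \<phi>.zero \<phi>.add)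
  qed
  have "(\<Sum>(v, w)\<leftarrow>ps. \<beta> v w) = (\<Sum>(v, w)\<leftarrow>qs. \<beta> v w)" (is "?x = ?y")
  proof (rule ccontr)
    assume "?x \<noteq> ?y"
    then have "U.independent {?x - ?y}" by simp
    from P.linear_independent_extend[OF this, of "\<lambda>_. 1"]
    obtain \<phi> where \<phi>: "Vector_Spaces.linear (scl U) (*) \<phi>" "\<phi> (?x - ?y) = 1" by auto
    interpret \<phi>: Vector_Spaces.linear "scl U" "(*)" \<phi> by (rule \<phi>)
    have "\<phi> ?x = \<phi> ?y" using ev[OF \<phi>(1)] eq by metis
    with \<phi>(2) show False by (simp add: \<phi>.diff)
  qed
  then show ?thesis
    by (simp add: tsum_def qs_def Let_def)
qed


section \<open>Quasitriangular Hopf algebras\<close>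

text \<open>The product and unit of \<open>H\<close> are those of the class \<open>ring_1\<close>.\<close>

record ('k, 'h) qtha =
  scale :: "'k \<Rightarrow> 'h \<Rightarrow> 'h"
  comult :: "'h \<Rightarrow> ('h, 'h, 'k) tensor"
  counit :: "'h \<Rightarrow> 'k"
  antipode :: "'h \<Rightarrow> 'h"
  rmat :: "('h, 'h, 'k) tensor"

context
  fixes H :: "('k::field, 'h::ring_1) qtha"
begin

definition Hsp :: "('k, 'h) vspace" where
  "Hsp = \<lparr>car = UNIV, scl = scale H\<rparr>"

text \<open>Pure tensors in \<open>H \<otimes> H\<close> and in \<open>H \<otimes> (H \<otimes> H)\<close>, and Sweedler sums over \<open>H \<otimes> H\<close>.\<close>

definition tens2 :: "'h \<Rightarrow> 'h \<Rightarrow> ('h, 'h, 'k) tensor" where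
  "tens2 = tens Hsp Hsp"

definition tens3 :: "'h \<Rightarrow> 'h \<Rightarrow> 'h \<Rightarrow> ('h, ('h, 'h, 'k) tensor, 'k) tensor" where
  "tens3 a b c = tens Hsp (tprod Hsp Hsp) a (tens2 b c)"

definition sw :: "('h, 'h, 'k) tensor \<Rightarrow> ('h \<Rightarrow> 'h \<Rightarrow> 'u::ab_group_add) \<Rightarrow> 'u" where
  "sw = tsum Hsp Hsp"

definition tmult :: "('h, 'h, 'k) tensor \<Rightarrow> ('h, 'h, 'k) tensor \<Rightarrow> ('h, 'h, 'k) tensor" where
  "tmult s t = sw s (\<lambda>a b. sw t (\<lambda>c d. tens2 (a * c) (b * d)))"

definition is_algebra :: bool where
  "is_algebra \<longleftrightarrow> vector_space (scale H) \<and>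
     (\<forall>c a b. scale H c a * b = scale H c (a * b) \<and> a * scale H c b = scale H c (a * b))"

definition is_hopf_algebra :: bool where
  "is_hopf_algebra \<longleftrightarrow> is_algebra \<and>
     linear_on Hsp (tprod Hsp Hsp) (comult H) \<and>
     linear_on Hsp kspace (counit H) \<and>
     (\<forall>h. sw (comult H h) (\<lambda>a b. sw (comult H a) (\<lambda>a1 a2. tens3 a1 a2 b)) =
          sw (comult H h) (\<lambda>a b. sw (comult H b) (\<lambda>b1 b2. tens3 a b1 b2))) \<and>
     (\<forall>h. sw (comult H h) (\<lambda>a b. scale H (counit H a) b) = h) \<and>
     (\<forall>h. sw (comult H h) (\<lambda>a b. scale H (counit H b) a) = h) \<and>
     (\<forall>g h. comult H (g * h) = tmult (comult H g) (comult H h)) \<and>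
     comult H 1 = tens2 1 1 \<and>
     (\<forall>g h. counit H (g * h) = counit H g * counit H h) \<and>
     counit H 1 = 1 \<and>
     linear_on Hsp Hsp (antipode H) \<and>
     (\<forall>h. sw (comult H h) (\<lambda>a b. antipode H a * b) = scale H (counit H h) 1) \<and>
     (\<forall>h. sw (comult H h) (\<lambda>a b. a * antipode H b) = scale H (counit H h) 1)"

text \<open>
  Drinfeld's axioms, in the convention \<open>\<Delta>\<^sup>o\<^sup>p h = \<R> (\<Delta> h) \<R>\<^sup>-\<^sup>1\<close>, \<open>(\<Delta> \<otimes> id) \<R> = \<R>\<^sub>1\<^sub>3 \<R>\<^sub>2\<^sub>3\<close>,
  \<open>(id \<otimes> \<Delta>) \<R> = \<R>\<^sub>1\<^sub>3 \<R>\<^sub>1\<^sub>2\<close>, which is the one making \<open>v \<otimes> w \<mapsto> \<R>\<^sup>2 w \<otimes> \<R>\<^sup>1 v\<close> a braiding on left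
  modules.
\<close>

definition is_quasitriangular :: bool where
  "is_quasitriangular \<longleftrightarrow> is_hopf_algebra \<and>
     rmat H \<in> car (tprod Hsp Hsp) \<and>
     (\<exists>Rinv\<in>car (tprod Hsp Hsp).
        tmult (rmat H) Rinv = tens2 1 1 \<and> tmult Rinv (rmat H) = tens2 1 1) \<and>
     (\<forall>h. tmult (sw (comult H h) (\<lambda>a b. tens2 b a)) (rmat H) = tmult (rmat H) (comult H h)) \<and>
     sw (rmat H) (\<lambda>a b. sw (comult H a) (\<lambda>a1 a2. tens3 a1 a2 b)) =
       sw (rmat H) (\<lambda>a b. sw (rmat H) (\<lambda>c d. tens3 a c (b * d))) \<and>
     sw (rmat H) (\<lambda>a b. sw (comult H b) (\<lambda>b1 b2. tens3 a b1 b2)) =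
       sw (rmat H) (\<lambda>a b. sw (rmat H) (\<lambda>c d. tens3 (a * c) d b))"

definition is_finite_dimensional :: bool where
  "is_finite_dimensional \<longleftrightarrow> (\<exists>Basis. finite_dimensional_vector_space (scale H) Basis)"

definition qmat :: "('h, 'h, 'k) tensor" where
  "qmat = tmult (sw (rmat H) (\<lambda>a b. tens2 b a)) (rmat H)"

definition is_factorisable :: bool where
  "is_factorisable \<longleftrightarrow>
     bij_betw (\<lambda>\<phi>. sw qmat (\<lambda>a b. scale H (\<phi> a) b))
       {\<phi>. Vector_Spaces.linear (scale H) (*) \<phi>} UNIV"

definition is_left_integral_in :: "'h \<Rightarrow> bool" where
  "is_left_integral_in \<Lambda> \<longleftrightarrow> (\<forall>h. h * \<Lambda> = scale H (counit H h) \<Lambda>)"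

end


section \<open>The braided category of modules\<close>

record ('k, 'v, 'h) hmod = "('k, 'v) vspace" +
  act :: "'h \<Rightarrow> 'v \<Rightarrow> 'v"

text \<open>
  Arrows carry their source and target. Their underlying functions are \<open>undefined\<close> outside the
  source, so that equality of arrows is equality of maps.
\<close>

record ('k, 'h, 'v, 'w) arrow =
  dom :: "('k, 'v, 'h) hmod"
  cod :: "('k, 'w, 'h) hmod"
  app :: "'v \<Rightarrow> 'w"

definition arr :: "('k, 'v, 'h) hmod \<Rightarrow> ('k, 'w, 'h) hmod \<Rightarrow> ('v \<Rightarrow> 'w) \<Rightarrow> ('k, 'h, 'v, 'w) arrow"
  where "arr V W f = \<lparr>dom = V, cod = W, app = restrict f (car V)\<rparr>"

definition ident :: "('k, 'v, 'h) hmod \<Rightarrow> ('k, 'h, 'v, 'v) arrow" where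
  "ident V = arr V V (\<lambda>v. v)"

definition compose_arr ::
  "('k, 'h, 'v, 'w) arrow \<Rightarrow> ('k, 'h, 'u, 'v) arrow \<Rightarrow> ('k, 'h, 'u, 'w) arrow"
    (infixr "\<cdot>" 65)
  where "g \<cdot> f = arr (dom f) (cod g) (\<lambda>x. app g (app f x))"

context
  fixes H :: "('k::field, 'h::ring_1) qtha"
begin

definition is_module :: "('k, 'v::ab_group_add, 'h) hmod \<Rightarrow> bool" where
  "is_module V \<longleftrightarrow> is_vspace V \<and> bilinear_on (Hsp H) V V (act V) \<and>
     (\<forall>v\<in>car V. act V 1 v = v) \<and>
     (\<forall>g h. \<forall>v\<in>car V. act V (g * h) v = act V g (act V h v))"

definition hom ::
  "('k, 'v::ab_group_add, 'h) hmod \<Rightarrow> ('k, 'w::ab_group_add, 'h) hmod \<Rightarrow> ('k, 'h, 'v, 'w) arrow set"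
  where
  "hom V W = {f. dom f = V \<and> cod f = W \<and> is_module V \<and> is_module W \<and>
     app f \<in> extensional (car V) \<and> linear_on V W (app f) \<and>
     (\<forall>h. \<forall>v\<in>car V. app f (act V h v) = act W h (app f v))}"

definition kmod :: "('k, 'k, 'h) hmod" where
  "kmod = \<lparr>car = UNIV, scl = (*), act = (\<lambda>h c. counit H h * c)\<rparr>"

definition mod_tensor ::
  "('k, 'v::ab_group_add, 'h) hmod \<Rightarrow> ('k, 'w::ab_group_add, 'h) hmod
    \<Rightarrow> ('k, ('v, 'w, 'k) tensor, 'h) hmod"
    (infixr "\<boxtimes>" 75)
  where
  "V \<boxtimes> W = \<lparr>car = car (tprod V W), scl = scl (tprod V W),
     act = (\<lambda>h t. sw H (comult H h)
       (\<lambda>h1 h2. tsum V W t (\<lambda>v w. tens V W (act V h1 v) (act W h2 w))))\<rparr>"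

definition arr_tensor ::
  "('k, 'h, 'v::ab_group_add, 'v'::ab_group_add) arrow
    \<Rightarrow> ('k, 'h, 'w::ab_group_add, 'w'::ab_group_add) arrow
    \<Rightarrow> ('k, 'h, ('v, 'w, 'k) tensor, ('v', 'w', 'k) tensor) arrow"
    (infixr "\<otimes>" 75)
  where
  "f \<otimes> g = arr (dom f \<boxtimes> dom g) (cod f \<boxtimes> cod g)
     (\<lambda>t. tsum (dom f) (dom g) t (\<lambda>v w. tens (cod f) (cod g) (app f v) (app g w)))"

definition assoc ::
  "('k, 'u::ab_group_add, 'h) hmod \<Rightarrow> ('k, 'v::ab_group_add, 'h) hmod
    \<Rightarrow> ('k, 'w::ab_group_add, 'h) hmod
    \<Rightarrow> ('k, 'h, (('u, 'v, 'k) tensor, 'w, 'k) tensor, ('u, ('v, 'w, 'k) tensor, 'k) tensor) arrow"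
  where
  "assoc U V W = arr ((U \<boxtimes> V) \<boxtimes> W) (U \<boxtimes> (V \<boxtimes> W))
     (\<lambda>t. tsum (U \<boxtimes> V) W t (\<lambda>s w. tsum U V s (\<lambda>u v. tens U (V \<boxtimes> W) u (tens V W v w))))"

definition assoc_inv ::
  "('k, 'u::ab_group_add, 'h) hmod \<Rightarrow> ('k, 'v::ab_group_add, 'h) hmod
    \<Rightarrow> ('k, 'w::ab_group_add, 'h) hmod
    \<Rightarrow> ('k, 'h, ('u, ('v, 'w, 'k) tensor, 'k) tensor, (('u, 'v, 'k) tensor, 'w, 'k) tensor) arrow"
  where
  "assoc_inv U V W = arr (U \<boxtimes> (V \<boxtimes> W)) ((U \<boxtimes> V) \<boxtimes> W)
     (\<lambda>t. tsum U (V \<boxtimes> W) t (\<lambda>u s. tsum V W s (\<lambda>v w. tens (U \<boxtimes> V) W (tens U V u v) w)))"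

definition lunit :: "('k, 'v::ab_group_add, 'h) hmod \<Rightarrow> ('k, 'h, ('k, 'v, 'k) tensor, 'v) arrow"
  where "lunit V = arr (kmod \<boxtimes> V) V (\<lambda>t. tsum kmod V t (\<lambda>c v. scl V c v))"

definition lunit_inv :: "('k, 'v::ab_group_add, 'h) hmod \<Rightarrow> ('k, 'h, 'v, ('k, 'v, 'k) tensor) arrow"
  where "lunit_inv V = arr V (kmod \<boxtimes> V) (\<lambda>v. tens kmod V 1 v)"

definition runit :: "('k, 'v::ab_group_add, 'h) hmod \<Rightarrow> ('k, 'h, ('v, 'k, 'k) tensor, 'v) arrow"
  where "runit V = arr (V \<boxtimes> kmod) V (\<lambda>t. tsum V kmod t (\<lambda>v c. scl V c v))"

definition runit_inv :: "('k, 'v::ab_group_add, 'h) hmod \<Rightarrow> ('k, 'h, 'v, ('v, 'k, 'k) tensor) arrow"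
  where "runit_inv V = arr V (V \<boxtimes> kmod) (\<lambda>v. tens V kmod v 1)"

definition braid ::
  "('k, 'v::ab_group_add, 'h) hmod \<Rightarrow> ('k, 'w::ab_group_add, 'h) hmod
    \<Rightarrow> ('k, 'h, ('v, 'w, 'k) tensor, ('w, 'v, 'k) tensor) arrow"
  where
  "braid V W = arr (V \<boxtimes> W) (W \<boxtimes> V)
     (\<lambda>t. tsum V W t (\<lambda>v w. sw H (rmat H) (\<lambda>r1 r2. tens W V (act W r2 w) (act V r1 v))))"


section \<open>Algebras, Hopf algebras and Frobenius structures in the category\<close>

text \<open>
  Throughout \<open>B\<close> is the underlying object, \<open>m, e\<close> product and unit, \<open>d, n\<close> coproduct and counit,
  \<open>s\<close> an antipode, \<open>cup, cap\<close> a pairing \<open>\<union> : B \<otimes> B \<rightarrow> k\<close> and a copairing \<open>g : k \<rightarrow> B \<otimes> B\<close>.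
  Associators and unitors, suppressed in the usual notation, are written out.
\<close>

definition algebra_in ::
  "('k, 'b::ab_group_add, 'h) hmod \<Rightarrow> ('k, 'h, ('b, 'b, 'k) tensor, 'b) arrow
    \<Rightarrow> ('k, 'h, 'k, 'b) arrow \<Rightarrow> bool" where
  "algebra_in B m e \<longleftrightarrow> m \<in> hom (B \<boxtimes> B) B \<and> e \<in> hom kmod B \<and>
     m \<cdot> (m \<otimes> ident B) = m \<cdot> (ident B \<otimes> m) \<cdot> assoc B B B \<and>
     m \<cdot> (e \<otimes> ident B) = lunit B \<and>
     m \<cdot> (ident B \<otimes> e) = runit B"

definition coalgebra_in ::
  "('k, 'b::ab_group_add, 'h) hmod \<Rightarrow> ('k, 'h, 'b, ('b, 'b, 'k) tensor) arrow
    \<Rightarrow> ('k, 'h, 'b, 'k) arrow \<Rightarrow> bool" where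
  "coalgebra_in B d n \<longleftrightarrow> d \<in> hom B (B \<boxtimes> B) \<and> n \<in> hom B kmod \<and>
     assoc B B B \<cdot> (d \<otimes> ident B) \<cdot> d = (ident B \<otimes> d) \<cdot> d \<and>
     (n \<otimes> ident B) \<cdot> d = lunit_inv B \<and>
     (ident B \<otimes> n) \<cdot> d = runit_inv B"

text \<open>\<open>id \<otimes> \<Psi> \<otimes> id\<close> on \<open>B \<otimes> B \<otimes> B \<otimes> B\<close>, bracketed as \<open>(B \<otimes> B) \<otimes> (B \<otimes> B)\<close> on both sides.\<close>

definition mid_braid ::
  "('k, 'b::ab_group_add, 'h) hmod
    \<Rightarrow> ('k, 'h, (('b, 'b, 'k) tensor, ('b, 'b, 'k) tensor, 'k) tensor,
          (('b, 'b, 'k) tensor, ('b, 'b, 'k) tensor, 'k) tensor) arrow" where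
  "mid_braid B =
     assoc_inv B B (B \<boxtimes> B) \<cdot> (ident B \<otimes> assoc B B B) \<cdot> (ident B \<otimes> (braid B B \<otimes> ident B)) \<cdot>
     (ident B \<otimes> assoc_inv B B B) \<cdot> assoc B B (B \<boxtimes> B)"

definition hopf_in ::
  "('k, 'b::ab_group_add, 'h) hmod \<Rightarrow> ('k, 'h, ('b, 'b, 'k) tensor, 'b) arrow
    \<Rightarrow> ('k, 'h, 'k, 'b) arrow \<Rightarrow> ('k, 'h, 'b, ('b, 'b, 'k) tensor) arrow
    \<Rightarrow> ('k, 'h, 'b, 'k) arrow \<Rightarrow> ('k, 'h, 'b, 'b) arrow \<Rightarrow> bool" where
  "hopf_in B m e d n s \<longleftrightarrow> algebra_in B m e \<and> coalgebra_in B d n \<and>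
     d \<cdot> m = (m \<otimes> m) \<cdot> mid_braid B \<cdot> (d \<otimes> d) \<and>
     d \<cdot> e = (e \<otimes> e) \<cdot> lunit_inv kmod \<and>
     n \<cdot> m = lunit kmod \<cdot> (n \<otimes> n) \<and>
     n \<cdot> e = ident kmod \<and>
     s \<in> hom B B \<and>
     m \<cdot> (s \<otimes> ident B) \<cdot> d = e \<cdot> n \<and>
     m \<cdot> (ident B \<otimes> s) \<cdot> d = e \<cdot> n"

definition left_integral_on ::
  "('k, 'b::ab_group_add, 'h) hmod \<Rightarrow> ('k, 'h, ('b, 'b, 'k) tensor, 'b) arrow
    \<Rightarrow> ('k, 'h, 'b, 'k) arrow \<Rightarrow> ('k, 'h, 'k, 'b) arrow \<Rightarrow> bool" where
  "left_integral_on B m n L \<longleftrightarrow>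
     L \<in> hom kmod B \<and> m \<cdot> (ident B \<otimes> L) = L \<cdot> n \<cdot> runit B"

definition right_integral_on ::
  "('k, 'b::ab_group_add, 'h) hmod \<Rightarrow> ('k, 'h, 'k, 'b) arrow
    \<Rightarrow> ('k, 'h, 'b, ('b, 'b, 'k) tensor) arrow \<Rightarrow> ('k, 'h, 'b, 'k) arrow \<Rightarrow> bool" where
  "right_integral_on B e d J \<longleftrightarrow>
     J \<in> hom B kmod \<and> lunit B \<cdot> (J \<otimes> ident B) \<cdot> d = e \<cdot> J"

text \<open>\<open>(\<union> \<otimes> id)(id \<otimes> g)\<close> and \<open>(id \<otimes> \<union>)(g \<otimes> id)\<close> as maps \<open>B \<rightarrow> B\<close>.\<close>

definition cup_cap ::
  "('k, 'b::ab_group_add, 'h) hmod \<Rightarrow> ('k, 'h, ('b, 'b, 'k) tensor, 'k) arrow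
    \<Rightarrow> ('k, 'h, 'k, ('b, 'b, 'k) tensor) arrow \<Rightarrow> ('k, 'h, 'b, 'b) arrow" where
  "cup_cap B cup cap =
     lunit B \<cdot> (cup \<otimes> ident B) \<cdot> assoc_inv B B B \<cdot> (ident B \<otimes> cap) \<cdot> runit_inv B"

definition cap_cup ::
  "('k, 'b::ab_group_add, 'h) hmod \<Rightarrow> ('k, 'h, ('b, 'b, 'k) tensor, 'k) arrow
    \<Rightarrow> ('k, 'h, 'k, ('b, 'b, 'k) tensor) arrow \<Rightarrow> ('k, 'h, 'b, 'b) arrow" where
  "cap_cup B cup cap =
     runit B \<cdot> (ident B \<otimes> cup) \<cdot> assoc B B B \<cdot> (cap \<otimes> ident B) \<cdot> lunit_inv B"

definition frobenius_algebra_in ::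
  "('k, 'b::ab_group_add, 'h) hmod \<Rightarrow> ('k, 'h, ('b, 'b, 'k) tensor, 'b) arrow
    \<Rightarrow> ('k, 'h, 'k, 'b) arrow \<Rightarrow> ('k, 'h, ('b, 'b, 'k) tensor, 'k) arrow
    \<Rightarrow> ('k, 'h, 'k, ('b, 'b, 'k) tensor) arrow \<Rightarrow> bool" where
  "frobenius_algebra_in B m e cup cap \<longleftrightarrow> algebra_in B m e \<and>
     cup \<in> hom (B \<boxtimes> B) kmod \<and> cap \<in> hom kmod (B \<boxtimes> B) \<and>
     cup \<cdot> (m \<otimes> ident B) = cup \<cdot> (ident B \<otimes> m) \<cdot> assoc B B B \<and>
     cup_cap B cup cap = ident B \<and> cap_cup B cup cap = ident B"

definition frobenius_coalgebra_in ::
  "('k, 'b::ab_group_add, 'h) hmod \<Rightarrow> ('k, 'h, 'b, ('b, 'b, 'k) tensor) arrow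
    \<Rightarrow> ('k, 'h, 'b, 'k) arrow \<Rightarrow> ('k, 'h, ('b, 'b, 'k) tensor, 'k) arrow
    \<Rightarrow> ('k, 'h, 'k, ('b, 'b, 'k) tensor) arrow \<Rightarrow> bool" where
  "frobenius_coalgebra_in B d n cup cap \<longleftrightarrow> coalgebra_in B d n \<and>
     cup \<in> hom (B \<boxtimes> B) kmod \<and> cap \<in> hom kmod (B \<boxtimes> B) \<and>
     assoc B B B \<cdot> (d \<otimes> ident B) \<cdot> cap = (ident B \<otimes> d) \<cdot> cap \<and>
     cup_cap B cup cap = ident B \<and> cap_cup B cup cap = ident B"

text \<open>
  The associated structures: \<open>frob_comult\<close>, \<open>frob_counit\<close> are \<open>\<Delta>\<^sub>r, \<epsilon>\<^sub>r\<close> of a Frobenius algebra, and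
  \<open>frob_mult\<close>, \<open>frob_unit\<close> are \<open>\<mu>\<^sub>g, 1\<^sub>g\<close> of a Frobenius coalgebra.
\<close>

definition frob_comult ::
  "('k, 'b::ab_group_add, 'h) hmod \<Rightarrow> ('k, 'h, ('b, 'b, 'k) tensor, 'b) arrow
    \<Rightarrow> ('k, 'h, 'k, ('b, 'b, 'k) tensor) arrow \<Rightarrow> ('k, 'h, 'b, ('b, 'b, 'k) tensor) arrow" where
  "frob_comult B m cap = (ident B \<otimes> m) \<cdot> assoc B B B \<cdot> (cap \<otimes> ident B) \<cdot> lunit_inv B"

definition frob_counit ::
  "('k, 'b::ab_group_add, 'h) hmod \<Rightarrow> ('k, 'h, 'k, 'b) arrow
    \<Rightarrow> ('k, 'h, ('b, 'b, 'k) tensor, 'k) arrow \<Rightarrow> ('k, 'h, 'b, 'k) arrow" where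
  "frob_counit B e cup = cup \<cdot> (ident B \<otimes> e) \<cdot> runit_inv B"

definition frob_mult ::
  "('k, 'b::ab_group_add, 'h) hmod \<Rightarrow> ('k, 'h, 'b, ('b, 'b, 'k) tensor) arrow
    \<Rightarrow> ('k, 'h, ('b, 'b, 'k) tensor, 'k) arrow \<Rightarrow> ('k, 'h, ('b, 'b, 'k) tensor, 'b) arrow" where
  "frob_mult B d cup = runit B \<cdot> (ident B \<otimes> cup) \<cdot> assoc B B B \<cdot> (d \<otimes> ident B)"

definition frob_unit ::
  "('k, 'b::ab_group_add, 'h) hmod \<Rightarrow> ('k, 'h, 'b, 'k) arrow
    \<Rightarrow> ('k, 'h, 'k, ('b, 'b, 'k) tensor) arrow \<Rightarrow> ('k, 'h, 'k, 'b) arrow" where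
  "frob_unit B n cap = runit B \<cdot> (ident B \<otimes> n) \<cdot> cap"

definition F_algebra_in ::
  "('k, 'b::ab_group_add, 'h) hmod \<Rightarrow> ('k, 'h, ('b, 'b, 'k) tensor, 'b) arrow
    \<Rightarrow> ('k, 'h, 'k, 'b) arrow \<Rightarrow> ('k, 'h, 'b, ('b, 'b, 'k) tensor) arrow
    \<Rightarrow> ('k, 'h, 'b, 'k) arrow \<Rightarrow> bool" where
  "F_algebra_in B m e d n \<longleftrightarrow> algebra_in B m e \<and> coalgebra_in B d n \<and>
     (ident B \<otimes> m) \<cdot> assoc B B B \<cdot> (d \<otimes> ident B) = d \<cdot> m \<and>
     (m \<otimes> ident B) \<cdot> assoc_inv B B B \<cdot> (ident B \<otimes> d) = d \<cdot> m"


section \<open>Transmutation\<close>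

definition trm :: "('k, 'h, 'h) hmod" where
  "trm = \<lparr>car = UNIV, scl = scale H,
     act = (\<lambda>h x. sw H (comult H h) (\<lambda>h1 h2. h1 * x * antipode H h2))\<rparr>"

definition trm_mult :: "('k, 'h, ('h, 'h, 'k) tensor, 'h) arrow" where
  "trm_mult = arr (trm \<boxtimes> trm) trm (\<lambda>t. sw H t (\<lambda>a b. a * b))"

text \<open>The map \<open>k \<rightarrow> H\<close> defined by an element of \<open>H\<close>.\<close>

definition elem_arr :: "'h \<Rightarrow> ('k, 'h, 'k, 'h) arrow" where
  "elem_arr x = arr kmod trm (\<lambda>c. scale H c x)"

definition trm_unit :: "('k, 'h, 'k, 'h) arrow" where
  "trm_unit = elem_arr 1"

definition trm_comult :: "('k, 'h, 'h, ('h, 'h, 'k) tensor) arrow" where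
  "trm_comult = arr trm (trm \<boxtimes> trm)
     (\<lambda>h. sw H (comult H h) (\<lambda>h1 h2. sw H (rmat H)
        (\<lambda>r1 r2. tens2 H (h1 * antipode H r2) (act trm r1 h2))))"

definition trm_counit :: "('k, 'h, 'h, 'k) arrow" where
  "trm_counit = arr trm kmod (counit H)"

definition trm_antipode :: "('k, 'h, 'h, 'h) arrow" where
  "trm_antipode = arr trm trm
     (\<lambda>h. sw H (rmat H) (\<lambda>r1 r2. r2 * antipode H (act trm r1 h)))"

end

end

theory Submission
  imports Defs
begin

text \<open>
  Put \<open>P = \<R> \<R>\<^sub>2\<^sub>1\<close>. Since \<open>S \<otimes> S\<close> fixes \<open>\<R>\<close>, factorisability makes \<open>S\<close> bijective and
  \<open>\<phi> \<mapsto> \<phi>(P\<^sup>1) P\<^sup>2\<close> a bijection from \<open>H\<^sup>*\<close> onto \<open>H\<close>. Hexagon computations show that under it the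
  braided coproduct is dual to the product of \<open>H\<close>; coassociativity, counit and equivariance of the
  coproduct become properties of the product, and the functional corresponding to \<open>\<Lambda>\<close> is an
  invariant braided right integral. It is also an ordinary left integral on \<open>H\<close>, and so cannot vanish at \<open>\<Lambda>\<close>.
  Multiplicativity of the coproduct follows because
  \<open>a \<otimes> b \<mapsto> a \<R>\<^sup>2 \<otimes> \<R>\<^sup>1 \<triangleright> b\<close> is an algebra isomorphism from the braided to the ordinary tensor square
  that carries the braided coproduct to the ordinary one.

  With the integral \<open>J\<close> normalised by \<open>J \<Lambda> = 1\<close>, the Frobenius forms are \<open>J (x y)\<close> and
  \<open>J (S x \<cdot> y)\<close> (braided \<open>S\<close>), with copairings \<open>\<Lambda>\<^sub>1 \<otimes> S \<Lambda>\<^sub>2\<close> and \<open>\<Lambda>\<^sub>1 \<otimes> \<Lambda>\<^sub>2\<close>. The last Hopf algebra is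
  the categorical dual of the transmutation along \<open>J (x y)\<close>.

  Equations between tensors are tested on bilinear and trilinear scalar forms, which turns Sweedler
  calculus into rewriting under \<open>sw\<close> with linearity side conditions.
\<close>

section \<open>Tensor products of vector spaces\<close>

text \<open>\<open>P\<close> is used in place of the \<open>\<R>\<^sub>2\<^sub>1 \<R>\<close> of the
  definition of factorisability because it commutes with the opposite coproduct: the adjoint action
  on its first leg then moves to the second leg as
  \<open>y \<mapsto> S h\<^sub>1 y h\<^sub>2\<close>. The ordinary coproduct of the first leg of
  \<open>P\<close> gives two copies of \<open>P\<close>, one nested in the other, and the twist in
  the braided coproduct is what unnests them. The condition \<open>S \<Lambda> = \<Lambda>\<close>
  makes \<Lambda> a two-sided integral, and so invariant under the adjoint action. With braided
  coproduct and antipode, the identity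
  \<open>J (h \<Lambda>\<^sub>1) S \<Lambda>\<^sub>2 = h\<close> carries most of what follows: it
  exhibits a preimage of each \<open>h\<close> under the braided antipode, makes
  \<open>J (x y)\<close> nondegenerate and, by finite dimension, implies its mirror image. Every
  functional is then of the form \<open>y \<mapsto> J (x y)\<close>, so identities of the dual Hopf
  algebra are read off from those of the transmutation. Nested evaluation against
  \<open>\<mu>\<^sub>g\<close> leaves one copy of \<R> behind; \<Psi> supplies the copy that cancels
  it, which explains the braiding in the last Hopf algebra.\<close>

lemma linear_onI:
  assumes "\<And>x. x \<in> car V \<Longrightarrow> f x \<in> car W"
    and "\<And>x y. x \<in> car V \<Longrightarrow> y \<in> car V \<Longrightarrow> f (x + y) = f x + f y"
    and "\<And>c x. x \<in> car V \<Longrightarrow> f (scl V c x) = scl W c (f x)"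
  shows "linear_on V W f"
  using assms by (auto simp: linear_on_def)

lemma linear_onD:
  assumes "linear_on V W f"
  shows "x \<in> car V \<Longrightarrow> f x \<in> car W"
    and "x \<in> car V \<Longrightarrow> y \<in> car V \<Longrightarrow> f (x + y) = f x + f y"
    and "x \<in> car V \<Longrightarrow> f (scl V c x) = scl W c (f x)"
  using assms by (auto simp: linear_on_def)

lemma vspace_closed:
  assumes "is_vspace V"
  shows "0 \<in> car V" "x \<in> car V \<Longrightarrow> y \<in> car V \<Longrightarrow> x + y \<in> car V"
    "x \<in> car V \<Longrightarrow> scl V c x \<in> car V"
proof -
  interpret vector_space "scl V" using assms by (simp add: is_vspace_def)
  show "0 \<in> car V" "x \<in> car V \<Longrightarrow> y \<in> car V \<Longrightarrow> x + y \<in> car V"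
    "x \<in> car V \<Longrightarrow> scl V c x \<in> car V"
    using assms by (auto simp: is_vspace_def subspace_def)
qed

lemma vspace_scl:
  assumes "is_vspace V"
  shows "scl V c (x + y) = scl V c x + scl V c y" "scl V (c + d) x = scl V c x + scl V d x"
    "scl V c (scl V d x) = scl V (c * d) x" "scl V 1 x = x" "scl V 0 x = 0" "scl V c 0 = 0"
proof -
  interpret vector_space "scl V" using assms by (simp add: is_vspace_def)
  show "scl V c (x + y) = scl V c x + scl V c y" "scl V (c + d) x = scl V c x + scl V d x"
    "scl V c (scl V d x) = scl V (c * d) x" "scl V 1 x = x" "scl V 0 x = 0" "scl V c 0 = 0"
    by (simp_all add: scale_right_distrib scale_left_distrib)
qed

lemma linear_on_zero:
  assumes "is_vspace V" "is_vspace W" "linear_on V W f"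
  shows "f 0 = 0"
  using linear_onD(3)[OF assms(3) vspace_closed(1)[OF assms(1)], of 0]
  by (simp add: vspace_scl[OF assms(1)] vspace_scl[OF assms(2)])

lemma linear_on_comp:
  assumes "linear_on V W f" "linear_on W Z g"
  shows "linear_on V Z (\<lambda>x. g (f x))"
  using assms by (auto simp: linear_on_def)

lemma is_vspace_kspace [simp]: "is_vspace (kspace :: ('k::field, 'k) vspace)"
proof -
  interpret vector_space "(*) :: 'k \<Rightarrow> 'k \<Rightarrow> 'k" by unfold_locales (auto simp: algebra_simps)
  show ?thesis by (simp add: is_vspace_def kspace_def subspace_def vector_space_axioms)
qed

lemma kspace_simps [simp]: "car kspace = UNIV" "scl kspace = (*)"
  by (simp_all add: kspace_def)

lemma tprod_simps [simp]:
  "scl (tprod V W) = (\<lambda>c t \<beta>. c * t \<beta>)"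
  "car (tprod V W) = {\<Sum>(v, w)\<leftarrow>ps. tens V W v w |ps. set ps \<subseteq> car V \<times> car W}"
  by (simp_all add: tprod_def)

declare tprod_simps(2) [simp del]

lemma tens_in_tprod: "v \<in> car V \<Longrightarrow> w \<in> car W \<Longrightarrow> tens V W v w \<in> car (tprod V W)"
  unfolding tprod_simps by (rule CollectI, rule exI[of _ "[(v, w)]"]) simp

lemma bilinear_onD:
  assumes "bilinear_on V W U \<beta>"
  shows "v \<in> car V \<Longrightarrow> w \<in> car W \<Longrightarrow> \<beta> v w \<in> car U"
    and "v \<in> car V \<Longrightarrow> v' \<in> car V \<Longrightarrow> w \<in> car W \<Longrightarrow> \<beta> (v + v') w = \<beta> v w + \<beta> v' w"
    and "v \<in> car V \<Longrightarrow> w \<in> car W \<Longrightarrow> w' \<in> car W \<Longrightarrow> \<beta> v (w + w') = \<beta> v w + \<beta> v w'"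
    and "v \<in> car V \<Longrightarrow> w \<in> car W \<Longrightarrow> \<beta> (scl V c v) w = scl U c (\<beta> v w)"
    and "v \<in> car V \<Longrightarrow> w \<in> car W \<Longrightarrow> \<beta> v (scl W c w) = scl U c (\<beta> v w)"
  using assms by (auto simp: bilinear_on_def linear_on_def)

lemma bilinear_onI:
  assumes "\<And>v w. v \<in> car V \<Longrightarrow> w \<in> car W \<Longrightarrow> \<beta> v w \<in> car U"
    and "\<And>v v' w. v \<in> car V \<Longrightarrow> v' \<in> car V \<Longrightarrow> w \<in> car W \<Longrightarrow> \<beta> (v + v') w = \<beta> v w + \<beta> v' w"
    and "\<And>v w w'. v \<in> car V \<Longrightarrow> w \<in> car W \<Longrightarrow> w' \<in> car W \<Longrightarrow> \<beta> v (w + w') = \<beta> v w + \<beta> v w'"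
    and "\<And>c v w. v \<in> car V \<Longrightarrow> w \<in> car W \<Longrightarrow> \<beta> (scl V c v) w = scl U c (\<beta> v w)"
    and "\<And>c v w. v \<in> car V \<Longrightarrow> w \<in> car W \<Longrightarrow> \<beta> v (scl W c w) = scl U c (\<beta> v w)"
  shows "bilinear_on V W U \<beta>"
  using assms by (auto simp: bilinear_on_def linear_on_def)

lemma bilinear_tens: "bilinear_on V W (tprod V W) (tens V W)"
  by (rule bilinear_onI, erule (1) tens_in_tprod)
    (auto simp: tens_def fun_eq_iff dest: bilinear_onD)

lemma bilinear_on_pre:
  assumes "bilinear_on V' W' U \<beta>" "linear_on V V' f" "linear_on W W' g"
  shows "bilinear_on V W U (\<lambda>v w. \<beta> (f v) (g w))"
  by (rule bilinear_onI)
    (simp_all add: bilinear_onD[OF assms(1)] linear_onD[OF assms(2)] linear_onD[OF assms(3)])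

lemma sum_list_closed:
  assumes "is_vspace V" "\<And>x. x \<in> set xs \<Longrightarrow> f x \<in> car V"
  shows "(\<Sum>x\<leftarrow>xs. f x) \<in> car V"
  using assms(2) by (induction xs) (auto simp: vspace_closed[OF assms(1)])

lemma linear_on_sum_list:
  assumes "is_vspace V" "is_vspace W" "linear_on V W F" "\<And>x. x \<in> set xs \<Longrightarrow> f x \<in> car V"
  shows "F (\<Sum>x\<leftarrow>xs. f x) = (\<Sum>x\<leftarrow>xs. F (f x))"
  using assms(4)
  by (induction xs)
    (simp_all add: linear_on_zero[OF assms(1-3)] linear_onD(2)[OF assms(3)]
      sum_list_closed[OF assms(1)])

lemma is_vspace_tprod [simp]:
  assumes "is_vspace V"
  shows "is_vspace (tprod V W)"
proof -
  interpret P: vector_space "(\<lambda>c t \<beta>. c * t \<beta>) :: 'a \<Rightarrow> ('b, 'd, 'a) tensor \<Rightarrow> _"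
    by unfold_locales (auto simp: fun_eq_iff algebra_simps)
  have "P.subspace (car (tprod V W))"
  proof (rule P.subspaceI)
    show "0 \<in> car (tprod V W)"
      unfolding tprod_simps by (rule CollectI, rule exI[of _ "[]"]) simp
  next
    fix x y assume "x \<in> car (tprod V W)" "y \<in> car (tprod V W)"
    then obtain ps qs where "x = (\<Sum>(v, w)\<leftarrow>ps. tens V W v w)" "set ps \<subseteq> car V \<times> car W"
       "y = (\<Sum>(v, w)\<leftarrow>qs. tens V W v w)" "set qs \<subseteq> car V \<times> car W"
      unfolding tprod_simps by blast
    then show "x + y \<in> car (tprod V W)"
      unfolding tprod_simps by (intro CollectI exI[of _ "ps @ qs"]) simp
  next
    fix c x assume "x \<in> car (tprod V W)"
    then obtain ps where ps: "x = (\<Sum>(v, w)\<leftarrow>ps. tens V W v w)" "set ps \<subseteq> car V \<times> car W"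
      unfolding tprod_simps by blast
    have "(\<lambda>\<beta>. c * (\<Sum>(v, w)\<leftarrow>ps. tens V W v w) \<beta>)
        = (\<Sum>(v, w)\<leftarrow>map (\<lambda>(v, w). (scl V c v, w)) ps. tens V W v w)"
      using ps(2)
    proof (induction ps)
      case (Cons p ps)
      then show ?case
        using bilinear_onD(4)[OF bilinear_tens[of V W], of "fst p" "snd p" c]
        by (auto simp: fun_eq_iff case_prod_beta distrib_left)
    qed (simp add: fun_eq_iff)
    moreover have "set (map (\<lambda>(v, w). (scl V c v, w)) ps) \<subseteq> car V \<times> car W"
      using ps(2) by (auto simp: vspace_closed[OF assms])
    ultimately show "(\<lambda>\<beta>. c * x \<beta>) \<in> car (tprod V W)"
      unfolding ps(1) by (metis (mono_tags, lifting) CollectI tprod_simps(2))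
  qed
  then show ?thesis by (simp add: is_vspace_def P.vector_space_axioms)
qed

text \<open>The list chosen inside \<open>tsum\<close> depends on the tensor alone, so a single list
  serves all summands. The sum formula is stated for two value types because a linear map between
  different types has to be pushed through the same list.\<close>

lemma tsum_rep:
  obtains ps where "t \<in> car (tprod V W) \<Longrightarrow> set ps \<subseteq> car V \<times> car W"
    "t \<in> car (tprod V W) \<Longrightarrow> t = (\<Sum>(v, w)\<leftarrow>ps. tens V W v w)"
    "\<And>\<beta>::_ \<Rightarrow> _ \<Rightarrow> 'u::ab_group_add. tsum V W t \<beta> = (\<Sum>(v, w)\<leftarrow>ps. \<beta> v w)"
    "\<And>\<beta>::_ \<Rightarrow> _ \<Rightarrow> 'u'::ab_group_add. tsum V W t \<beta> = (\<Sum>(v, w)\<leftarrow>ps. \<beta> v w)"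
proof -
  define qs where
    "qs = (SOME qs. set qs \<subseteq> car V \<times> car W \<and> t = (\<Sum>(v, w)\<leftarrow>qs. tens V W v w))"
  have "set qs \<subseteq> car V \<times> car W \<and> t = (\<Sum>(v, w)\<leftarrow>qs. tens V W v w)"
    if "t \<in> car (tprod V W)"
    unfolding qs_def by (rule someI_ex) (use that in \<open>auto simp: tprod_simps(2)\<close>)
  then show ?thesis
    by (intro that[of qs]) (auto simp: tsum_def qs_def Let_def)
qed

lemma tsum_tensor:
  assumes "t \<in> car (tprod V W)"
  shows "tsum V W t (tens V W) = t"
proof -
  obtain ps where "t = (\<Sum>(v, w)\<leftarrow>ps. tens V W v w)"
    "tsum V W t (tens V W) = (\<Sum>(v, w)\<leftarrow>ps. tens V W v w)"
    using assms by (rule_tac tsum_rep[of t V W]) blast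
  then show ?thesis by simp
qed

lemma tsum_additive:
  fixes F :: "'u::ab_group_add \<Rightarrow> 'z::ab_group_add"
  assumes "F 0 = 0" "\<And>x y. F (x + y) = F x + F y"
  shows "F (tsum V W t \<beta>) = tsum V W t (\<lambda>v w. F (\<beta> v w))"
proof -
  obtain ps where ps: "\<And>\<beta>::_ \<Rightarrow> _ \<Rightarrow> 'u. tsum V W t \<beta> = (\<Sum>(v, w)\<leftarrow>ps. \<beta> v w)"
    "\<And>\<beta>::_ \<Rightarrow> _ \<Rightarrow> 'z. tsum V W t \<beta> = (\<Sum>(v, w)\<leftarrow>ps. \<beta> v w)"
    by (rule tsum_rep[of t V W]) blast
  show ?thesis unfolding ps by (induction ps) (auto simp: assms)
qed

lemma tsum_apply: "tsum V W t \<beta> x = tsum V W t (\<lambda>v w. \<beta> v w x)"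
  by (rule tsum_additive[where F = "\<lambda>f. f x"]) auto

lemma tsum_zero [simp]: "tsum V W t (\<lambda>v w. 0) = 0"
  using tsum_additive[of "\<lambda>_. 0" V W t] by simp

lemma tsum_plus:
  fixes \<beta> \<gamma> :: "'v::ab_group_add \<Rightarrow> 'w::ab_group_add \<Rightarrow> 'u::ab_group_add"
  shows "tsum V W t (\<lambda>v w. \<beta> v w + \<gamma> v w) = tsum V W t \<beta> + tsum V W t \<gamma>"
proof -
  obtain ps where ps: "\<And>\<beta>::_ \<Rightarrow> _ \<Rightarrow> 'u. tsum V W t \<beta> = (\<Sum>(v, w)\<leftarrow>ps. \<beta> v w)"
    by (rule tsum_rep[of t V W]) blast
  show ?thesis unfolding ps by (induction ps) (auto simp: algebra_simps)
qed

lemma tsum_swap: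
  fixes f :: "_ \<Rightarrow> _ \<Rightarrow> _ \<Rightarrow> _ \<Rightarrow> 'u::ab_group_add"
  shows "tsum V W s (\<lambda>a b. tsum V' W' t (\<lambda>c d. f a b c d)) =
   tsum V' W' t (\<lambda>c d. tsum V W s (\<lambda>a b. f a b c d))"
proof -
  obtain ps where ps: "\<And>\<beta>::_ \<Rightarrow> _ \<Rightarrow> 'u. tsum V W s \<beta> = (\<Sum>(v, w)\<leftarrow>ps. \<beta> v w)"
    by (rule tsum_rep[of s V W]) blast
  show ?thesis unfolding ps
    by (induction ps) (auto simp: tsum_plus)
qed

lemma tsum_cong:
  fixes \<beta> \<gamma> :: "'v::ab_group_add \<Rightarrow> 'w::ab_group_add \<Rightarrow> 'u::ab_group_add"
  assumes "t \<in> car (tprod V W)" "\<And>v w. v \<in> car V \<Longrightarrow> w \<in> car W \<Longrightarrow> \<beta> v w = \<gamma> v w"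
  shows "tsum V W t \<beta> = tsum V W t \<gamma>"
proof -
  obtain ps where ps: "\<And>\<beta>::_ \<Rightarrow> _ \<Rightarrow> 'u. tsum V W t \<beta> = (\<Sum>(v, w)\<leftarrow>ps. \<beta> v w)"
     "set ps \<subseteq> car V \<times> car W"
    using assms(1) by (rule_tac tsum_rep[of t V W]) blast
  show ?thesis unfolding ps(1) using ps(2) assms(2) by (induction ps) auto
qed

lemma tsum_closed:
  assumes "is_vspace U" "t \<in> car (tprod V W)"
    "\<And>v w. v \<in> car V \<Longrightarrow> w \<in> car W \<Longrightarrow> \<beta> v w \<in> car U"
  shows "tsum V W t \<beta> \<in> car U"
proof -
  obtain ps where ps: "tsum V W t \<beta> = (\<Sum>(v, w)\<leftarrow>ps. \<beta> v w)"
     "set ps \<subseteq> car V \<times> car W"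
    using assms(2) by (rule_tac tsum_rep[of t V W]) blast
  show ?thesis unfolding ps(1)
    by (rule sum_list_closed[OF assms(1)]) (use ps(2) assms(3) in auto)
qed

lemma tsum_linear_image:
  fixes F :: "'u::ab_group_add \<Rightarrow> 'z::ab_group_add"
  assumes "is_vspace U" "is_vspace Z" "linear_on U Z F" "t \<in> car (tprod V W)"
    "\<And>v w. v \<in> car V \<Longrightarrow> w \<in> car W \<Longrightarrow> \<beta> v w \<in> car U"
  shows "F (tsum V W t \<beta>) = tsum V W t (\<lambda>v w. F (\<beta> v w))"
proof -
  obtain ps where ps: "\<And>\<beta>::_ \<Rightarrow> _ \<Rightarrow> 'u. tsum V W t \<beta> = (\<Sum>(v, w)\<leftarrow>ps. \<beta> v w)"
    "\<And>\<beta>::_ \<Rightarrow> _ \<Rightarrow> 'z. tsum V W t \<beta> = (\<Sum>(v, w)\<leftarrow>ps. \<beta> v w)" "set ps \<subseteq> car V \<times> car W"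
    using assms(4) by (rule_tac tsum_rep[of t V W]) blast
  show ?thesis unfolding ps
    by (subst linear_on_sum_list[OF assms(1-3)])
      (use ps(3) assms(5) in \<open>auto simp: split_def\<close>)
qed

lemma tsum_pure:
  assumes "is_vspace U" "bilinear_on V W U \<beta>" "v \<in> car V" "w \<in> car W"
  shows "tsum V W (tens V W v w) \<beta> = \<beta> v w"
  using tsum_tens[OF assms(1,2), of "[(v, w)]"] assms(3,4) by simp

lemma linear_on_tsum:
  assumes V: "is_vspace V" and U: "is_vspace U" and b: "bilinear_on V W U \<beta>"
  shows "linear_on (tprod V W) U (\<lambda>t. tsum V W t \<beta>)"
proof (rule linear_onI)
  fix t assume "t \<in> car (tprod V W)"
  then show "tsum V W t \<beta> \<in> car U"
    by (rule tsum_closed[OF U]) (rule bilinear_onD(1)[OF b])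
next
  fix s t assume "s \<in> car (tprod V W)" "t \<in> car (tprod V W)"
  then obtain ps qs where ps: "s = (\<Sum>(v, w)\<leftarrow>ps. tens V W v w)" "set ps \<subseteq> car V \<times> car W"
       "t = (\<Sum>(v, w)\<leftarrow>qs. tens V W v w)" "set qs \<subseteq> car V \<times> car W"
    unfolding tprod_simps by blast
  show "tsum V W (s + t) \<beta> = tsum V W s \<beta> + tsum V W t \<beta>"
    using tsum_tens[OF U b, of "ps @ qs"] tsum_tens[OF U b, of ps] tsum_tens[OF U b, of qs] ps
    by simp
next
  fix c t assume t: "t \<in> car (tprod V W)"
  then obtain ps where ps: "t = (\<Sum>(v, w)\<leftarrow>ps. tens V W v w)" "set ps \<subseteq> car V \<times> car W"
    unfolding tprod_simps by blast
  have 1: "(\<lambda>\<gamma>. c * t \<gamma>) = (\<Sum>(v, w)\<leftarrow>map (\<lambda>(v, w). (scl V c v, w)) ps. tens V W v w)"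
    unfolding ps(1) using ps(2)
  proof (induction ps)
    case (Cons p ps)
    then show ?case
      using bilinear_onD(4)[OF bilinear_tens[of V W], of "fst p" "snd p" c]
      by (auto simp: fun_eq_iff case_prod_beta distrib_left)
  qed (simp add: fun_eq_iff)
  have "set (map (\<lambda>(v, w). (scl V c v, w)) ps) \<subseteq> car V \<times> car W"
    using ps(2) by (auto simp: vspace_closed[OF V])
  from tsum_tens[OF U b this]
  have "tsum V W (\<lambda>\<gamma>. c * t \<gamma>) \<beta> = (\<Sum>(v, w)\<leftarrow>ps. \<beta> (scl V c v) w)"
    unfolding 1 by (simp add: split_def o_def)
  also have "\<dots> = scl U c (\<Sum>(v, w)\<leftarrow>ps. \<beta> v w)"
    using ps(2) by (induction ps) (auto simp: vspace_scl[OF U] bilinear_onD(4)[OF b])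
  finally show "tsum V W (scl (tprod V W) c t) \<beta> = scl U c (tsum V W t \<beta>)"
    using tsum_tens[OF U b ps(2)] ps(1) by simp
qed

lemma linear_on_tprod_eq:
  assumes "is_vspace V" "is_vspace U" "linear_on (tprod V W) U F" "linear_on (tprod V W) U G"
    and "\<And>v w. v \<in> car V \<Longrightarrow> w \<in> car W \<Longrightarrow> F (tens V W v w) = G (tens V W v w)"
    and "t \<in> car (tprod V W)"
  shows "F t = G t"
proof -
  have "F (tsum V W t (tens V W)) = G (tsum V W t (tens V W))"
    using assms by (auto simp: tsum_linear_image[OF is_vspace_tprod] tens_in_tprod intro!: tsum_cong)
  then show ?thesis by (simp add: tsum_tensor assms)
qed

text \<open>A tensor is itself a function on bilinear forms, so for scalar summands the Sweedler sum
  is application of the tensor. This removes the choice of a representation from all later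
  computations.\<close>

lemma tsum_eval:
  assumes "t \<in> car (tprod V W)" "bilinear_on V W kspace \<beta>"
  shows "tsum V W t \<beta> = t \<beta>"
proof -
  have "t \<beta> = tsum V W t (tens V W) \<beta>" by (simp add: tsum_tensor assms)
  also have "\<dots> = tsum V W t \<beta>"
    using assms by (simp add: tsum_apply) (simp add: tens_def assms(2))
  finally show ?thesis ..
qed

text \<open>Pure tensors take the default value \<open>0\<close> outside the bilinear forms, and so
  do their sums; bilinear forms alone therefore decide equality of functions.\<close>

lemma tensor_eqI:
  assumes "s \<in> car (tprod V W)" "t \<in> car (tprod V W)"
    and "\<And>\<beta>. bilinear_on V W kspace \<beta> \<Longrightarrow> s \<beta> = t \<beta>"
  shows "s = t"
proof
  fix \<beta>
  have *: "u \<beta> = 0" if "u \<in> car (tprod V W)" "\<not> bilinear_on V W kspace \<beta>" for u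
  proof -
    have "u \<beta> = tsum V W u (tens V W) \<beta>" by (simp add: tsum_tensor that)
    also have "\<dots> = 0" using that(2) by (simp add: tsum_apply tens_def)
    finally show ?thesis .
  qed
  show "s \<beta> = t \<beta>"
    using assms(3) *[OF assms(1)] *[OF assms(2)] by (cases "bilinear_on V W kspace \<beta>") auto
qed

section \<open>Sweedler calculus with scalar test functionals\<close>

locale quasitriangular_hopf =
  fixes H :: "('k::field, 'h::ring_1) qtha"
  assumes quasitriangular: "is_quasitriangular H"
begin

abbreviation sc :: "'k \<Rightarrow> 'h \<Rightarrow> 'h" where "sc \<equiv> scale H"
abbreviation eps :: "'h \<Rightarrow> 'k" where "eps \<equiv> counit H"
abbreviation S :: "'h \<Rightarrow> 'h" where "S \<equiv> antipode H"
abbreviation D :: "'h \<Rightarrow> ('h \<Rightarrow> 'h \<Rightarrow> 'u::ab_group_add) \<Rightarrow> 'u" where "D h \<equiv> sw H (comult H h)"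
abbreviation RS :: "('h \<Rightarrow> 'h \<Rightarrow> 'u::ab_group_add) \<Rightarrow> 'u" where "RS \<equiv> sw H (rmat H)"
abbreviation HH :: "('k, ('h, 'h, 'k) tensor) vspace" where "HH \<equiv> tprod (Hsp H) (Hsp H)"

text \<open>Linearity as predicates on functions: test forms are lambda terms, and the rules
  collected in \<open>lin\<close> and its extensions establish their linearity by recursion on the
  term.\<close>

definition lf :: "('h \<Rightarrow> 'k) \<Rightarrow> bool" where "lf = linear_on (Hsp H) kspace"
definition le :: "('h \<Rightarrow> 'h) \<Rightarrow> bool" where "le = linear_on (Hsp H) (Hsp H)"
definition bil :: "('h \<Rightarrow> 'h \<Rightarrow> 'k) \<Rightarrow> bool" where
  "bil \<beta> \<longleftrightarrow> (\<forall>y. lf (\<lambda>x. \<beta> x y)) \<and> (\<forall>x. lf (\<lambda>y. \<beta> x y))"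
definition tri :: "('h \<Rightarrow> 'h \<Rightarrow> 'h \<Rightarrow> 'k) \<Rightarrow> bool" where
  "tri \<gamma> \<longleftrightarrow> (\<forall>y z. lf (\<lambda>x. \<gamma> x y z)) \<and> (\<forall>x z. lf (\<lambda>y. \<gamma> x y z)) \<and> (\<forall>x y. lf (\<lambda>z. \<gamma> x y z))"

lemma Hsp_simps [simp]: "car (Hsp H) = UNIV" "scl (Hsp H) = sc"
  by (simp_all add: Hsp_def)

lemma hopf: "is_hopf_algebra H" using quasitriangular by (simp add: is_quasitriangular_def)
lemma algebra: "is_algebra H" using hopf by (simp add: is_hopf_algebra_def)
lemma vs: "vector_space sc" using algebra by (simp add: is_algebra_def)
lemma is_vspace_Hsp [simp]: "is_vspace (Hsp H)"
proof -
  interpret vector_space sc by (rule vs)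
  show ?thesis by (simp add: is_vspace_def vs subspace_def)
qed

sublocale vector_space sc by (rule vs)

lemma sc_mult [simp]: "sc c a * b = sc c (a * b)" "a * sc c b = sc c (a * b)"
  using algebra by (auto simp: is_algebra_def)

lemma lf_iff: "lf \<phi> \<longleftrightarrow> (\<forall>x y. \<phi> (x + y) = \<phi> x + \<phi> y) \<and> (\<forall>c x. \<phi> (sc c x) = c * \<phi> x)"
  by (auto simp: lf_def linear_on_def)

lemma le_iff: "le \<phi> \<longleftrightarrow> (\<forall>x y. \<phi> (x + y) = \<phi> x + \<phi> y) \<and> (\<forall>c x. \<phi> (sc c x) = sc c (\<phi> x))"
  by (auto simp: le_def linear_on_def)

lemma lf_linear: "lf \<phi> \<longleftrightarrow> Vector_Spaces.linear sc (*) \<phi>"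
proof -
  interpret P: vector_space "(*) :: 'k \<Rightarrow> 'k \<Rightarrow> 'k"
    by unfold_locales (auto simp: algebra_simps)
  show ?thesis
    by (auto simp: lf_iff Vector_Spaces.linear_def module_hom_def module_hom_axioms_def
        vector_space_axioms P.vector_space_axioms module_axioms P.module_axioms)
qed

lemma lfD: "lf \<phi> \<Longrightarrow> \<phi> (x + y) = \<phi> x + \<phi> y" "lf \<phi> \<Longrightarrow> \<phi> (sc c x) = c * \<phi> x"
  by (auto simp: lf_iff)

lemma lf_zero: "lf \<phi> \<Longrightarrow> \<phi> 0 = 0"
  using lfD(2)[of \<phi> 0 0] by simp

lemma leD: "le f \<Longrightarrow> f (x + y) = f x + f y" "le f \<Longrightarrow> f (sc c x) = sc c (f x)"
  by (auto simp: le_iff)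

lemma le_zero: "le \<phi> \<Longrightarrow> \<phi> 0 = 0"
  using leD(2)[of \<phi> 0 0] by simp

text \<open>A nonzero \<open>x - y\<close> is independent, so some functional takes the value
  \<open>1\<close> on it. Equations in \<open>H\<close> thereby become equations of scalars, and
  Sweedler sums can be kept scalar-valued.\<close>

lemma lf_separate:
  assumes "\<And>\<phi>. lf \<phi> \<Longrightarrow> \<phi> x = \<phi> y"
  shows "x = y"
proof (rule ccontr)
  interpret P: vector_space_pair sc "(*) :: 'k \<Rightarrow> 'k \<Rightarrow> 'k"
    by unfold_locales (auto simp: algebra_simps)
  assume "x \<noteq> y"
  then have "independent {x - y}" by simp
  from P.linear_independent_extend[OF this, of "\<lambda>_. 1"]
  obtain \<phi> where \<phi>: "Vector_Spaces.linear sc (*) \<phi>" "\<phi> (x - y) = 1" by auto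
  then have "\<phi> (y + (x - y)) = \<phi> y + \<phi> (x - y)" using lf_linear lfD(1) by blast
  moreover have "\<phi> x = \<phi> y" using assms \<phi>(1) lf_linear by blast
  ultimately show False using \<phi>(2) by simp
qed

lemma bil_bilinear: "bil \<beta> \<longleftrightarrow> bilinear_on (Hsp H) (Hsp H) kspace \<beta>"
  by (auto simp: bil_def bilinear_on_def lf_def)

lemma comult_in: "comult H h \<in> car HH"
  using hopf by (auto simp: is_hopf_algebra_def linear_on_def)

lemma rmat_in: "rmat H \<in> car HH"
  using quasitriangular by (auto simp: is_quasitriangular_def)

lemma sw_apply: "sw H t f x = sw H t (\<lambda>a b. f a b x)"
  by (simp add: sw_def tsum_apply)

lemma sw_swap: "sw H s (\<lambda>a b. sw H t (\<lambda>c d. f a b c d)) = sw H t (\<lambda>c d. sw H s (\<lambda>a b. f a b c d))"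
  unfolding sw_def by (rule tsum_swap)

lemma sw_lf: "lf \<phi> \<Longrightarrow> \<phi> (sw H t f) = sw H t (\<lambda>a b. \<phi> (f a b))"
  unfolding sw_def by (rule tsum_additive) (auto simp: lfD lf_zero)

lemma sw_cmult:
  fixes c :: 'k
  shows "c * sw H t f = sw H t (\<lambda>a b. c * f a b)" "sw H t f * c = sw H t (\<lambda>a b. f a b * c)"
  unfolding sw_def by (rule tsum_additive; simp add: algebra_simps)+

lemma sw_plus: "sw H t (\<lambda>a b. f a b + g a b) = sw H t f + sw H t g"
  unfolding sw_def by (rule tsum_plus)

lemma sw_zero [simp]: "sw H t (\<lambda>a b. 0) = 0"
  by (simp add: sw_def)

lemma sw_eval: "t \<in> car HH \<Longrightarrow> bil \<beta> \<Longrightarrow> sw H t \<beta> = t \<beta>"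
  unfolding sw_def bil_bilinear by (rule tsum_eval)

lemma sw_tensor: "t \<in> car HH \<Longrightarrow> sw H t (tens2 H) = t"
  unfolding sw_def tens2_def by (rule tsum_tensor)

lemma tens2_eval: "bil \<beta> \<Longrightarrow> tens2 H a b \<beta> = \<beta> a b"
  by (simp add: tens2_def tens_def bil_bilinear)

lemma tens2_in: "tens2 H a b \<in> car HH"
  by (simp add: tens2_def tens_in_tprod)

lemma sw_in: "(\<And>a b. f a b \<in> car HH) \<Longrightarrow> t \<in> car HH \<Longrightarrow> sw H t f \<in> car HH"
  unfolding sw_def by (rule tsum_closed) auto

lemma sw_tens2: "bil \<beta> \<Longrightarrow> sw H (tens2 H a b) \<beta> = \<beta> a b"
  by (simp add: sw_eval tens2_in tens2_eval)

lemma HH_eqI: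
  assumes "s \<in> car HH" "t \<in> car HH" "\<And>\<beta>. bil \<beta> \<Longrightarrow> sw H s \<beta> = sw H t \<beta>"
  shows "s = t"
  by (rule tensor_eqI[OF assms(1,2)]) (use assms in \<open>simp add: bil_bilinear[symmetric] sw_eval\<close>)

lemma sw_cong: "(\<And>a b. f a b = g a b) \<Longrightarrow> sw H t f = sw H t g"
  by presburger

lemma lf_comp: "lf \<phi> \<Longrightarrow> le f \<Longrightarrow> lf (\<lambda>x. \<phi> (f x))"
  by (auto simp: lf_iff le_iff)
lemma le_comp: "le \<phi> \<Longrightarrow> le f \<Longrightarrow> le (\<lambda>x. \<phi> (f x))"
  by (auto simp: le_iff)
lemma bil_1: "bil \<beta> \<Longrightarrow> le f \<Longrightarrow> lf (\<lambda>x. \<beta> (f x) c)"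
  using lf_comp[of "\<lambda>x. \<beta> x c" f] by (auto simp: bil_def)
lemma bil_2: "bil \<beta> \<Longrightarrow> le f \<Longrightarrow> lf (\<lambda>x. \<beta> c (f x))"
  using lf_comp[of "\<lambda>x. \<beta> c x" f] by (auto simp: bil_def)
lemma tri_1: "tri \<beta> \<Longrightarrow> le f \<Longrightarrow> lf (\<lambda>x. \<beta> (f x) c d)"
  using lf_comp[of "\<lambda>x. \<beta> x c d" f] by (auto simp: tri_def)
lemma tri_2: "tri \<beta> \<Longrightarrow> le f \<Longrightarrow> lf (\<lambda>x. \<beta> c (f x) d)"
  using lf_comp[of "\<lambda>x. \<beta> c x d" f] by (auto simp: tri_def)
lemma tri_3: "tri \<beta> \<Longrightarrow> le f \<Longrightarrow> lf (\<lambda>x. \<beta> c d (f x))"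
  using lf_comp[of "\<lambda>x. \<beta> c d x" f] by (auto simp: tri_def)
lemmas bil_lin = bil_1 bil_2
lemmas tri_lin = tri_1 tri_2 tri_3

lemma bilI: "(\<And>y. lf (\<lambda>x. \<beta> x y)) \<Longrightarrow> (\<And>x. lf (\<lambda>y. \<beta> x y)) \<Longrightarrow> bil \<beta>"
  by (auto simp: bil_def)
lemma triI:
  "(\<And>y z. lf (\<lambda>x. \<gamma> x y z)) \<Longrightarrow> (\<And>x z. lf (\<lambda>y. \<gamma> x y z)) \<Longrightarrow> (\<And>x y. lf (\<lambda>z. \<gamma> x y z)) \<Longrightarrow> tri \<gamma>"
  by (auto simp: tri_def)

lemma le_id: "le (\<lambda>x. x)" by (auto simp: le_iff)
lemma le_mult_r: "le f \<Longrightarrow> le (\<lambda>x. f x * c)" by (auto simp: le_iff algebra_simps)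
lemma le_mult_l: "le f \<Longrightarrow> le (\<lambda>x. c * f x)" by (auto simp: le_iff algebra_simps)
lemma le_S: "le f \<Longrightarrow> le (\<lambda>x. S (f x))"
  using hopf by (auto simp: is_hopf_algebra_def le_def[symmetric] intro: le_comp)
lemma lf_mult_r: "lf f \<Longrightarrow> lf (\<lambda>x. f x * c)" by (auto simp: lf_iff algebra_simps)
lemma lf_mult_l: "lf f \<Longrightarrow> lf (\<lambda>x. c * f x)" by (auto simp: lf_iff algebra_simps)
lemma lf_eps: "le f \<Longrightarrow> lf (\<lambda>x. eps (f x))"
  using hopf by (auto simp: is_hopf_algebra_def lf_def[symmetric] intro: lf_comp)
text \<open>Here the tensor varies with \<open>x\<close>, and a Sweedler sum is additive in its
  tensor when the summand is bilinear. In \<open>lf_sw\<close> the tensor is fixed and linearity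
  passes to the sum termwise.\<close>

lemma lf_D: "le f \<Longrightarrow> bil \<beta> \<Longrightarrow> lf (\<lambda>x. D (f x) \<beta>)"
proof -
  assume f: "le f" and b: "bil \<beta>"
  have "linear_on (Hsp H) HH (comult H)" using hopf by (simp add: is_hopf_algebra_def)
  then have "linear_on (Hsp H) kspace (\<lambda>x. D x \<beta>)"
    unfolding sw_def
    by (rule linear_on_comp) (rule linear_on_tsum, use b in \<open>auto simp: bil_bilinear\<close>)
  then show ?thesis using lf_comp f by (simp add: lf_def[symmetric])
qed
lemma lf_sw: "(\<And>a b. lf (\<lambda>x. \<gamma> x a b)) \<Longrightarrow> lf (\<lambda>x. sw H t (\<lambda>a b. \<gamma> x a b))"
  by (auto simp: lf_iff sw_plus[symmetric] sw_cmult intro!: sw_cong)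
lemma sw_sc: "sc c (sw H t f) = sw H t (\<lambda>a b. sc c (f a b))"
  unfolding sw_def by (rule tsum_additive) (auto simp: scale_right_distrib)
lemma le_sw: "(\<And>a b. le (\<lambda>x. \<gamma> x a b)) \<Longrightarrow> le (\<lambda>x. sw H t (\<lambda>a b. \<gamma> x a b))"
  by (auto simp: le_iff sw_plus[symmetric] sw_sc intro!: sw_cong)
lemma le_sc: "le f \<Longrightarrow> le (\<lambda>x. sc c (f x))"
  by (auto simp: le_iff scale_right_distrib mult.commute)
lemma le_sc': "lf f \<Longrightarrow> le (\<lambda>x. sc (f x) c)"
  by (auto simp: le_iff lf_iff scale_left_distrib)

lemmas lin = bilI triI le_id le_mult_r le_mult_l le_S lf_mult_r lf_mult_l lf_eps lf_D lf_sw le_sw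
  le_sc le_sc'

text \<open>An element of \<open>H \<otimes> (H \<otimes> H)\<close> is a function on bilinear forms
  on \<open>H\<close> and \<open>H \<otimes> H\<close>; a trilinear \<gamma> induces such a form by
  Sweedler summation in the second argument. Axioms about threefold tensors are turned into
  statements about trilinear forms in this way.\<close>

lemma tens3_eval:
  assumes g: "tri \<gamma>"
  shows "tens3 H a b c (\<lambda>a t. sw H t (\<gamma> a)) = \<gamma> a b c"
proof -
  let ?G = "\<lambda>a t. sw H t (\<gamma> a)"
  have lin': "linear_on HH kspace (?G a)" for a
    unfolding sw_def
    by (rule linear_on_tsum) (simp_all add: bil_bilinear[symmetric], intro lin tri_lin[OF g])
  have "bilinear_on (Hsp H) HH kspace ?G"
    unfolding bilinear_on_def lf_def[symmetric]
    by (intro conjI ballI lin') (intro lf_sw tri_lin[OF g] le_id)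
  then show ?thesis
    by (simp add: tens3_def tens_def) (rule sw_tens2, intro lin tri_lin[OF g])
qed

section \<open>The Hopf algebra axioms in scalar form\<close>

lemma D_coassoc:
  assumes g: "tri \<gamma>"
  shows "D h (\<lambda>a b. D a (\<lambda>c d. \<gamma> c d b)) = D h (\<lambda>a b. D b (\<lambda>c d. \<gamma> a c d))"
proof -
  let ?G = "\<lambda>a t. sw H t (\<gamma> a)"
  have "D h (\<lambda>a b. D a (\<lambda>a1 a2. tens3 H a1 a2 b)) ?G = D h (\<lambda>a b. D b (\<lambda>b1 b2. tens3 H a b1 b2)) ?G"
    using hopf by (simp add: is_hopf_algebra_def)
  then show ?thesis by (simp add: sw_apply tens3_eval[OF g])
qed

lemma D_counit_l: "lf \<phi> \<Longrightarrow> D h (\<lambda>a b. eps a * \<phi> b) = \<phi> h"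
proof -
  assume "lf \<phi>"
  then have "\<phi> (D h (\<lambda>a b. sc (eps a) b)) = D h (\<lambda>a b. eps a * \<phi> b)"
    by (simp add: sw_lf lfD)
  then show ?thesis using hopf by (simp add: is_hopf_algebra_def)
qed

lemma D_counit_r: "lf \<phi> \<Longrightarrow> D h (\<lambda>a b. \<phi> a * eps b) = \<phi> h"
proof -
  assume "lf \<phi>"
  then have "\<phi> (D h (\<lambda>a b. sc (eps b) a)) = D h (\<lambda>a b. \<phi> a * eps b)"
    by (simp add: sw_lf lfD mult.commute)
  then show ?thesis using hopf by (simp add: is_hopf_algebra_def)
qed

lemma D_mult:
  assumes "bil \<beta>"
  shows "D (g * h) \<beta> = D g (\<lambda>a b. D h (\<lambda>c d. \<beta> (a * c) (b * d)))"
proof -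
  have "D (g * h) \<beta> = tmult H (comult H g) (comult H h) \<beta>"
    using hopf comult_in[of "g * h"] by (simp only: sw_eval[OF comult_in assms]) (simp only: is_hopf_algebra_def)
  then show ?thesis by (simp add: tmult_def sw_apply tens2_eval assms)
qed

lemma D_one: "bil \<beta> \<Longrightarrow> D 1 \<beta> = \<beta> 1 1"
  using hopf by (simp add: sw_tens2 is_hopf_algebra_def)

lemma eps_mult [simp]: "eps (g * h) = eps g * eps h" "eps 1 = 1"
  using hopf by (auto simp: is_hopf_algebra_def)

lemma S_l: "lf \<phi> \<Longrightarrow> D h (\<lambda>a b. \<phi> (S a * b)) = eps h * \<phi> 1"
proof -
  assume "lf \<phi>"
  then have "\<phi> (D h (\<lambda>a b. S a * b)) = D h (\<lambda>a b. \<phi> (S a * b))" by (simp add: sw_lf)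
  then show ?thesis using hopf \<open>lf \<phi>\<close> by (simp add: is_hopf_algebra_def lfD)
qed

lemma S_r: "lf \<phi> \<Longrightarrow> D h (\<lambda>a b. \<phi> (a * S b)) = eps h * \<phi> 1"
proof -
  assume "lf \<phi>"
  then have "\<phi> (D h (\<lambda>a b. a * S b)) = D h (\<lambda>a b. \<phi> (a * S b))" by (simp add: sw_lf)
  then show ?thesis using hopf \<open>lf \<phi>\<close> by (simp add: is_hopf_algebra_def lfD)
qed

lemma S_1 [simp]: "S 1 = 1"
proof (rule lf_separate)
  fix \<phi> assume f: "lf \<phi>"
  have "D 1 (\<lambda>a b. \<phi> (S a * b)) = \<phi> (S 1 * 1)"
    by (rule D_one) (intro lin lf_comp[OF f])
  then show "\<phi> (S 1) = \<phi> 1" by (simp add: S_l f)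
qed

lemma eps_S [simp]: "eps (S h) = eps h"
proof -
  have "D h (\<lambda>a b. eps (S a) * eps b) = eps (S h)" by (rule D_counit_r) (intro lin)
  moreover have "D h (\<lambda>a b. eps (S a * b)) = eps h * eps 1" by (rule S_l) (intro lin)
  ultimately show ?thesis by simp
qed

text \<open>Uniqueness of convolution inverses, written out:
  \<open>g\<^sub>2 h\<^sub>2 S h\<^sub>3 S g\<^sub>3\<close> is inserted behind
  \<open>S (g\<^sub>1 h\<^sub>1)\<close>, which then cancels against
  \<open>g\<^sub>2 h\<^sub>2\<close> and leaves \<open>S h S g\<close>.\<close>

lemma S_mult: "S (g * h) = S h * S g"
proof (rule lf_separate)
  fix \<phi> assume f: "lf \<phi>"
  note l = lin lf_comp[OF f]
  have "\<phi> (S (g * h)) = D g (\<lambda>a p. D h (\<lambda>d q. \<phi> (S (a * d)) * eps q) * eps p)"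
    by (subst D_counit_r, intro l)+ simp
  also have "\<dots> = D g (\<lambda>a p. D h (\<lambda>d q. (eps p * \<phi> (S (a * d) * 1)) * eps q))"
    by (simp add: sw_cmult mult_ac)
  also have "\<dots> = D g (\<lambda>a p. D h (\<lambda>d q. D p (\<lambda>b c. \<phi> (S (a * d) * (b * S c))) * eps q))"
    by (subst S_r, intro l) simp
  also have "\<dots> = D g (\<lambda>a p. D p (\<lambda>b c. D h (\<lambda>d q. \<phi> (S (a * d) * (b * S c)) * eps q)))"
    by (simp add: sw_cmult sw_swap[of "comult H h"])
  also have "\<dots> = D g (\<lambda>a p. D p (\<lambda>b c. D h (\<lambda>d q. D q (\<lambda>e f. \<phi> (S (a * d) * (b * (e * S f) * S c))))))"
    by (subst S_r, intro l) (simp add: mult_ac)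
  also have "\<dots> = D g (\<lambda>a p. D p (\<lambda>b c. D h (\<lambda>d q. D d (\<lambda>e f. \<phi> (S (a * e) * (b * (f * S q) * S c))))))"
    by (subst D_coassoc[where \<gamma> = "\<lambda>d e f. \<phi> (S (_ * d) * (_ * (e * S f) * S _))"], intro l) simp
  also have "\<dots> = D g (\<lambda>p c. D p (\<lambda>a b. D h (\<lambda>d q. D d (\<lambda>e f. \<phi> (S (a * e) * (b * (f * S q) * S c))))))"
    by (rule D_coassoc[symmetric]) (intro l)
  also have "\<dots> = D g (\<lambda>p c. D h (\<lambda>d q. D p (\<lambda>a b. D d (\<lambda>e f. \<phi> (S (a * e) * (b * f) * (S q * S c))))))"
    by (simp add: mult.assoc) (subst sw_swap, rule refl)
  also have "\<dots> = D g (\<lambda>p c. D h (\<lambda>d q. D (p * d) (\<lambda>a b. \<phi> (S a * b * (S q * S c)))))"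
    by (subst D_mult, intro l) simp
  also have "\<dots> = D g (\<lambda>p c. D h (\<lambda>d q. eps p * (eps d * \<phi> (S q * S c))))"
    by (subst S_l[where \<phi> = "\<lambda>x. \<phi> (x * _)"], intro l) (simp add: mult_ac)
  also have "\<dots> = D g (\<lambda>p c. eps p * \<phi> (S h * S c))"
    by (simp add: sw_cmult[symmetric]) (subst D_counit_l, intro l, simp)
  also have "\<dots> = \<phi> (S h * S g)"
    by (rule D_counit_l) (intro l)
  finally show "\<phi> (S (g * h)) = \<phi> (S h * S g)" .
qed

end

section \<open>The universal R-matrix\<close>

context quasitriangular_hopf
begin

lemma sw_sw:
  assumes "t \<in> car HH" "\<And>a b. f a b \<in> car HH" "bil \<beta>"
  shows "sw H (sw H t f) \<beta> = sw H t (\<lambda>a b. sw H (f a b) \<beta>)"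
  by (simp add: sw_eval assms sw_in sw_apply)

lemma sw_tmult:
  assumes "s \<in> car HH" "t \<in> car HH" "bil \<beta>"
  shows "sw H (tmult H s t) \<beta> = sw H s (\<lambda>a b. sw H t (\<lambda>c d. \<beta> (a * c) (b * d)))"
  by (simp add: tmult_def sw_sw assms sw_in tens2_in sw_tens2)

lemma R_intertwines:
  assumes b: "bil \<beta>"
  shows "D h (\<lambda>a b. RS (\<lambda>r s. \<beta> (b * r) (a * s))) = RS (\<lambda>r s. D h (\<lambda>a b. \<beta> (r * a) (s * b)))"
proof -
  note l = lin bil_lin[OF b]
  have t: "sw H (comult H h) (\<lambda>a b. tens2 H b a) \<in> car HH"
    by (rule sw_in) (simp_all add: tens2_in comult_in)
  have "sw H (tmult H (sw H (comult H h) (\<lambda>a b. tens2 H b a)) (rmat H)) \<beta>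
      = sw H (tmult H (rmat H) (comult H h)) \<beta>"
    using quasitriangular by (simp add: is_quasitriangular_def)
  then show ?thesis
    unfolding sw_tmult[OF t rmat_in b] sw_tmult[OF rmat_in comult_in b]
    by (subst (asm) sw_sw; (intro l)?) (simp_all add: comult_in tens2_in, subst (asm) sw_tens2, intro l)
qed

lemma R_hex1:
  assumes g: "tri \<gamma>"
  shows "RS (\<lambda>r s. D r (\<lambda>a b. \<gamma> a b s)) = RS (\<lambda>r s. RS (\<lambda>p q. \<gamma> r p (s * q)))"
proof -
  let ?G = "\<lambda>a t. sw H t (\<gamma> a)"
  have eq: "RS (\<lambda>a b. D a (\<lambda>a1 a2. tens3 H a1 a2 b)) ?G = RS (\<lambda>a b. RS (\<lambda>c d. tens3 H a c (b * d))) ?G"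
    using quasitriangular by (simp add: is_quasitriangular_def)
  show ?thesis using eq by (simp add: sw_apply tens3_eval[OF g])
qed

lemma R_hex2:
  assumes g: "tri \<gamma>"
  shows "RS (\<lambda>r s. D s (\<lambda>a b. \<gamma> r a b)) = RS (\<lambda>r s. RS (\<lambda>p q. \<gamma> (r * p) q s))"
proof -
  let ?G = "\<lambda>a t. sw H t (\<gamma> a)"
  have eq: "RS (\<lambda>a b. D b (\<lambda>b1 b2. tens3 H a b1 b2)) ?G = RS (\<lambda>a b. RS (\<lambda>c d. tens3 H (a * c) d b)) ?G"
    using quasitriangular by (simp add: is_quasitriangular_def)
  show ?thesis using eq by (simp add: sw_apply tens3_eval[OF g])
qed

text \<open>Some inverse of \<R>, with which \<R> can be cancelled until \<open>SR_R\<close> and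
  \<open>R_SR\<close> provide the explicit inverse \<open>(S \<otimes> id) \<R>\<close>.\<close>

definition Rinv :: "('h, 'h, 'k) tensor" where
  "Rinv = (SOME Y. Y \<in> car HH \<and> tmult H (rmat H) Y = tens2 H 1 1 \<and> tmult H Y (rmat H) = tens2 H 1 1)"

lemma R_Rinv:
  assumes b: "bil \<beta>"
  shows "RS (\<lambda>r s. sw H Rinv (\<lambda>c d. \<beta> (r * c) (s * d))) = \<beta> 1 1"
proof -
  have "\<exists>Y. Y \<in> car HH \<and> tmult H (rmat H) Y = tens2 H 1 1 \<and> tmult H Y (rmat H) = tens2 H 1 1"
    using quasitriangular by (auto simp: is_quasitriangular_def)
  from someI_ex[OF this] have Y: "Rinv \<in> car HH" "tmult H (rmat H) Rinv = tens2 H 1 1"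
    by (simp_all add: Rinv_def)
  show ?thesis
    using sw_tmult[OF rmat_in Y(1) b] by (simp add: Y(2) sw_tens2 b)
qed

text \<open>For \<open>e = (\<epsilon> \<otimes> id) \<R>\<close> the counit on the first leg of the
  first hexagon gives \<open>\<R> = (1 \<otimes> e) \<R>\<close>, and cancelling \<R> gives
  \<open>e = 1\<close>. The other leg is treated alike in \<open>R_eps2\<close> with the second
  hexagon.\<close>

lemma R_eps1:
  assumes f: "lf \<phi>"
  shows "RS (\<lambda>r s. eps r * \<phi> s) = \<phi> 1"
proof -
  define e where "e = RS (\<lambda>r s. sc (eps r) s)"
  have e: "\<psi> e = RS (\<lambda>r s. eps r * \<psi> s)" if "lf \<psi>" for \<psi>
    by (simp add: e_def sw_lf that lfD)
  have R: "RS \<beta> = RS (\<lambda>r s. \<beta> r (e * s))" if b: "bil \<beta>" for \<beta>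
  proof -
    note l = lin bil_lin[OF b]
    have "RS \<beta> = RS (\<lambda>r s. D r (\<lambda>a b. eps a * \<beta> b s))"
      by (subst D_counit_l, intro l) simp
    also have "\<dots> = RS (\<lambda>r s. RS (\<lambda>p q. eps r * \<beta> p (s * q)))"
      by (rule R_hex1) (intro l)
    also have "\<dots> = RS (\<lambda>p q. RS (\<lambda>r s. eps r * \<beta> p (s * q)))"
      by (rule sw_swap)
    also have "\<dots> = RS (\<lambda>p q. \<beta> p (e * q))"
      by (intro sw_cong e[symmetric] l)
    finally show ?thesis .
  qed
  note l = lin lf_comp[OF f]
  have "\<phi> 1 = RS (\<lambda>r s. sw H Rinv (\<lambda>c d. eps (r * c) * \<phi> (s * d)))"
    by (subst R_Rinv, intro l) simp
  also have "\<dots> = RS (\<lambda>r s. sw H Rinv (\<lambda>c d. eps (r * c) * \<phi> (e * s * d)))"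
    by (rule R) (intro l)
  also have "\<dots> = RS (\<lambda>r s. sw H Rinv (\<lambda>c d. eps (r * c) * \<phi> (e * (s * d))))"
    by (simp add: mult.assoc)
  also have "\<dots> = \<phi> e" by (subst R_Rinv, intro l) simp
  finally show ?thesis by (simp add: e f)
qed

lemma R_eps2:
  assumes f: "lf \<phi>"
  shows "RS (\<lambda>r s. \<phi> r * eps s) = \<phi> 1"
proof -
  define e where "e = RS (\<lambda>r s. sc (eps s) r)"
  have e: "\<psi> e = RS (\<lambda>r s. \<psi> r * eps s)" if "lf \<psi>" for \<psi>
    by (simp add: e_def sw_lf that lfD mult.commute)
  have R: "RS \<beta> = RS (\<lambda>r s. \<beta> (e * r) s)" if b: "bil \<beta>" for \<beta>
  proof -
    note l = lin bil_lin[OF b]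
    have "RS \<beta> = RS (\<lambda>r s. D s (\<lambda>a b. \<beta> r a * eps b))"
      by (subst D_counit_r, intro l) simp
    also have "\<dots> = RS (\<lambda>r s. RS (\<lambda>p q. \<beta> (r * p) q * eps s))"
      by (rule R_hex2) (intro l)
    also have "\<dots> = RS (\<lambda>p q. RS (\<lambda>r s. \<beta> (r * p) q * eps s))"
      by (rule sw_swap)
    also have "\<dots> = RS (\<lambda>p q. \<beta> (e * p) q)"
      by (intro sw_cong e[symmetric] l)
    finally show ?thesis .
  qed
  note l = lin lf_comp[OF f]
  have "\<phi> 1 = RS (\<lambda>r s. sw H Rinv (\<lambda>c d. \<phi> (r * c) * eps (s * d)))"
    by (subst R_Rinv, intro l) simp
  also have "\<dots> = RS (\<lambda>r s. sw H Rinv (\<lambda>c d. \<phi> (e * r * c) * eps (s * d)))"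
    by (rule R) (intro l)
  also have "\<dots> = RS (\<lambda>r s. sw H Rinv (\<lambda>c d. \<phi> (e * (r * c)) * eps (s * d)))"
    by (simp add: mult.assoc)
  also have "\<dots> = \<phi> e" by (subst R_Rinv, intro l) simp
  finally show ?thesis by (simp add: e f)
qed

text \<open>The first hexagon turns the product \<open>(S \<otimes> id) \<R> \<cdot> \<R>\<close>
  into \<open>S r\<^sub>1 r\<^sub>2 \<otimes> s\<close> for \<open>\<R> = r \<otimes> s\<close>,
  where the antipode axiom applies.\<close>

lemma SR_R:
  assumes b: "bil \<beta>"
  shows "RS (\<lambda>r s. RS (\<lambda>p q. \<beta> (S r * p) (s * q))) = \<beta> 1 1"
proof -
  note l = lin bil_lin[OF b]
  have "RS (\<lambda>r s. RS (\<lambda>p q. \<beta> (S r * p) (s * q))) = RS (\<lambda>r s. D r (\<lambda>a b. \<beta> (S a * b) s))"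
    by (rule R_hex1[symmetric]) (intro l)
  also have "\<dots> = RS (\<lambda>r s. eps r * \<beta> 1 s)"
    by (intro sw_cong S_l l)
  also have "\<dots> = \<beta> 1 1" by (rule R_eps1) (intro l)
  finally show ?thesis .
qed

text \<open>A left inverse of an invertible element is also a right inverse:
  \<open>\<R> Rinv\<close> is appended, and the left inverse cancels the \<R> next to it.\<close>

lemma R_SR:
  assumes b: "bil \<beta>"
  shows "RS (\<lambda>r s. RS (\<lambda>p q. \<beta> (r * S p) (s * q))) = \<beta> 1 1"
proof -
  note l = lin bil_lin[OF b]
  have "RS (\<lambda>r s. RS (\<lambda>p q. \<beta> (r * S p) (s * q))) = RS (\<lambda>r s. RS (\<lambda>p q. RS (\<lambda>u v. sw H Rinv (\<lambda>c d.
      \<beta> (r * S p * (u * c)) (s * q * (v * d))))))"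
    by (subst R_Rinv[where \<beta> = "\<lambda>x y. \<beta> (_ * x) (_ * y)"], intro l) simp
  also have "\<dots> = RS (\<lambda>r s. RS (\<lambda>p q. sw H Rinv (\<lambda>c d. RS (\<lambda>u v.
      \<beta> (r * (S p * u) * c) (s * (q * v) * d)))))"
    by (subst sw_swap[of "rmat H" Rinv]) (simp add: mult.assoc)
  also have "\<dots> = RS (\<lambda>r s. sw H Rinv (\<lambda>c d. RS (\<lambda>p q. RS (\<lambda>u v.
      \<beta> (r * (S p * u) * c) (s * (q * v) * d)))))"
    by (subst sw_swap[of "rmat H" Rinv]) (rule refl)
  also have "\<dots> = RS (\<lambda>r s. sw H Rinv (\<lambda>c d. \<beta> (r * c) (s * d)))"
    by (subst SR_R[where \<beta> = "\<lambda>x y. \<beta> (_ * x * _) (_ * y * _)"], intro l) simp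
  also have "\<dots> = \<beta> 1 1" by (rule R_Rinv[OF b])
  finally show ?thesis .
qed

text \<open>Both \<open>(S \<otimes> S) \<R>\<close> and \<R> are inverse to
  \<open>(S \<otimes> id) \<R>\<close>: the former by the second hexagon, which is the fact
  \<open>W\<close>, the latter by \<open>SR_R\<close>.\<close>

lemma R_SS:
  assumes b: "bil \<beta>"
  shows "RS (\<lambda>r s. \<beta> (S r) (S s)) = RS \<beta>"
proof -
  note l = lin bil_lin[OF b]
  have W: "RS (\<lambda>r s. RS (\<lambda>p q. \<delta> (S p * S r) (S q * s))) = \<delta> 1 1" if d: "bil \<delta>" for \<delta>
  proof -
    note l = lin bil_lin[OF d]
    have "RS (\<lambda>r s. RS (\<lambda>p q. \<delta> (S (r * p)) (S q * s))) = RS (\<lambda>r s. D s (\<lambda>a b. \<delta> (S r) (S a * b)))"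
      by (rule R_hex2[symmetric]) (intro l)
    also have "\<dots> = RS (\<lambda>r s. \<delta> (S r) 1 * eps s)"
      by (subst S_l, intro l) (simp add: mult.commute)
    also have "\<dots> = \<delta> (S 1) 1" by (rule R_eps2) (intro l)
    finally show ?thesis by (simp add: S_mult)
  qed
  have "RS (\<lambda>p q. \<beta> (S p) (S q)) = RS (\<lambda>p q. RS (\<lambda>r s. RS (\<lambda>u v. \<beta> (S p * (S r * u)) (S q * (s * v)))))"
    by (subst SR_R[where \<beta> = "\<lambda>x y. \<beta> (_ * x) (_ * y)"], intro l) simp
  also have "\<dots> = RS (\<lambda>p q. RS (\<lambda>u v. RS (\<lambda>r s. \<beta> (S p * S r * u) (S q * s * v))))"
    by (subst (2) sw_swap) (simp add: mult.assoc)
  also have "\<dots> = RS (\<lambda>u v. RS (\<lambda>r s. RS (\<lambda>p q. \<beta> (S p * S r * u) (S q * s * v))))"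
    by (subst sw_swap, subst (2) sw_swap) (rule refl)
  also have "\<dots> = RS \<beta>"
    by (subst W[of "\<lambda>x y. \<beta> (x * _) (y * _)"], intro l) simp
  finally show ?thesis .
qed

text \<open>In \<open>H\<close> tensored with its opposite algebra the inverse of \<R> is
  \<open>(id \<otimes> S) \<R>\<close>; this lemma and \<open>R_R_S2\<close> are the two sides.
  Invariance of \<R> under \<open>S \<otimes> S\<close> reduces them to the inverse in
  \<open>H \<otimes> H\<close>.\<close>

lemma R_R_S1:
  assumes b: "bil \<beta>"
  shows "RS (\<lambda>r s. RS (\<lambda>p q. \<beta> (r * p) (S q * s))) = \<beta> 1 1"
proof -
  note l = lin bil_lin[OF b]
  have "RS (\<lambda>r s. RS (\<lambda>p q. \<beta> (r * p) (S q * s))) = RS (\<lambda>r s. RS (\<lambda>p q. \<beta> (S r * p) (S q * S s)))"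
    by (rule R_SS[symmetric]) (intro l)
  also have "\<dots> = RS (\<lambda>r s. RS (\<lambda>p q. \<beta> (S r * p) (S (s * q))))" by (simp add: S_mult)
  also have "\<dots> = \<beta> 1 (S 1)" by (rule SR_R) (intro l)
  finally show ?thesis by simp
qed

lemma R_R_S2:
  assumes b: "bil \<beta>"
  shows "RS (\<lambda>r s. RS (\<lambda>p q. \<beta> (r * p) (q * S s))) = \<beta> 1 1"
proof -
  note l = lin bil_lin[OF b]
  have "RS (\<lambda>r s. RS (\<lambda>p q. \<beta> (r * p) (q * S s))) = RS (\<lambda>r s. RS (\<lambda>p q. \<beta> (r * S p) (S q * S s)))"
    by (intro sw_cong R_SS[symmetric] l)
  also have "\<dots> = RS (\<lambda>r s. RS (\<lambda>p q. \<beta> (r * S p) (S (s * q))))" by (simp add: S_mult)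
  also have "\<dots> = \<beta> 1 (S 1)" by (rule R_SR) (intro l)
  finally show ?thesis by simp
qed

section \<open>The adjoint action\<close>

definition ad :: "'h \<Rightarrow> 'h \<Rightarrow> 'h" where "ad = act (trm H)"

lemma ad_def': "ad h x = D h (\<lambda>a b. a * x * S b)"
  by (simp add: ad_def trm_def)

lemma ad_lf: "lf \<phi> \<Longrightarrow> \<phi> (ad h x) = D h (\<lambda>a b. \<phi> (a * x * S b))"
  by (simp add: ad_def' sw_lf)

lemma le_D:
  assumes "le f" "\<And>y. le (\<lambda>x. \<beta> x y)" "\<And>x. le (\<lambda>y. \<beta> x y)"
  shows "le (\<lambda>x. D (f x) \<beta>)"
proof -
  have "linear_on (Hsp H) HH (comult H)" using hopf by (simp add: is_hopf_algebra_def)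
  then have "linear_on (Hsp H) (Hsp H) (\<lambda>x. D x \<beta>)"
    unfolding sw_def
    by (rule linear_on_comp)
      (rule linear_on_tsum, use assms in \<open>auto simp: bilinear_on_def le_def[symmetric]\<close>)
  then show ?thesis using le_comp assms(1) by (simp add: le_def[symmetric])
qed

lemma le_ad1: "le f \<Longrightarrow> le (\<lambda>x. ad (f x) c)"
  unfolding ad_def' by (intro le_D lin)

lemma le_ad2: "le f \<Longrightarrow> le (\<lambda>x. ad c (f x))"
  unfolding ad_def' by (intro lin)

lemmas lin_ad = lin le_ad1 le_ad2

lemma ad_one: "ad 1 x = x"
proof (rule lf_separate)
  fix \<phi> assume f: "lf \<phi>"
  show "\<phi> (ad 1 x) = \<phi> x"
    by (subst ad_lf[OF f], subst D_one, intro lin lf_comp[OF f]) simp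
qed

lemma ad_mult: "ad (g * h) x = ad g (ad h x)"
proof (rule lf_separate)
  fix \<phi> assume f: "lf \<phi>"
  note l = lin_ad lf_comp[OF f]
  have "\<phi> (ad (g * h) x) = D g (\<lambda>a b. D h (\<lambda>c d. \<phi> (a * c * x * S (b * d))))"
    by (subst ad_lf[OF f], subst D_mult, intro l) simp
  also have "\<dots> = D g (\<lambda>a b. D h (\<lambda>c d. \<phi> (a * (c * x * S d) * S b)))"
    by (simp add: S_mult mult.assoc)
  also have "\<dots> = D g (\<lambda>a b. \<phi> (a * ad h x * S b))"
    by (intro sw_cong ad_lf[symmetric] l)
  also have "\<dots> = \<phi> (ad g (ad h x))" by (rule ad_lf[OF f, symmetric])
  finally show "\<phi> (ad (g * h) x) = \<phi> (ad g (ad h x))" .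
qed

lemma ad_unit: "ad h 1 = sc (eps h) 1"
proof (rule lf_separate)
  fix \<phi> assume f: "lf \<phi>"
  show "\<phi> (ad h 1) = \<phi> (sc (eps h) 1)"
    by (simp add: ad_lf f S_r lfD)
qed

lemma eps_ad [simp]: "eps (ad h x) = eps h * eps x"
proof -
  have "eps (ad h x) = D h (\<lambda>a b. eps (a * x * S b))" by (rule ad_lf) (intro lin)
  also have "\<dots> = D h (\<lambda>a b. eps a * eps b) * eps x" by (simp add: sw_cmult mult_ac)
  also have "\<dots> = eps h * eps x" by (subst D_counit_l) (auto intro: lin)
  finally show ?thesis .
qed

text \<open>The inner factors of \<open>h\<^sub>1 x S h\<^sub>2 h\<^sub>3 y S h\<^sub>4\<close>
  cancel. This is the module algebra property, by which the product is a morphism.\<close>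

lemma ad_times:
  assumes f: "lf \<phi>"
  shows "D h (\<lambda>a b. \<phi> (ad a x * ad b y)) = \<phi> (ad h (x * y))"
proof -
  note l = lin_ad lf_comp[OF f]
  have "D h (\<lambda>a b. \<phi> (ad a x * ad b y)) =
      D h (\<lambda>a b. D a (\<lambda>c d. D b (\<lambda>e f. \<phi> (c * x * S d * (e * y * S f)))))"
    by (subst ad_lf[where \<phi> = "\<lambda>z. \<phi> (z * _)"], intro l, subst ad_lf[where \<phi> = "\<lambda>z. \<phi> (_ * z)"], intro l) simp
  also have "\<dots> = D h (\<lambda>c b. D b (\<lambda>d b. D b (\<lambda>e f. \<phi> (c * x * S d * (e * y * S f)))))"
    by (rule D_coassoc) (intro l)
  also have "\<dots> = D h (\<lambda>c b. D b (\<lambda>d b. D d (\<lambda>e f. \<phi> (c * x * S e * (f * y * S b)))))"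
    by (intro sw_cong D_coassoc[symmetric] l)
  also have "\<dots> = D h (\<lambda>c b. D b (\<lambda>d b. D d (\<lambda>e f. \<phi> (c * x * (S e * f) * y * S b))))"
    by (simp add: mult.assoc)
  also have "\<dots> = D h (\<lambda>c b. D b (\<lambda>d b. eps d * \<phi> (c * x * 1 * y * S b)))"
    by (intro sw_cong S_l l)
  also have "\<dots> = D h (\<lambda>c b. \<phi> (c * x * 1 * y * S b))"
    by (intro sw_cong D_counit_l l)
  also have "\<dots> = \<phi> (ad h (x * y))" by (simp add: ad_lf f mult.assoc)
  finally show ?thesis .
qed

text \<open>The tail of \<open>h\<^sub>1 x S h\<^sub>2 h\<^sub>3\<close> cancels. In
  \<open>theta_mult\<close> this converts the action in the braided product into an ordinary left
  multiplication.\<close>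

lemma ad_absorb:
  assumes f: "lf \<phi>"
  shows "D h (\<lambda>a b. \<phi> (ad a x * b)) = \<phi> (h * x)"
proof -
  note l = lin_ad lf_comp[OF f]
  have "D h (\<lambda>a b. \<phi> (ad a x * b)) = D h (\<lambda>a b. D a (\<lambda>c d. \<phi> (c * x * S d * b)))"
    by (intro sw_cong ad_lf l)
  also have "\<dots> = D h (\<lambda>c b. D b (\<lambda>d b. \<phi> (c * x * (S d * b))))"
    by (subst D_coassoc, intro l) (simp add: mult.assoc)
  also have "\<dots> = D h (\<lambda>c b. \<phi> (c * x * 1) * eps b)"
    by (subst S_l, intro l) (simp add: mult.commute)
  also have "\<dots> = \<phi> (h * x * 1)" by (rule D_counit_r) (intro l)
  finally show ?thesis by simp
qed

end

section \<open>The braided coproduct and antipode\<close>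

context quasitriangular_hopf
begin

definition dc :: "'h \<Rightarrow> ('h, 'h, 'k) tensor" where
  "dc h = D h (\<lambda>a b. RS (\<lambda>r s. tens2 H (a * S s) (ad r b)))"

abbreviation BD :: "'h \<Rightarrow> ('h \<Rightarrow> 'h \<Rightarrow> 'u::ab_group_add) \<Rightarrow> 'u" where "BD h \<equiv> sw H (dc h)"

lemma dc_in: "dc h \<in> car HH"
  unfolding dc_def by (intro sw_in tens2_in comult_in rmat_in)

lemma BD_eq:
  assumes b: "bil \<beta>"
  shows "BD h \<beta> = D h (\<lambda>a b. RS (\<lambda>r s. \<beta> (a * S s) (ad r b)))"
  by (simp add: dc_def sw_sw comult_in rmat_in tens2_in sw_in sw_tens2 b)

lemma lf_BD:
  assumes f: "le f" and b: "bil \<beta>"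
  shows "lf (\<lambda>x. BD (f x) \<beta>)"
  unfolding BD_eq[OF b] by (intro lin_ad f bil_lin[OF b])

lemmas lin_BD = lin_ad lf_BD

text \<open>The lemmas named after theta concern the map \<open>a \<otimes> b \<mapsto> a
  \<R>\<^sup>2 \<otimes> \<R>\<^sup>1 \<triangleright> b\<close>; its inverse has
  \<open>S \<R>\<^sup>2\<close> in place of \<open>\<R>\<^sup>2\<close>. In a composite the first
  legs multiply in the order of the actions and the second legs in the opposite order, so the
  cancellation is that of \<R> in \<open>H\<close> tensored with its opposite.\<close>

lemma theta_inverse1:
  assumes b: "bil \<beta>"
  shows "RS (\<lambda>p q. RS (\<lambda>r s. \<beta> (a * S q * s) (ad r (ad p b)))) = \<beta> a b"
proof -
  note l = lin_BD bil_lin[OF b]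
  have "RS (\<lambda>p q. RS (\<lambda>r s. \<beta> (a * S q * s) (ad r (ad p b)))) =
      RS (\<lambda>r s. RS (\<lambda>p q. \<beta> (a * (S q * s)) (ad (r * p) b)))"
    by (subst sw_swap) (simp add: ad_mult mult.assoc)
  also have "\<dots> = \<beta> (a * 1) (ad 1 b)" by (rule R_R_S1) (intro l)
  finally show ?thesis by (simp add: ad_one)
qed

lemma theta_inverse2:
  assumes b: "bil \<beta>"
  shows "RS (\<lambda>p q. RS (\<lambda>r s. \<beta> (a * q * S s) (ad r (ad p b)))) = \<beta> a b"
proof -
  note l = lin_BD bil_lin[OF b]
  have "RS (\<lambda>p q. RS (\<lambda>r s. \<beta> (a * q * S s) (ad r (ad p b)))) =
      RS (\<lambda>r s. RS (\<lambda>p q. \<beta> (a * (q * S s)) (ad (r * p) b)))"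
    by (subst sw_swap) (simp add: ad_mult mult.assoc)
  also have "\<dots> = \<beta> (a * 1) (ad 1 b)" by (rule R_R_S2) (intro l)
  finally show ?thesis by (simp add: ad_one)
qed

lemma BD_theta:
  assumes b: "bil \<beta>"
  shows "BD h (\<lambda>a b. RS (\<lambda>r s. \<beta> (a * s) (ad r b))) = D h \<beta>"
proof -
  note l = lin_BD bil_lin[OF b]
  show ?thesis
    by (subst BD_eq, intro l) (subst theta_inverse1[OF b], rule refl)
qed

text \<open>The left side multiplies the images of \<open>a \<otimes> b\<close> and
  \<open>c \<otimes> d\<close> in the ordinary tensor square, the right side is the image of their
  braided product. On the right, the first hexagon splits the outer action over the two factors; the
  second hexagon joins two copies of \<R> into a coproduct, which \<open>ad_absorb\<close> turns
  into multiplication by \<open>q\<close>.\<close>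

lemma theta_mult:
  assumes b: "bil \<beta>"
  shows "RS (\<lambda>r s. RS (\<lambda>p q. \<beta> (a * s * c * q) (ad r b * ad p d))) =
    RS (\<lambda>r s. RS (\<lambda>p q. \<beta> (a * ad s c * q) (ad p (ad r b * d))))"
proof -
  note l = lin_BD bil_lin[OF b]
  have "RS (\<lambda>r s. RS (\<lambda>p q. \<beta> (a * ad s c * q) (ad p (ad r b * d)))) =
      RS (\<lambda>r s. RS (\<lambda>p q. D p (\<lambda>e f. \<beta> (a * ad s c * q) (ad e (ad r b) * ad f d))))"
    by (intro sw_cong ad_times[symmetric] l)
  also have "\<dots> = RS (\<lambda>r s. RS (\<lambda>p q. RS (\<lambda>f t. \<beta> (a * ad s c * (q * t)) (ad p (ad r b) * ad f d))))"
    by (intro sw_cong R_hex1 l)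
  also have "\<dots> = RS (\<lambda>r s. RS (\<lambda>f t. RS (\<lambda>p q. \<beta> (a * (ad s c * q) * t) (ad (p * r) b * ad f d))))"
    by (subst (2) sw_swap) (simp add: ad_mult mult.assoc)
  also have "\<dots> = RS (\<lambda>f t. RS (\<lambda>p q. RS (\<lambda>r s. \<beta> (a * (ad s c * q) * t) (ad (p * r) b * ad f d))))"
    by (subst sw_swap, subst (2) sw_swap) (rule refl)
  also have "\<dots> = RS (\<lambda>f t. RS (\<lambda>p q. D q (\<lambda>v w. \<beta> (a * (ad v c * w) * t) (ad p b * ad f d))))"
    by (intro sw_cong R_hex2[symmetric] l)
  also have "\<dots> = RS (\<lambda>f t. RS (\<lambda>p q. \<beta> (a * (q * c) * t) (ad p b * ad f d)))"
    by (intro sw_cong ad_absorb l)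
  also have "\<dots> = RS (\<lambda>r s. RS (\<lambda>p q. \<beta> (a * s * c * q) (ad r b * ad p d)))"
    by (subst sw_swap) (simp add: mult.assoc)
  finally show ?thesis ..
qed

lemma BD_mult:
  assumes b: "bil \<beta>"
  shows "BD (x * y) \<beta> = BD x (\<lambda>a b. BD y (\<lambda>c d. RS (\<lambda>r s. \<beta> (a * ad s c) (ad r b * d))))"
proof -
  \<comment> \<open>Precomposing with the inverse of the theta map turns the braided coproduct
    tested on \<beta> into the ordinary one tested on \<open>\<beta>'\<close>.\<close>
  define \<beta>' where "\<beta>' = (\<lambda>u v. RS (\<lambda>p q. \<beta> (u * S q) (ad p v)))"
  have b': "bil \<beta>'" unfolding \<beta>'_def by (intro lin_BD bil_lin[OF b])
  note l = lin_BD bil_lin[OF b] bil_lin[OF b']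
  have "BD (x * y) \<beta> = D (x * y) \<beta>'"
    by (simp add: BD_eq b \<beta>'_def)
  also have "\<dots> = D x (\<lambda>a b. D y (\<lambda>c d. \<beta>' (a * c) (b * d)))"
    by (rule D_mult[OF b'])
  also have "\<dots> = BD x (\<lambda>a b. RS (\<lambda>r s. D y (\<lambda>c d. \<beta>' (a * s * c) (ad r b * d))))"
    by (rule BD_theta[symmetric]) (intro l)
  also have "\<dots> = BD x (\<lambda>a b. RS (\<lambda>r s. BD y (\<lambda>c d. RS (\<lambda>p q. \<beta>' (a * s * (c * q)) (ad r b * ad p d)))))"
    by (intro sw_cong BD_theta[symmetric] l)
  also have "\<dots> = BD x (\<lambda>a b. BD y (\<lambda>c d. RS (\<lambda>r s. RS (\<lambda>p q. \<beta>' (a * s * c * q) (ad r b * ad p d)))))"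
    by (subst sw_swap[of "rmat H" "dc y"]) (simp add: mult.assoc)
  also have "\<dots> = BD x (\<lambda>a b. BD y (\<lambda>c d. RS (\<lambda>r s. RS (\<lambda>p q. \<beta>' (a * ad s c * q) (ad p (ad r b * d))))))"
    by (intro sw_cong theta_mult b')
  also have "\<dots> = BD x (\<lambda>a b. BD y (\<lambda>c d. RS (\<lambda>r s. \<beta> (a * ad s c) (ad r b * d))))"
    unfolding \<beta>'_def by (intro sw_cong theta_inverse2 b)
  finally show ?thesis .
qed

lemma BD_one: "bil \<beta> \<Longrightarrow> BD 1 \<beta> = \<beta> 1 1"
proof -
  assume b: "bil \<beta>"
  note l = lin_BD bil_lin[OF b]
  have "BD 1 \<beta> = RS (\<lambda>r s. \<beta> (S s) (ad r 1))"
    by (subst BD_eq[OF b], subst D_one, intro l) simp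
  also have "\<dots> = RS (\<lambda>r s. eps r * \<beta> (S s) 1)"
    using b by (simp add: ad_unit bil_def lf_iff)
  also have "\<dots> = \<beta> (S 1) 1" by (rule R_eps1) (intro l)
  finally show ?thesis by simp
qed

section \<open>The braided antipode\<close>

definition sb :: "'h \<Rightarrow> 'h" where "sb x = RS (\<lambda>r s. s * S (ad r x))"

lemma sb_lf: "lf \<phi> \<Longrightarrow> \<phi> (sb x) = RS (\<lambda>r s. \<phi> (s * S (ad r x)))"
  by (simp add: sb_def sw_lf)

lemma le_sb: "le f \<Longrightarrow> le (\<lambda>x. sb (f x))"
  unfolding sb_def by (intro lin_BD)

lemmas lin_sb = lin_BD le_sb

text \<open>Since \<open>a * sb b\<close> is
  \<open>a \<R>\<^sup>2 S (\<R>\<^sup>1 \<triangleright> b)\<close>, the theta map is already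
  contained in \<open>sb\<close>, and \<open>BD_theta\<close> reduces the axiom to the ordinary one
  for \<open>S\<close>.\<close>

lemma BD_sb_r:
  assumes f: "lf \<phi>"
  shows "BD h (\<lambda>a b. \<phi> (a * sb b)) = eps h * \<phi> 1"
proof -
  note l = lin_sb lf_comp[OF f]
  have "BD h (\<lambda>a b. \<phi> (a * sb b)) = BD h (\<lambda>a b. RS (\<lambda>r s. \<phi> (a * s * S (ad r b))))"
    by (subst sb_lf[where \<phi> = "\<lambda>z. \<phi> (_ * z)"], intro l) (simp add: mult.assoc)
  also have "\<dots> = D h (\<lambda>a b. \<phi> (a * S b))"
    by (rule BD_theta) (intro l)
  also have "\<dots> = eps h * \<phi> 1" by (rule S_r[OF f])
  finally show ?thesis .
qed

text \<open>The inverse of the Drinfeld element.\<close>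

definition uinv :: 'h where "uinv = RS (\<lambda>r s. s * S (S r))"

lemma uinv_lf: "lf \<phi> \<Longrightarrow> \<phi> uinv = RS (\<lambda>r s. \<phi> (s * S (S r)))"
  by (simp add: uinv_def sw_lf)

text \<open>A pair \<open>S h\<^sub>2 h\<^sub>3\<close> is inserted behind
  \<open>S \<R>\<^sup>1\<close>, inside the outer antipode. Then \<open>h\<^sub>1\<close> and
  \<open>h\<^sub>2\<close> stand on the left of the two legs of \<R>, the intertwining relation
  exchanges them to the right, and \<open>h\<^sub>2 S h\<^sub>3\<close> cancels.\<close>

lemma uinv_comm: "h * uinv = uinv * S (S h)"
proof (rule lf_separate)
  fix \<phi> assume f: "lf \<phi>"
  note l = lin_sb lf_comp[OF f]
  have "\<phi> (h * uinv) = RS (\<lambda>r s. \<phi> (h * (s * S (S r))))"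
    by (rule uinv_lf) (intro l)
  also have "\<dots> = RS (\<lambda>r s. D h (\<lambda>a b. \<phi> (a * (s * S (S r * 1))) * eps b))"
    by (subst D_counit_r, intro l) simp
  also have "\<dots> = RS (\<lambda>r s. D h (\<lambda>a b. D b (\<lambda>c d. \<phi> (a * (s * S (S r * (S c * d)))))))"
    by (subst S_l, intro l) (simp add: mult.commute)
  also have "\<dots> = RS (\<lambda>r s. D h (\<lambda>a d. D a (\<lambda>a c. \<phi> (a * (s * S (S r * (S c * d)))))))"
    by (intro sw_cong D_coassoc[symmetric] l)
  also have "\<dots> = D h (\<lambda>e d. D e (\<lambda>a c. RS (\<lambda>r s. \<phi> (a * s * S (S (c * r) * d)))))"
    by (subst sw_swap, subst (2) sw_swap) (simp add: mult.assoc S_mult)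
  also have "\<dots> = D h (\<lambda>e d. RS (\<lambda>r s. D e (\<lambda>a c. \<phi> (s * c * S (S (r * a) * d)))))"
    by (intro sw_cong R_intertwines l)
  also have "\<dots> = RS (\<lambda>r s. D h (\<lambda>e d. D e (\<lambda>a c. \<phi> (s * (c * S d) * S (S r) * S (S a)))))"
    by (subst sw_swap) (simp add: mult.assoc S_mult)
  also have "\<dots> = RS (\<lambda>r s. D h (\<lambda>a e. D e (\<lambda>c d. \<phi> (s * (c * S d) * S (S r) * S (S a)))))"
    by (intro sw_cong D_coassoc l)
  also have "\<dots> = RS (\<lambda>r s. D h (\<lambda>a e. \<phi> (s * 1 * S (S r) * S (S a)) * eps e))"
    by (subst S_r, intro l) (simp add: mult.commute)
  also have "\<dots> = RS (\<lambda>r s. \<phi> (s * S (S r) * S (S h)))"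
    by (subst D_counit_r, intro l) simp
  also have "\<dots> = \<phi> (uinv * S (S h))"
    by (rule uinv_lf[symmetric]) (intro l)
  finally show "\<phi> (h * uinv) = \<phi> (uinv * S (S h))" .
qed

text \<open>The first hexagon distributes the two halves of the adjoint action over two copies of
  \<R>; the inner copy closes up to \<open>uinv\<close>. The form obtained contains no action, which
  makes the left antipode axiom and equivariance accessible.\<close>

lemma sb_formula:
  assumes f: "lf \<phi>"
  shows "\<phi> (sb x) = RS (\<lambda>r s. \<phi> (s * uinv * S x * S r))"
proof -
  note l = lin_sb lf_comp[OF f]
  have "\<phi> (sb x) = RS (\<lambda>r s. D r (\<lambda>a b. \<phi> (s * S (a * x * S b))))"
    by (subst sb_lf[OF f]) (intro sw_cong ad_lf l)
  also have "\<dots> = RS (\<lambda>r s. RS (\<lambda>p q. \<phi> (s * q * S (r * x * S p))))"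
    by (rule R_hex1) (intro l)
  also have "\<dots> = RS (\<lambda>r s. RS (\<lambda>p q. \<phi> (s * (q * S (S p)) * S x * S r)))"
    by (simp add: S_mult mult.assoc)
  also have "\<dots> = RS (\<lambda>r s. \<phi> (s * uinv * S x * S r))"
    by (intro sw_cong uinv_lf[symmetric] l)
  finally show ?thesis .
qed

text \<open>On this side the theta map does not meet the \<R> inside \<open>sb\<close> directly.
  After the explicit formula for \<open>sb\<close>, the antipode on the twisting \<R> is absorbed by
  \<open>uinv\<close>, the first hexagon splits the action, \<open>SR_R\<close> cancels the inner
  copies, and the ordinary axiom removes \<open>S a * b\<close>.\<close>

lemma BD_sb_l:
  assumes f: "lf \<phi>"
  shows "BD h (\<lambda>a b. \<phi> (sb a * b)) = eps h * \<phi> 1"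
proof -
  note l = lin_sb lf_comp[OF f]
  have "BD h (\<lambda>a b. \<phi> (sb a * b)) = D h (\<lambda>a b. RS (\<lambda>p q. \<phi> (sb (a * S q) * ad p b)))"
    by (rule BD_eq) (intro l)
  also have "\<dots> = D h (\<lambda>a b. RS (\<lambda>p q. RS (\<lambda>r s. \<phi> (s * uinv * S (a * S q) * S r * ad p b))))"
    by (intro sw_cong sb_formula l)
  also have "\<dots> = D h (\<lambda>a b. RS (\<lambda>p q. RS (\<lambda>r s. D p (\<lambda>c d. \<phi> (s * q * uinv * S a * S r * (c * b * S d))))))"
  proof -
    \<comment> \<open>By \<open>uinv_comm\<close>, \<open>uinv * S (S q)\<close> equals
      \<open>q * uinv\<close>, which frees \<open>q\<close> from its antipodes and brings it next to
      \<open>s\<close>.\<close>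
    have "s * uinv * S (a * S q) = s * q * uinv * S a" for s a q
      by (simp add: S_mult mult.assoc) (metis mult.assoc uinv_comm)
    then show ?thesis by simp (intro sw_cong ad_lf l)
  qed
  also have "\<dots> = D h (\<lambda>a b. RS (\<lambda>r s. RS (\<lambda>p q. D p (\<lambda>c d. \<phi> (s * q * uinv * S a * S r * (c * b * S d))))))"
    by (subst (2) sw_swap) (rule refl)
  also have "\<dots> = D h (\<lambda>a b. RS (\<lambda>r s. RS (\<lambda>c q. RS (\<lambda>d t. \<phi> (s * (q * t) * uinv * S a * S r * (c * b * S d))))))"
    by (intro sw_cong R_hex1 l)
  also have "\<dots> = D h (\<lambda>a b. RS (\<lambda>d t. RS (\<lambda>r s. RS (\<lambda>c q. \<phi> ((s * q) * t * uinv * S a * (S r * c) * b * S d)))))"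
    by (subst (3) sw_swap, subst (2) sw_swap) (simp add: mult.assoc)
  also have "\<dots> = D h (\<lambda>a b. RS (\<lambda>d t. \<phi> (1 * t * uinv * S a * 1 * b * S d)))"
    by (intro sw_cong SR_R l)
  also have "\<dots> = RS (\<lambda>d t. D h (\<lambda>a b. \<phi> (t * uinv * (S a * b) * S d)))"
    by (subst sw_swap) (simp add: mult.assoc)
  also have "\<dots> = RS (\<lambda>d t. eps h * \<phi> (t * uinv * 1 * S d))"
    by (intro sw_cong S_l l)
  \<comment> \<open>With \<open>uinv\<close> written out, the remaining factor is
    \<open>t * s * S (d * S r)\<close>, which is \<open>1\<close> because
    \<open>(S \<otimes> id) \<R>\<close> is a right inverse of \<R>.\<close>
  also have "\<dots> = eps h * RS (\<lambda>d t. RS (\<lambda>r s. \<phi> (t * (s * S (S r)) * 1 * S d)))"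
    by (subst uinv_lf[where \<phi> = "\<lambda>z. \<phi> (_ * z * _ * _)"], intro l) (simp add: sw_cmult)
  also have "\<dots> = eps h * RS (\<lambda>d t. RS (\<lambda>r s. \<phi> (t * s * S (d * S r))))"
    by (simp add: S_mult mult.assoc)
  also have "\<dots> = eps h * \<phi> (1 * S 1)"
    by (subst R_SR, intro l) simp
  finally show ?thesis by simp
qed

text \<open>In \<open>sb_formula\<close>, \<open>h\<close> meets the outer copy of \<R>, past which
  \<open>R_intertwines\<close> moves it. Then \<open>uinv_comm\<close> changes
  \<open>b * uinv\<close> into \<open>uinv * S (S b)\<close>, as the antipode of
  \<open>a * x * S b\<close> requires.\<close>

lemma sb_ad: "sb (ad h x) = ad h (sb x)"
proof (rule lf_separate)
  fix \<phi> assume f: "lf \<phi>"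
  note l = lin_sb lf_comp[OF f]
  have "\<phi> (ad h (sb x)) = D h (\<lambda>a b. RS (\<lambda>r s. \<phi> (a * (s * uinv * S x * S r) * S b)))"
    by (subst ad_lf[OF f]) (intro sw_cong sb_formula l)
  also have "\<dots> = D h (\<lambda>a b. RS (\<lambda>r s. \<phi> (a * s * uinv * S x * S (b * r))))"
    by (simp add: S_mult mult.assoc)
  also have "\<dots> = RS (\<lambda>r s. D h (\<lambda>a b. \<phi> (s * b * uinv * S x * S (r * a))))"
    by (rule R_intertwines) (intro l)
  also have "\<dots> = RS (\<lambda>r s. D h (\<lambda>a b. \<phi> (s * uinv * S (a * x * S b) * S r)))"
  proof -
    have "s * b * uinv * S x * S (r * a) = s * uinv * S (a * x * S b) * S r" for s b r a
      by (simp add: S_mult mult.assoc) (metis mult.assoc uinv_comm)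
    then show ?thesis by simp
  qed
  also have "\<dots> = RS (\<lambda>r s. \<phi> (s * uinv * S (ad h x) * S r))"
    by (intro sw_cong ad_lf[symmetric] l)
  also have "\<dots> = \<phi> (sb (ad h x))" by (rule sb_formula[OF f, symmetric])
  finally show "\<phi> (sb (ad h x)) = \<phi> (ad h (sb x))" ..
qed

section \<open>The element \<open>\<R> \<R>\<^sub>2\<^sub>1\<close>\<close>

abbreviation PS :: "('h \<Rightarrow> 'h \<Rightarrow> 'u::ab_group_add) \<Rightarrow> 'u" where
  "PS f \<equiv> RS (\<lambda>r s. RS (\<lambda>p q. f (r * q) (s * p)))"

text \<open>Each of the two factors of \<open>P\<close> exchanges the coproduct with its opposite
  once, so \<open>P\<close> commutes with the opposite coproduct.\<close>

lemma P_intertwines: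
  assumes b: "bil \<beta>"
  shows "D h (\<lambda>a b. PS (\<lambda>x y. \<beta> (b * x) (a * y))) = D h (\<lambda>a b. PS (\<lambda>x y. \<beta> (x * b) (y * a)))"
proof -
  note l = lin_sb bil_lin[OF b]
  have "D h (\<lambda>a b. PS (\<lambda>x y. \<beta> (b * x) (a * y))) =
      D h (\<lambda>a b. RS (\<lambda>r s. RS (\<lambda>p q. \<beta> (b * r * q) (a * s * p))))"
    by (simp add: mult.assoc)
  also have "\<dots> = RS (\<lambda>r s. D h (\<lambda>a b. RS (\<lambda>p q. \<beta> (r * a * q) (s * b * p))))"
    by (rule R_intertwines) (intro l)
  also have "\<dots> = RS (\<lambda>r s. D h (\<lambda>a b. RS (\<lambda>p q. \<beta> (r * (a * q)) (s * (b * p)))))"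
    by (simp add: mult.assoc)
  also have "\<dots> = RS (\<lambda>r s. RS (\<lambda>p q. D h (\<lambda>a b. \<beta> (r * (q * b)) (s * (p * a)))))"
    by (intro sw_cong R_intertwines l)
  also have "\<dots> = D h (\<lambda>a b. PS (\<lambda>x y. \<beta> (x * b) (y * a)))"
    by (subst (2) sw_swap, subst sw_swap) (simp add: mult.assoc)
  finally show ?thesis .
qed

text \<open>With \<open>S h\<^sub>1 h\<^sub>2\<close> inserted on the second leg,
  \<open>h\<^sub>3\<close> and \<open>h\<^sub>2\<close> stand on the left of the legs of
  \<open>P\<close> and may be commuted to the right. There \<open>h\<^sub>3 S h\<^sub>4\<close>
  cancels on the first leg.\<close>

lemma P_ad:
  assumes b: "bil \<beta>"
  shows "PS (\<lambda>x y. \<beta> (ad h x) y) = D h (\<lambda>a b. PS (\<lambda>x y. \<beta> x (S a * y * b)))"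
proof -
  note l = lin_sb bil_lin[OF b]
  have "PS (\<lambda>x y. \<beta> (ad h x) y) = PS (\<lambda>x y. D h (\<lambda>c b. \<beta> (c * x * S b) y))"
    by (intro sw_cong ad_lf l)
  also have "\<dots> = PS (\<lambda>x y. D h (\<lambda>a b. eps a * D b (\<lambda>c d. \<beta> (c * x * S d) y)))"
    by (subst D_counit_l, intro l) simp
  also have "\<dots> = PS (\<lambda>x y. D h (\<lambda>a b. D a (\<lambda>e f. D b (\<lambda>c d. \<beta> (c * x * S d) (S e * f * y)))))"
    by (subst S_l[where \<phi> = "\<lambda>z. D _ (\<lambda>c d. \<beta> (c * _ * S d) (z * _))"], intro l) simp
  also have "\<dots> = PS (\<lambda>x y. D h (\<lambda>e g. D g (\<lambda>f b. D b (\<lambda>c d. \<beta> (c * x * S d) (S e * f * y)))))"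
    by (intro sw_cong D_coassoc l)
  also have "\<dots> = PS (\<lambda>x y. D h (\<lambda>e g. D g (\<lambda>b d. D b (\<lambda>f c. \<beta> (c * x * S d) (S e * f * y)))))"
    by (intro sw_cong D_coassoc[symmetric] l)
  also have "\<dots> = D h (\<lambda>e g. D g (\<lambda>b d. D b (\<lambda>f c. PS (\<lambda>x y. \<beta> (c * x * S d) (S e * (f * y))))))"
    by (subst (2) sw_swap, subst sw_swap, subst (3) sw_swap, subst (2) sw_swap,
        subst (4) sw_swap, subst (3) sw_swap) (simp add: mult.assoc)
  also have "\<dots> = D h (\<lambda>e g. D g (\<lambda>b d. D b (\<lambda>f c. PS (\<lambda>x y. \<beta> (x * c * S d) (S e * (y * f))))))"
    by (intro sw_cong P_intertwines[where \<beta> = "\<lambda>u v. \<beta> (u * S _) (S _ * v)"] l)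
  also have "\<dots> = D h (\<lambda>e g. D g (\<lambda>f b. D b (\<lambda>c d. PS (\<lambda>x y. \<beta> (x * c * S d) (S e * (y * f))))))"
    by (intro sw_cong D_coassoc l)
  also have "\<dots> = D h (\<lambda>e g. D g (\<lambda>f b. D b (\<lambda>c d. PS (\<lambda>x y. \<beta> (x * (c * S d)) (S e * (y * f))))))"
    by (simp add: mult.assoc)
  also have "\<dots> = D h (\<lambda>e g. D g (\<lambda>f b. eps b * PS (\<lambda>x y. \<beta> (x * 1) (S e * (y * f)))))"
    by (intro sw_cong S_r[where \<phi> = "\<lambda>z. PS (\<lambda>x y. \<beta> (x * z) (G y))" for G] l)
  also have "\<dots> = D h (\<lambda>e g. PS (\<lambda>x y. \<beta> (x * 1) (S e * (y * g))))"
    by (subst mult.commute) (intro sw_cong D_counit_r l)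
  finally show ?thesis by (simp add: mult.assoc)
qed

text \<open>The hexagons applied to both factors give \<open>\<R>\<^sub>1\<^sub>3
  \<R>\<^sub>2\<^sub>3 \<R>\<^sub>3\<^sub>2 \<R>\<^sub>3\<^sub>1\<close>: the copy of
  \<open>P\<close> on legs two and three lies between the factors of the copy on legs one and three.
  \<open>P_BD\<close> has to undo this nesting.\<close>

lemma P_D:
  assumes g: "tri \<gamma>"
  shows "PS (\<lambda>x y. D x (\<lambda>a b. \<gamma> a b y)) =
    RS (\<lambda>r s. RS (\<lambda>p q. PS (\<lambda>x y. \<gamma> (r * q) x (s * y * p))))"
proof -
  note l = lin_sb tri_lin[OF g]
  have "PS (\<lambda>x y. D x (\<lambda>a b. \<gamma> a b y)) =
      RS (\<lambda>r s. RS (\<lambda>p q. D r (\<lambda>a b. D q (\<lambda>c d. \<gamma> (a * c) (b * d) (s * p)))))"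
    by (subst D_mult, intro l) simp
  also have "\<dots> = RS (\<lambda>r s. D r (\<lambda>a b. RS (\<lambda>p q. D q (\<lambda>c d. \<gamma> (a * c) (b * d) (s * p)))))"
    by (subst (2) sw_swap) (rule refl)
  also have "\<dots> = RS (\<lambda>r s. RS (\<lambda>u v. RS (\<lambda>p q. D q (\<lambda>c d. \<gamma> (r * c) (u * d) (s * v * p)))))"
    by (rule R_hex1) (intro l)
  also have "\<dots> = RS (\<lambda>r s. RS (\<lambda>u v. RS (\<lambda>p q. RS (\<lambda>p' q'. \<gamma> (r * q') (u * q) (s * v * (p * p'))))))"
    by (intro sw_cong R_hex2 l)
  also have "\<dots> = RS (\<lambda>r s. RS (\<lambda>p' q'. RS (\<lambda>u v. RS (\<lambda>p q. \<gamma> (r * q') (u * q) (s * v * (p * p'))))))"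
    by (subst (3) sw_swap, subst (2) sw_swap) (rule refl)
  finally show ?thesis by (simp add: mult.assoc)
qed

lemma P_eps1:
  assumes f: "lf \<phi>"
  shows "PS (\<lambda>x y. eps x * \<phi> y) = \<phi> 1"
proof -
  note l = lin_sb lf_comp[OF f]
  have "PS (\<lambda>x y. eps x * \<phi> y) = RS (\<lambda>r s. eps r * RS (\<lambda>p q. \<phi> (s * p) * eps q))"
    by (simp add: sw_cmult mult_ac)
  also have "\<dots> = \<phi> 1"
    by (subst R_eps2, intro l, subst R_eps1, intro l) simp
  finally show ?thesis .
qed

lemma P_eps2:
  assumes f: "lf \<phi>"
  shows "PS (\<lambda>x y. \<phi> x * eps y) = \<phi> 1"
proof -
  note l = lin_sb lf_comp[OF f]
  have "PS (\<lambda>x y. \<phi> x * eps y) = RS (\<lambda>r s. RS (\<lambda>p q. eps p * \<phi> (r * q)) * eps s)"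
    by (simp add: sw_cmult mult_ac)
  also have "\<dots> = \<phi> 1"
    by (subst R_eps1, intro l, subst R_eps2, intro l) simp
  finally show ?thesis .
qed

text \<open>The braided coproduct is dual to the product of \<open>H\<close> under \<open>\<R> \<R>\<^sub>2\<^sub>1\<close>.\<close>

lemma P_BD:
  assumes g: "tri \<gamma>"
  shows "PS (\<lambda>x y. BD x (\<lambda>a b. \<gamma> a b y)) = PS (\<lambda>x y. PS (\<lambda>x' y'. \<gamma> x x' (y * y')))"
proof -
  \<comment> \<open>The ordinary coproduct of the first leg consists of two unnested copies of
    \<open>P\<close> to which the theta map has been applied. The inverse of that map, contained in
    the braided coproduct, then removes it.\<close>
  have twisted: "PS (\<lambda>x y. D x (\<lambda>a b. \<delta> a b y)) =
      PS (\<lambda>x y. PS (\<lambda>x' y'. RS (\<lambda>p q. \<delta> (x * q) (ad p x') (y * y'))))"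
    if d: "tri \<delta>" for \<delta>
  proof -
    note l = lin_sb tri_lin[OF d]
    have "PS (\<lambda>x y. PS (\<lambda>x' y'. RS (\<lambda>p q. \<delta> (x * q) (ad p x') (y * y')))) =
        PS (\<lambda>x y. RS (\<lambda>p q. PS (\<lambda>x' y'. \<delta> (x * q) (ad p x') (y * y'))))"
      by (subst (4) sw_swap, subst (3) sw_swap) (rule refl)
    also have "\<dots> = PS (\<lambda>x y. RS (\<lambda>p q. D p (\<lambda>a b. PS (\<lambda>x' y'. \<delta> (x * q) x' (y * (S a * y' * b))))))"
      by (intro sw_cong P_ad[where \<beta> = "\<lambda>u v. \<delta> _ u (_ * v)"] l)
    also have "\<dots> = PS (\<lambda>x y. RS (\<lambda>p q. RS (\<lambda>b q'. PS (\<lambda>x' y'. \<delta> (x * (q * q')) x' (y * (S p * y' * b))))))"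
      by (intro sw_cong R_hex1 l)
    also have "\<dots> = RS (\<lambda>r s. RS (\<lambda>u v. RS (\<lambda>p q. RS (\<lambda>b q'. PS (\<lambda>x' y'.
        \<delta> (r * (v * q) * q') x' (s * (u * S p) * y' * b))))))"
      by (simp add: mult.assoc)
    \<comment> \<open>The copy of \<R> with legs \<open>u\<close>, \<open>v\<close> from the first
      \<open>P\<close> cancels against the copy with \<open>S p\<close> that came from the action on
      the second \<open>P\<close>; the nested form of \<open>P_D\<close> remains.\<close>
    also have "\<dots> = RS (\<lambda>r s. RS (\<lambda>b q'. PS (\<lambda>x' y'. \<delta> (r * 1 * q') x' (s * 1 * y' * b))))"
      by (intro sw_cong R_SR[where \<beta> = "\<lambda>u v. RS (\<lambda>b q'. PS (\<lambda>x' y'. \<delta> (_ * v * q') x' (_ * u * y' * b)))"] l)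
    also have "\<dots> = PS (\<lambda>x y. D x (\<lambda>a b. \<delta> a b y))"
      by (subst P_D[OF d]) simp
    finally show ?thesis ..
  qed
  note l = lin_sb tri_lin[OF g]
  have "PS (\<lambda>x y. BD x (\<lambda>a b. \<gamma> a b y)) =
      PS (\<lambda>x y. D x (\<lambda>a b. RS (\<lambda>r s. \<gamma> (a * S s) (ad r b) y)))"
    by (intro sw_cong BD_eq l)
  also have "\<dots> = PS (\<lambda>x y. PS (\<lambda>x' y'. RS (\<lambda>p q. RS (\<lambda>r s. \<gamma> (x * q * S s) (ad r (ad p x')) (y * y')))))"
    by (rule twisted) (intro l)
  also have "\<dots> = PS (\<lambda>x y. PS (\<lambda>x' y'. \<gamma> x x' (y * y')))"
    by (intro sw_cong theta_inverse2 l)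
  finally show ?thesis .
qed

end

section \<open>Finite dimension and factorisability\<close>

locale factorisable_hopf = quasitriangular_hopf H for H :: "('k::field, 'h::ring_1) qtha" +
  assumes finite_dimensional: "is_finite_dimensional H"
    and factorisable: "is_factorisable H"
begin

lemma le_linear: "le f \<longleftrightarrow> Vector_Spaces.linear sc sc f"
  by (auto simp: le_iff Vector_Spaces.linear_def module_hom_def module_hom_axioms_def
      vector_space_axioms module_axioms)

lemma le_surj_inj: "le f \<Longrightarrow> surj f \<Longrightarrow> inj f"
proof -
  assume f: "le f" "surj f"
  obtain B where "finite_dimensional_vector_space sc B"
    using finite_dimensional by (auto simp: is_finite_dimensional_def)
  then interpret F: finite_dimensional_vector_space sc B .
  show ?thesis using F.linear_surj_imp_inj f by (simp add: le_linear)
qed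

lemma le_inj_surj: "le f \<Longrightarrow> inj f \<Longrightarrow> surj f"
proof -
  assume f: "le f" "inj f"
  obtain B where "finite_dimensional_vector_space sc B"
    using finite_dimensional by (auto simp: is_finite_dimensional_def)
  then interpret F: finite_dimensional_vector_space sc B .
  show ?thesis using F.linear_inj_imp_surj f by (simp add: le_linear)
qed

lemma dual_basis:
  obtains B and co :: "'h \<Rightarrow> 'h \<Rightarrow> 'k" where "finite B" "\<And>i. lf (co i)" "\<And>x. (\<Sum>i\<in>B. sc (co i x) i) = x"
    "\<And>i j. i \<in> B \<Longrightarrow> j \<in> B \<Longrightarrow> co i j = (if i = j then 1 else 0)"
proof -
  obtain B where "finite_dimensional_vector_space sc B"
    using finite_dimensional by (auto simp: is_finite_dimensional_def)
  then interpret F: finite_dimensional_vector_space sc B .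
  show ?thesis
  proof
    show "finite B" by (rule F.finite_Basis)
    show "lf (\<lambda>x. representation B x i)" for i
      using linear_representation F.independent_Basis F.span_Basis by (simp add: lf_linear)
    show "(\<Sum>i\<in>B. sc (representation B x i) i) = x" for x
      by (rule sum_representation_eq[OF F.independent_Basis _ F.finite_Basis]) (simp_all add: F.span_Basis)
    show "representation B j i = (if i = j then 1 else 0)" if "i \<in> B" "j \<in> B" for i j
      by (simp add: representation_basis F.independent_Basis that)
  qed
qed

lemma lf_sum: "lf \<phi> \<Longrightarrow> \<phi> (\<Sum>i\<in>I. f i) = (\<Sum>i\<in>I. \<phi> (f i))"
  by (induction I rule: infinite_finite_induct) (auto simp: lf_zero lfD)

lemma lf_expand:
  assumes "lf \<phi>" "(\<Sum>i\<in>B. sc (co i x) i) = x"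
  shows "\<phi> x = (\<Sum>i\<in>B. \<phi> i * co i x)"
  using lf_sum[OF assms(1), of "\<lambda>i. sc (co i x) i" B] by (simp add: assms(2) lfD(2)[OF assms(1)] mult.commute)

lemma additive_sum:
  fixes F :: "('c \<Rightarrow> 'k) \<Rightarrow> 'k"
  assumes "\<And>f g. F (\<lambda>x. f x + g x) = F f + F g" "F (\<lambda>_. 0) = 0"
  shows "F (\<lambda>x. \<Sum>i\<in>I. f i x) = (\<Sum>i\<in>I. F (f i))"
  by (induction I rule: infinite_finite_induct) (auto simp: assms)

text \<open>In finite dimension \<open>\<beta> a b\<close> is the finite sum of the products
  \<open>\<beta> a i * co i b\<close>, so additive operators on forms are determined by products of
  functionals. Arbitrary operators \<open>F\<close> and \<open>G\<close> are allowed because the two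
  sides to be compared are nested Sweedler sums in the form itself.\<close>

lemma bil_ext:
  assumes "\<And>f g. F (\<lambda>a b. f a b + g a b) = F f + F g" "F (\<lambda>a b. 0) = (0::'k)"
    and "\<And>f g. G (\<lambda>a b. f a b + g a b) = G f + G g" "G (\<lambda>a b. 0) = (0::'k)"
    and FG: "\<And>\<phi> \<psi>. lf \<phi> \<Longrightarrow> lf \<psi> \<Longrightarrow> F (\<lambda>a b. \<phi> a * \<psi> b) = G (\<lambda>a b. \<phi> a * \<psi> b)"
    and b: "bil \<beta>"
  shows "F \<beta> = G \<beta>"
proof -
  obtain B co where B: "\<And>i. lf (co i)" "\<And>x. (\<Sum>i\<in>B. sc (co i x) i) = x"
    by (rule dual_basis) blast
  have e: "\<beta> = (\<lambda>a b. \<Sum>i\<in>B. \<beta> a i * co i b)"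
    by (intro ext lf_expand B bil_lin[OF b] lin)
  show ?thesis
    using additive_sum[of "\<lambda>f. F (curry f)" "\<lambda>i p. \<beta> (fst p) i * co i (snd p)" B]
      additive_sum[of "\<lambda>f. G (curry f)" "\<lambda>i p. \<beta> (fst p) i * co i (snd p)" B]
      assms(1-4) FG[OF bil_1[OF b le_id] B(1)]
    by (subst (1 2) e) (simp add: curry_def)
qed

lemma tri_ext:
  assumes "\<And>f g. F (\<lambda>a b c. f a b c + g a b c) = F f + F g" "F (\<lambda>a b c. 0) = (0::'k)"
    and "\<And>f g. G (\<lambda>a b c. f a b c + g a b c) = G f + G g" "G (\<lambda>a b c. 0) = (0::'k)"
    and FG: "\<And>\<phi> \<psi> \<chi>. lf \<phi> \<Longrightarrow> lf \<psi> \<Longrightarrow> lf \<chi> \<Longrightarrow> F (\<lambda>a b c. \<phi> a * \<psi> b * \<chi> c) = G (\<lambda>a b c. \<phi> a * \<psi> b * \<chi> c)"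
    and t: "tri \<gamma>"
  shows "F \<gamma> = G \<gamma>"
proof -
  obtain B co where B: "\<And>i. lf (co i)" "\<And>x. (\<Sum>i\<in>B. sc (co i x) i) = x"
    by (rule dual_basis) blast
  have e: "\<gamma> = (\<lambda>a b c. \<Sum>i\<in>B. \<gamma> a b i * co i c)"
    by (intro ext lf_expand B tri_lin[OF t] lin)
  have "F (\<lambda>a b c. \<gamma> a b i * co i c) = G (\<lambda>a b c. \<gamma> a b i * co i c)" for i
  proof (rule bil_ext[where F = "\<lambda>\<beta>. F (\<lambda>a b c. \<beta> a b * co i c)" and G = "\<lambda>\<beta>. G (\<lambda>a b c. \<beta> a b * co i c)"])
    show "bil (\<lambda>a b. \<gamma> a b i)" by (intro lin tri_lin[OF t])
  qed (simp_all add: distrib_right assms(1-4) FG B)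
  then show ?thesis
    using additive_sum[of "\<lambda>f. F (\<lambda>a b c. f (a, b, c))" "\<lambda>i (a, b, c). \<gamma> a b i * co i c" B]
      additive_sum[of "\<lambda>f. G (\<lambda>a b c. f (a, b, c))" "\<lambda>i (a, b, c). \<gamma> a b i * co i c" B]
      assms(1-4)
    by (subst (1 2) e) simp
qed

lemma nondegenerate_represents:
  assumes b: "bil \<beta>" and inj: "\<And>h. (\<And>x. \<beta> h x = 0) \<Longrightarrow> h = 0" and f: "lf \<phi>"
  shows "\<exists>h. \<forall>x. \<beta> h x = \<phi> x"
proof -
  obtain B co where B: "finite B" "\<And>i. lf (co i)" "\<And>x. (\<Sum>i\<in>B. sc (co i x) i) = x"
    "\<And>i j. i \<in> B \<Longrightarrow> j \<in> B \<Longrightarrow> co i j = (if i = j then 1 else 0)"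
    by (rule dual_basis) blast
  \<comment> \<open>The coordinates of the functional \<open>\<beta> h\<close> in the dual basis are
    packed into an element of \<open>H\<close>. This makes \<open>M\<close> an endomorphism, for
    which injectivity gives surjectivity.\<close>
  define M where "M h = (\<Sum>i\<in>B. sc (\<beta> h i) i)" for h
  have M: "le M"
    unfolding M_def le_iff using b
    by (auto simp: bil_def lf_iff scale_left_distrib sum.distrib scale_sum_right)
  have coM: "co j (\<Sum>i\<in>B. sc (f i) i) = f j" if "j \<in> B" for j f
  proof -
    have "co j (\<Sum>i\<in>B. sc (f i) i) = (\<Sum>i\<in>B. f i * (if j = i then 1 else 0))"
      using that by (simp add: lf_sum B(2) lfD B(4))
    also have "\<dots> = (\<Sum>i\<in>B. if j = i then f i else 0)" by (rule sum.cong) auto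
    also have "\<dots> = f j" using that B(1) by simp
    finally show ?thesis .
  qed
  have ker: "h = 0" if "M h = 0" for h
  proof (rule inj)
    fix x
    have "\<beta> h i = 0" if "i \<in> B" for i
      using coM[OF that, of "\<beta> h"] \<open>M h = 0\<close> lf_zero[OF B(2)] by (simp add: M_def)
    moreover have "\<beta> h x = (\<Sum>i\<in>B. \<beta> h i * co i x)"
      by (intro lf_expand B bil_lin[OF b] lin)
    ultimately show "\<beta> h x = 0" by simp
  qed
  have "inj M"
  proof (rule injI)
    fix x y assume "M x = M y"
    moreover have "M (x - y + y) = M (x - y) + M y" by (rule leD(1)[OF M])
    ultimately have "M (x - y) = 0" by simp
    then have "x - y = 0" by (rule ker)
    then show "x = y" by simp
  qed
  then obtain h where h: "M h = (\<Sum>i\<in>B. sc (\<phi> i) i)"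
    using le_inj_surj[OF M] by (metis surjD)
  have "\<beta> h i = \<phi> i" if "i \<in> B" for i
    using coM[OF that, of "\<beta> h"] coM[OF that, of \<phi>] h by (simp add: M_def)
  then have "\<beta> h x = \<phi> x" for x
    using lf_expand[where co = co, OF bil_2[OF b le_id, of h] B(3)[of x]] lf_expand[where co = co, OF f B(3)[of x]] by simp
  then show ?thesis by blast
qed

text \<open>The snake identity kills the left radical of \<beta>; by finite dimension every
  functional is then \<open>\<beta> h\<close> for some \<open>h\<close>, so agreement of
  \<open>z\<close> and \<open>z'\<close> under all \<open>\<beta> h\<close> is agreement under all
  functionals.\<close>

lemma snake_nondegenerate:
  assumes b: "bil \<beta>" and snake: "\<And>h \<phi>. lf \<phi> \<Longrightarrow> sw H t (\<lambda>x y. \<beta> h x * \<phi> y) = \<phi> h"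
    and z: "\<And>h. \<beta> h z = \<beta> h z'"
  shows "z = z'"
proof (rule lf_separate)
  fix \<phi> assume f: "lf \<phi>"
  have "h = 0" if "\<And>x. \<beta> h x = 0" for h
    using snake[of _ h] that by (intro lf_separate) (simp add: lf_zero)
  from nondegenerate_represents[OF b this f] z show "\<phi> z = \<phi> z'" by metis
qed

text \<open>One snake identity implies the other in finite dimension: \<open>N\<close> is the value
  of the second snake at \<open>h\<close>, and the first one shows that \<open>N\<close> and
  \<open>h\<close> pair equally with everything.\<close>

lemma snake_flip:
  assumes b: "bil \<beta>" and snake: "\<And>h \<phi>. lf \<phi> \<Longrightarrow> sw H t (\<lambda>x y. \<beta> h x * \<phi> y) = \<phi> h"
    and f: "lf \<phi>"
  shows "sw H t (\<lambda>x y. \<beta> y h * \<phi> x) = \<phi> h"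
proof -
  define N where "N = sw H t (\<lambda>x y. sc (\<beta> y h) x)"
  have N: "\<psi> N = sw H t (\<lambda>x y. \<beta> y h * \<psi> x)" if "lf \<psi>" for \<psi>
    by (simp add: N_def sw_lf that lfD)
  have "N = h"
  proof (rule snake_nondegenerate[OF b snake])
    fix a
    have "\<beta> a N = sw H t (\<lambda>x y. \<beta> a x * \<beta> y h)"
      by (subst N[OF bil_2[OF b le_id]]) (simp add: mult.commute)
    also have "\<dots> = \<beta> a h" by (intro snake bil_lin[OF b] lin)
    finally show "\<beta> a N = \<beta> a h" .
  qed
  then show ?thesis using N[OF f] by simp
qed

section \<open>Factorisability and bijectivity of the antipode\<close>

lemma Q_map:
  assumes f: "lf \<phi>" and c: "lf \<chi>"
  shows "\<chi> (sw H (qmat H) (\<lambda>a b. sc (\<phi> a) b)) = RS (\<lambda>r s. RS (\<lambda>p q. \<phi> (s * p) * \<chi> (r * q)))"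
proof -
  have t: "sw H (rmat H) (\<lambda>a b. tens2 H b a) \<in> car HH"
    by (rule sw_in) (simp_all add: tens2_in rmat_in)
  note l = lin lf_comp[OF f] lf_comp[OF c]
  have "\<chi> (sw H (qmat H) (\<lambda>a b. sc (\<phi> a) b)) = sw H (qmat H) (\<lambda>a b. \<phi> a * \<chi> b)"
    by (simp add: sw_lf lfD c)
  also have "\<dots> = sw H (sw H (rmat H) (\<lambda>a b. tens2 H b a)) (\<lambda>a b. RS (\<lambda>p q. \<phi> (a * p) * \<chi> (b * q)))"
    unfolding qmat_def by (rule sw_tmult[OF t rmat_in]) (intro l)
  also have "\<dots> = RS (\<lambda>r s. RS (\<lambda>p q. \<phi> (s * p) * \<chi> (r * q)))"
    by (subst sw_sw; (intro l rmat_in tens2_in)?) (intro sw_cong sw_tens2 l)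
  finally show ?thesis .
qed

lemma Q_bij: "bij_betw (\<lambda>\<phi>. sw H (qmat H) (\<lambda>a b. sc (\<phi> a) b)) {\<phi>. lf \<phi>} UNIV"
  using factorisable by (simp add: is_factorisable_def lf_linear)

lemma Q_onto: "\<exists>\<phi>. lf \<phi> \<and> (\<forall>\<chi>. lf \<chi> \<longrightarrow> RS (\<lambda>r s. RS (\<lambda>p q. \<phi> (s * p) * \<chi> (r * q))) = \<chi> g)"
proof -
  have "g \<in> (\<lambda>\<phi>. sw H (qmat H) (\<lambda>a b. sc (\<phi> a) b)) ` {\<phi>. lf \<phi>}"
    using Q_bij by (simp add: bij_betw_def)
  then show ?thesis using Q_map by auto
qed

lemma Q_inj:
  assumes f: "lf \<phi>" "lf \<phi>'" and eq: "\<And>\<chi>. lf \<chi> \<Longrightarrow> RS (\<lambda>r s. RS (\<lambda>p q. \<phi> (s * p) * \<chi> (r * q))) =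
      RS (\<lambda>r s. RS (\<lambda>p q. \<phi>' (s * p) * \<chi> (r * q)))"
  shows "\<phi> = \<phi>'"
proof -
  have "sw H (qmat H) (\<lambda>a b. sc (\<phi> a) b) = sw H (qmat H) (\<lambda>a b. sc (\<phi>' a) b)"
    by (rule lf_separate) (simp add: Q_map f eq)
  then show ?thesis using Q_bij f by (auto simp: bij_betw_def inj_on_def)
qed

text \<open>\<open>S \<otimes> S\<close> exchanges \<open>\<R>\<^sub>2\<^sub>1 \<R>\<close> with \<open>\<R> \<R>\<^sub>2\<^sub>1\<close>, so that both are nondegenerate and \<open>S\<close> is onto.\<close>

lemma Q_S:
  assumes f: "lf \<phi>" "lf \<chi>"
  shows "RS (\<lambda>r s. RS (\<lambda>p q. \<phi> (s * p) * \<chi> (r * q))) = PS (\<lambda>x y. \<phi> (S x) * \<chi> (S y))"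
proof -
  note l = lin lf_comp[OF f(1)] lf_comp[OF f(2)]
  have "RS (\<lambda>r s. RS (\<lambda>p q. \<phi> (s * p) * \<chi> (r * q))) =
      RS (\<lambda>r s. RS (\<lambda>p q. \<phi> (S s * p) * \<chi> (S r * q)))"
    by (rule R_SS[symmetric]) (intro l)
  also have "\<dots> = RS (\<lambda>r s. RS (\<lambda>p q. \<phi> (S s * S p) * \<chi> (S r * S q)))"
    by (intro sw_cong R_SS[symmetric] l)
  also have "\<dots> = PS (\<lambda>x y. \<phi> (S x) * \<chi> (S y))"
    by (subst sw_swap) (simp add: S_mult)
  finally show ?thesis .
qed

lemma S_bij: "bij S"
proof -
  have "\<exists>h. g = S h" for g
  proof -
    obtain \<phi> where f: "lf \<phi>" and \<phi>: "\<And>\<chi>. lf \<chi> \<Longrightarrow> RS (\<lambda>r s. RS (\<lambda>p q. \<phi> (s * p) * \<chi> (r * q))) = \<chi> g"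
      using Q_onto by blast
    have "\<chi> g = \<chi> (S (PS (\<lambda>x y. sc (\<phi> (S x)) y)))" if c: "lf \<chi>" for \<chi>
      using \<phi>[OF c] Q_S[OF f c] lf_comp[OF c le_S[OF le_id]]
      by (simp add: sw_lf[where \<phi> = "\<lambda>x. \<chi> (S x)"] lfD[where \<phi> = "\<lambda>x. \<chi> (S x)"])
    then show ?thesis using lf_separate by blast
  qed
  then have "surj S" by (auto simp: surj_def)
  then show ?thesis using le_surj_inj[OF le_S[OF le_id]] by (simp add: bij_def)
qed

lemma P_inj:
  assumes f: "lf \<phi>" "lf \<phi>'"
    and eq: "\<And>\<chi>. lf \<chi> \<Longrightarrow> PS (\<lambda>x y. \<phi> x * \<chi> y) = PS (\<lambda>x y. \<phi>' x * \<chi> y)"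
  shows "\<phi> = \<phi>'"
proof -
  let ?T = "inv S"
  have TS: "?T (S x) = x" and ST: "S (?T x) = x" for x
    using S_bij by (simp_all add: bij_def surj_f_inv_f)
  have T: "le ?T"
    unfolding le_iff using leD[OF le_S[OF le_id]] TS ST by metis
  have "(\<lambda>x. \<phi> (?T x)) = (\<lambda>x. \<phi>' (?T x))"
  proof (rule Q_inj)
    show "lf (\<lambda>x. \<phi> (?T x))" "lf (\<lambda>x. \<phi>' (?T x))" using f T by (auto intro: lf_comp)
    fix \<chi> assume c: "lf \<chi>"
    show "RS (\<lambda>r s. RS (\<lambda>p q. \<phi> (?T (s * p)) * \<chi> (r * q))) =
        RS (\<lambda>r s. RS (\<lambda>p q. \<phi>' (?T (s * p)) * \<chi> (r * q)))"
      using Q_S[OF lf_comp[OF f(1) T] c] Q_S[OF lf_comp[OF f(2) T] c] eq[OF lf_comp[OF c le_S[OF le_id]]]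
      by (simp add: TS)
  qed
  then show ?thesis using TS by (metis (no_types, lifting) ext)
qed

text \<open>Factorisability is applied at \<open>S y\<close>. By \<open>Q_S\<close> it yields an
  element \<open>N\<close> obtained from \<open>P\<close> with \<open>S N = S y\<close>, and
  \<open>S\<close> is injective.\<close>

lemma P_onto: "\<exists>\<kappa>. lf \<kappa> \<and> (\<forall>\<chi>. lf \<chi> \<longrightarrow> PS (\<lambda>x z. \<kappa> x * \<chi> z) = \<chi> y)"
proof -
  obtain \<phi> where f: "lf \<phi>" and \<phi>: "\<And>\<chi>. lf \<chi> \<Longrightarrow> RS (\<lambda>r s. RS (\<lambda>p q. \<phi> (s * p) * \<chi> (r * q))) = \<chi> (S y)"
    using Q_onto by blast
  have k: "lf (\<lambda>x. \<phi> (S x))" by (intro lf_comp[OF f] lin)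
  define N where "N = PS (\<lambda>x z. sc (\<phi> (S x)) z)"
  have N: "\<chi> N = PS (\<lambda>x z. \<phi> (S x) * \<chi> z)" if "lf \<chi>" for \<chi>
    by (simp add: N_def sw_lf that lfD)
  have "S N = S y"
    by (rule lf_separate) (simp add: N[OF lf_comp[OF _ le_S[OF le_id]]] Q_S[OF f, symmetric] \<phi>)
  then have "N = y" using S_bij by (simp add: bij_def inj_eq)
  then show ?thesis using N k by auto
qed

text \<open>\<open>kap\<close> inverts the bijection \<open>\<phi> \<mapsto> \<phi>(P\<^sup>1) P\<^sup>2\<close> from \<open>H\<^sup>*\<close> onto \<open>H\<close>.\<close>

definition kap :: "'h \<Rightarrow> 'h \<Rightarrow> 'k" where
  "kap y = (SOME \<kappa>. lf \<kappa> \<and> (\<forall>\<chi>. lf \<chi> \<longrightarrow> PS (\<lambda>x z. \<kappa> x * \<chi> z) = \<chi> y))"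

lemma kap_lf: "lf (kap y)" and kap_P: "lf \<chi> \<Longrightarrow> PS (\<lambda>x z. kap y x * \<chi> z) = \<chi> y"
  using someI_ex[OF P_onto[of y]] by (auto simp: kap_def)

lemma kap_unique: "lf \<psi> \<Longrightarrow> (\<And>\<chi>. lf \<chi> \<Longrightarrow> PS (\<lambda>x z. \<psi> x * \<chi> z) = \<chi> y) \<Longrightarrow> \<psi> = kap y"
  by (rule P_inj) (simp_all add: kap_lf kap_P)

lemma kap_surj:
  assumes f: "lf \<phi>"
  shows "\<exists>y. \<phi> = kap y"
proof
  show "\<phi> = kap (PS (\<lambda>x z. sc (\<phi> x) z))"
    by (rule kap_unique[OF f]) (simp add: sw_lf lfD)
qed

lemma lf_kap1: "le f \<Longrightarrow> lf (\<lambda>x. kap y (f x))"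
  by (rule lf_comp[OF kap_lf])

lemma kap_linear: "lf (\<lambda>y. kap y x)"
proof -
  have "kap (y + z) = (\<lambda>x. kap y x + kap z x)" for y z
  proof (rule kap_unique[symmetric])
    show "lf (\<lambda>x. kap y x + kap z x)"
      using kap_lf[of y] kap_lf[of z] by (simp add: lf_iff algebra_simps)
    show "PS (\<lambda>x v. (kap y x + kap z x) * \<chi> v) = \<chi> (y + z)" if c: "lf \<chi>" for \<chi>
      by (simp add: distrib_right sw_plus kap_P[OF c] lfD(1)[OF c])
  qed
  moreover have "kap (sc c y) = (\<lambda>x. c * kap y x)" for y c
  proof (rule kap_unique[symmetric])
    show "lf (\<lambda>x. c * kap y x)" by (intro lin kap_lf)
    show "PS (\<lambda>x z. c * kap y x * \<chi> z) = \<chi> (sc c y)" if "lf \<chi>" for \<chi>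
      using kap_P[OF that, of y] by (simp add: lfD(2)[OF that] sw_cmult(1)[symmetric] mult.assoc)
  qed
  ultimately show ?thesis by (simp add: lf_iff)
qed

lemma lf_kap2: "le f \<Longrightarrow> lf (\<lambda>y. kap (f y) x)"
  by (rule lf_comp[OF kap_linear])

lemmas lin_kap = lin_sb lf_kap1 lf_kap2

text \<open>By uniqueness it suffices to evaluate both sides on \<open>P\<close>. There
  \<open>P_BD\<close> produces two independent copies of \<open>P\<close>, which recover
  \<open>y\<close> and \<open>z\<close> one after the other.\<close>

lemma kap_BD: "BD h (\<lambda>a b. kap y a * kap z b) = kap (y * z) h"
proof -
  have "(\<lambda>h. BD h (\<lambda>a b. kap y a * kap z b)) = kap (y * z)"
  proof (rule kap_unique)
    show "lf (\<lambda>h. BD h (\<lambda>a b. kap y a * kap z b))" by (intro lin_kap)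
    fix \<chi> assume c: "lf \<chi>"
    note l = lin_kap lf_comp[OF c]
    have "PS (\<lambda>x v. BD x (\<lambda>a b. kap y a * kap z b) * \<chi> v) = PS (\<lambda>x v. BD x (\<lambda>a b. kap y a * kap z b * \<chi> v))"
      by (simp add: sw_cmult)
    also have "\<dots> = PS (\<lambda>x v. PS (\<lambda>x' v'. kap y x * kap z x' * \<chi> (v * v')))"
      by (rule P_BD) (intro l)
    also have "\<dots> = PS (\<lambda>x v. kap y x * PS (\<lambda>x' v'. kap z x' * \<chi> (v * v')))"
      by (simp add: sw_cmult mult.assoc)
    also have "\<dots> = PS (\<lambda>x v. kap y x * \<chi> (v * z))"
      by (subst kap_P, intro l) simp
    also have "\<dots> = \<chi> (y * z)" by (rule kap_P) (intro l)
    finally show "PS (\<lambda>x v. BD x (\<lambda>a b. kap y a * kap z b) * \<chi> v) = \<chi> (y * z)" .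
  qed
  then show ?thesis by (rule fun_cong)
qed

lemma kap_one: "kap 1 = eps"
  by (rule kap_unique[symmetric]) (use P_eps1 in \<open>auto intro: lin\<close>)

lemma kap_at_1: "kap y 1 = eps y"
  by (rule trans[OF P_eps2[OF kap_lf, symmetric] kap_P]) (intro lin)

lemma kap_ad: "kap y (ad h x) = D h (\<lambda>a b. kap (S a * y * b) x)"
proof -
  have "(\<lambda>x. kap y (ad h x)) = kap (D h (\<lambda>a b. S a * y * b))"
  proof (rule kap_unique)
    show "lf (\<lambda>x. kap y (ad h x))" by (intro lin_kap)
    fix \<chi> assume c: "lf \<chi>"
    note l = lin_kap lf_comp[OF c]
    have "PS (\<lambda>x v. kap y (ad h x) * \<chi> v) = D h (\<lambda>a b. PS (\<lambda>x v. kap y x * \<chi> (S a * v * b)))"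
      by (rule P_ad) (intro l)
    also have "\<dots> = D h (\<lambda>a b. \<chi> (S a * y * b))"
      by (intro sw_cong kap_P l)
    finally show "PS (\<lambda>x v. kap y (ad h x) * \<chi> v) = \<chi> (D h (\<lambda>a b. S a * y * b))"
      by (simp add: sw_lf c)
  qed
  then show ?thesis by (simp add: fun_eq_iff sw_lf[OF kap_linear])
qed

section \<open>Properties of the braided coproduct obtained by duality\<close>

lemma BD_coassoc:
  assumes g: "tri \<gamma>"
  shows "BD h (\<lambda>a b. BD a (\<lambda>c d. \<gamma> c d b)) = BD h (\<lambda>a b. BD b (\<lambda>c d. \<gamma> a c d))"
proof (rule tri_ext[where F = "\<lambda>\<gamma>. BD h (\<lambda>a b. BD a (\<lambda>c d. \<gamma> c d b))"
      and G = "\<lambda>\<gamma>. BD h (\<lambda>a b. BD b (\<lambda>c d. \<gamma> a c d))" and \<gamma> = \<gamma>])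
  fix \<phi> \<psi> \<chi> assume lf: "lf \<phi>" "lf \<psi>" "lf \<chi>"
  obtain x y z where "\<phi> = kap x" "\<psi> = kap y" "\<chi> = kap z"
    using kap_surj[OF lf(1)] kap_surj[OF lf(2)] kap_surj[OF lf(3)] by (elim exE)
  moreover have "BD h (\<lambda>a b. BD a (\<lambda>c d. kap x c * kap y d * kap z b)) = kap (x * y * z) h"
    by (simp add: sw_cmult(2)[symmetric] kap_BD)
  moreover have "BD h (\<lambda>a b. BD b (\<lambda>c d. kap x a * kap y c * kap z d)) = kap (x * (y * z)) h"
    by (simp add: mult.assoc sw_cmult(1)[symmetric] kap_BD)
  ultimately show "BD h (\<lambda>a b. BD a (\<lambda>c d. \<phi> c * \<psi> d * \<chi> b)) = BD h (\<lambda>a b. BD b (\<lambda>c d. \<phi> a * \<psi> c * \<chi> d))"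
    by (simp add: mult.assoc)
qed (simp_all add: sw_plus g)

lemma BD_counit_l: "lf \<phi> \<Longrightarrow> BD h (\<lambda>a b. eps a * \<phi> b) = \<phi> h"
  by (drule kap_surj) (auto simp: kap_one[symmetric] kap_BD)

lemma BD_counit_r: "lf \<phi> \<Longrightarrow> BD h (\<lambda>a b. \<phi> a * eps b) = \<phi> h"
  by (drule kap_surj) (auto simp: kap_one[symmetric] kap_BD)

text \<open>Under \<open>kap\<close> the adjoint action is transposed to
  \<open>y \<mapsto> S h\<^sub>1 y h\<^sub>2\<close>. Equivariance of the coproduct says that this
  operation is compatible with products, which holds because the inner
  \<open>h\<^sub>2 S h\<^sub>3\<close> cancels.\<close>

lemma BD_ad:
  assumes b: "bil \<beta>"
  shows "BD (ad h x) \<beta> = D h (\<lambda>e f. BD x (\<lambda>a b. \<beta> (ad e a) (ad f b)))"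
proof (rule bil_ext[where F = "\<lambda>\<beta>. BD (ad h x) \<beta>"
      and G = "\<lambda>\<beta>. D h (\<lambda>e f. BD x (\<lambda>a b. \<beta> (ad e a) (ad f b)))" and \<beta> = \<beta>])
  fix \<phi> \<psi> assume lf: "lf \<phi>" "lf \<psi>"
  obtain y z where yz: "\<phi> = kap y" "\<psi> = kap z"
    using kap_surj[OF lf(1)] kap_surj[OF lf(2)] by (elim exE)
  have "D h (\<lambda>e f. BD x (\<lambda>a b. kap y (ad e a) * kap z (ad f b))) =
      D h (\<lambda>e f. BD x (\<lambda>a b. D e (\<lambda>p q. D f (\<lambda>u v. kap (S p * y * q) a * kap (S u * z * v) b))))"
    by (simp only: kap_ad sw_cmult(2)) (simp only: sw_cmult(1))
  also have "\<dots> = D h (\<lambda>e f. D e (\<lambda>p q. D f (\<lambda>u v. kap (S p * y * q * (S u * z * v)) x)))"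
    by (subst sw_swap[of "dc x"], subst sw_swap[of "dc x"]) (simp add: kap_BD)
  also have "\<dots> = D h (\<lambda>p f. D f (\<lambda>q f. D f (\<lambda>u v. kap (S p * y * q * (S u * z * v)) x)))"
    by (rule D_coassoc) (intro lin_kap)
  also have "\<dots> = D h (\<lambda>p f. D f (\<lambda>g v. D g (\<lambda>q u. kap (S p * y * q * (S u * z * v)) x)))"
    by (intro sw_cong D_coassoc[symmetric] lin_kap)
  also have "\<dots> = D h (\<lambda>p f. D f (\<lambda>g v. D g (\<lambda>q u. kap (S p * y * (q * S u) * z * v) x)))"
    by (simp add: mult.assoc)
  also have "\<dots> = D h (\<lambda>p f. D f (\<lambda>g v. eps g * kap (S p * y * 1 * z * v) x))"
    by (intro sw_cong S_r[where \<phi> = "\<lambda>w. kap (_ * w * _ * _) _"] lin_kap)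
  also have "\<dots> = D h (\<lambda>p f. kap (S p * y * 1 * z * f) x)"
    by (intro sw_cong D_counit_l lin_kap)
  also have "\<dots> = BD (ad h x) (\<lambda>a b. kap y a * kap z b)"
    by (simp add: kap_BD kap_ad mult.assoc)
  finally show "BD (ad h x) (\<lambda>a b. \<phi> a * \<psi> b) = D h (\<lambda>e f. BD x (\<lambda>a b. \<phi> (ad e a) * \<psi> (ad f b)))"
    by (simp add: yz)
qed (simp_all add: sw_plus b)

end

section \<open>Integrals\<close>

locale factorisable_hopf_integral = factorisable_hopf H for H :: "('k::field, 'h::ring_1) qtha" +
  fixes \<Lambda> :: 'h
  assumes left_integral: "is_left_integral_in H \<Lambda>"
    and integral_nonzero: "\<Lambda> \<noteq> 0"
    and S_integral: "antipode H \<Lambda> = \<Lambda>"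
begin

lemma Lam_l: "h * \<Lambda> = sc (eps h) \<Lambda>"
  using left_integral by (simp add: is_left_integral_in_def)

text \<open>Surjectivity of \<open>S\<close> allows \<open>h\<close> to be written as
  \<open>S g\<close>; the antimultiplicative \<open>S\<close>, which fixes \<Lambda>, then carries
  the left integral property to the right.\<close>

lemma Lam_r: "\<Lambda> * h = sc (eps h) \<Lambda>"
proof -
  obtain g where g: "h = S g" using bij_is_surj[OF S_bij] by (rule surjE)
  have "\<Lambda> * S g = S (g * \<Lambda>)" by (simp add: S_mult S_integral)
  also have "\<dots> = sc (eps g) (S \<Lambda>)" by (simp add: Lam_l leD(2)[OF le_S[OF le_id]])
  finally show ?thesis by (simp add: g S_integral)
qed

lemma ad_Lam: "ad h \<Lambda> = sc (eps h) \<Lambda>"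
proof (rule lf_separate)
  fix \<phi> assume f: "lf \<phi>"
  have "\<phi> (ad h \<Lambda>) = D h (\<lambda>a b. eps a * eps b) * \<phi> \<Lambda>"
    by (simp add: ad_lf[OF f] Lam_l Lam_r lfD(2)[OF f] sw_cmult(2) mult.assoc)
  also have "\<dots> = \<phi> (sc (eps h) \<Lambda>)"
    by (subst D_counit_l) (auto simp: lfD f intro: lin)
  finally show "\<phi> (ad h \<Lambda>) = \<phi> (sc (eps h) \<Lambda>)" .
qed

definition J0 :: "'h \<Rightarrow> 'k" where "J0 = kap \<Lambda>"

lemma J0_lf: "lf J0" by (simp add: J0_def kap_lf)

lemma J0_ad: "J0 (ad h x) = eps h * J0 x"
proof -
  have "J0 (ad h x) = D h (\<lambda>a b. eps a * eps b) * J0 x"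
    by (simp add: J0_def kap_ad Lam_l Lam_r lfD(2)[OF kap_linear] sw_cmult(2) mult.assoc)
  also have "\<dots> = eps h * J0 x" by (subst D_counit_l) (auto intro: lin)
  finally show ?thesis .
qed

text \<open>Dual to \<open>\<Lambda> * z = \<epsilon>(z) \<Lambda>\<close>: the functional is
  \<open>kap z\<close> for some \<open>z\<close>, and its value at \<open>1\<close> is
  \<open>eps z\<close>.\<close>

lemma J0_BD: "lf \<phi> \<Longrightarrow> BD h (\<lambda>a b. J0 a * \<phi> b) = J0 h * \<phi> 1"
  by (drule kap_surj)
    (auto simp: J0_def kap_BD Lam_r lfD(2)[OF kap_linear] kap_at_1)

text \<open>For the ordinary coproduct \<open>P\<close> occurs nested, so evaluation of the inner
  copy leaves \<open>s * \<Lambda> * p\<close>. The two-sided integral absorbs \<open>s\<close> and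
  \<open>p\<close>, and the counits collapse the outer copies of \<R>.\<close>

lemma J0_D:
  assumes f: "lf \<phi>"
  shows "D h (\<lambda>a b. \<phi> a * J0 b) = \<phi> 1 * J0 h"
proof -
  note l0 = lin_kap lf_comp[OF f] lf_comp[OF J0_lf]
  have "(\<lambda>h. D h (\<lambda>a b. \<phi> a * J0 b)) = (\<lambda>h. \<phi> 1 * J0 h)"
  proof (rule P_inj)
    show "lf (\<lambda>h. D h (\<lambda>a b. \<phi> a * J0 b))" "lf (\<lambda>h. \<phi> 1 * J0 h)" by (intro l0)+
    fix \<chi> assume c: "lf \<chi>"
    note l = l0 lf_comp[OF c]
    have "PS (\<lambda>x v. D x (\<lambda>a b. \<phi> a * J0 b) * \<chi> v) = PS (\<lambda>x v. D x (\<lambda>a b. \<phi> a * J0 b * \<chi> v))"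
      by (simp add: sw_cmult)
    also have "\<dots> = RS (\<lambda>r s. RS (\<lambda>p q. PS (\<lambda>x y. \<phi> (r * q) * J0 x * \<chi> (s * y * p))))"
      by (rule P_D) (intro l)
    also have "\<dots> = RS (\<lambda>r s. RS (\<lambda>p q. \<phi> (r * q) * PS (\<lambda>x y. kap \<Lambda> x * \<chi> (s * y * p))))"
      by (simp add: sw_cmult mult.assoc J0_def)
    also have "\<dots> = RS (\<lambda>r s. RS (\<lambda>p q. \<phi> (r * q) * \<chi> (s * \<Lambda> * p)))"
      by (subst kap_P, intro l) simp
    also have "\<dots> = RS (\<lambda>r s. RS (\<lambda>p q. eps p * \<phi> (r * q)) * eps s) * \<chi> \<Lambda>"
      by (simp add: Lam_l Lam_r lfD c sw_cmult mult_ac)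
    also have "\<dots> = \<phi> 1 * \<chi> \<Lambda>"
      by (subst R_eps1, intro l, subst R_eps2, intro l) simp
    also have "\<dots> = PS (\<lambda>x v. \<phi> 1 * J0 x * \<chi> v)"
      using kap_P[OF c, of \<Lambda>] by (simp add: J0_def sw_cmult[symmetric] mult.assoc)
    finally show "PS (\<lambda>x v. D x (\<lambda>a b. \<phi> a * J0 b) * \<chi> v) = PS (\<lambda>x v. \<phi> 1 * J0 x * \<chi> v)" .
  qed
  then show ?thesis by (rule fun_cong)
qed

text \<open>\<open>S a\<^sub>1 a\<^sub>2\<close> is created by applying the left integral property
  to the product \<open>a\<^sub>2 b\<close>. The resulting transfer of a coproduct from one factor
  to the other drives the nonvanishing argument.\<close>

lemma J0_shift:
  assumes f: "lf \<phi>"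
  shows "D b (\<lambda>c d. \<phi> c * J0 (a * d)) = D a (\<lambda>c d. \<phi> (S c) * J0 (d * b))"
proof -
  note l = lin_kap lf_comp[OF f] lf_comp[OF J0_lf]
  have "D a (\<lambda>c d. \<phi> (S c) * J0 (d * b)) = D a (\<lambda>c d. \<phi> (S c * 1) * J0 (d * b))" by simp
  also have "\<dots> = D a (\<lambda>c d. D (d * b) (\<lambda>u v. \<phi> (S c * u) * J0 v))"
    by (intro sw_cong J0_D[symmetric] l)
  also have "\<dots> = D a (\<lambda>c d. D d (\<lambda>e f. D b (\<lambda>u v. \<phi> (S c * (e * u)) * J0 (f * v))))"
    by (intro sw_cong D_mult l)
  also have "\<dots> = D a (\<lambda>d f. D d (\<lambda>c e. D b (\<lambda>u v. \<phi> (S c * (e * u)) * J0 (f * v))))"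
    by (rule D_coassoc[symmetric]) (intro l)
  also have "\<dots> = D a (\<lambda>d f. D b (\<lambda>u v. D d (\<lambda>c e. \<phi> (S c * e * u) * J0 (f * v))))"
    by (subst (2) sw_swap) (simp add: mult.assoc)
  also have "\<dots> = D a (\<lambda>d f. D b (\<lambda>u v. eps d * (\<phi> (1 * u) * J0 (f * v))))"
    by (intro sw_cong S_l[where \<phi> = "\<lambda>z. \<phi> (z * _) * _"] l)
  also have "\<dots> = D b (\<lambda>u v. D a (\<lambda>d f. eps d * (\<phi> (1 * u) * J0 (f * v))))"
    by (rule sw_swap)
  also have "\<dots> = D b (\<lambda>u v. \<phi> (1 * u) * J0 (a * v))"
    by (intro sw_cong D_counit_l l)
  finally show ?thesis by simp
qed

text \<open>If \<open>J0 \<Lambda>\<close> vanished, \<open>J0_shift\<close> would give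
  \<open>\<Lambda>\<^sub>1 J0 (a \<Lambda>\<^sub>2) = 0\<close> for all \<open>a\<close>, and after
  a second shift \<open>\<Lambda>\<^sub>1 \<otimes> \<Lambda>\<^sub>2 J0 (a \<Lambda>\<^sub>3) =
  0\<close>. With \<open>y S \<Lambda>\<^sub>2\<close> in the place of \<open>a\<close> this becomes
  \<open>\<Lambda> J0 y = 0\<close>, so \<open>J0\<close> would be zero.\<close>

lemma J0_Lam_nonzero: "J0 \<Lambda> \<noteq> 0"
proof
  assume "J0 \<Lambda> = 0"
  then have B: "D \<Lambda> (\<lambda>c d. \<phi> c * J0 (a * d)) = 0" if "lf \<phi>" for \<phi> a
    by (simp add: J0_shift[OF that] Lam_l lfD[OF J0_lf])
  have C: "D \<Lambda> (\<lambda>c d. D d (\<lambda>e f. \<phi> c * \<psi> e * J0 (a * f))) = 0" if f: "lf \<phi>" and p: "lf \<psi>" for \<phi> \<psi> a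
  proof -
    have "D \<Lambda> (\<lambda>c d. D d (\<lambda>e f. \<phi> c * \<psi> e * J0 (a * f))) =
        D \<Lambda> (\<lambda>c d. \<phi> c * D a (\<lambda>e f. \<psi> (S e) * J0 (f * d)))"
      by (simp add: J0_shift[OF p, symmetric] sw_cmult mult.assoc)
    also have "\<dots> = D a (\<lambda>e f. \<psi> (S e) * D \<Lambda> (\<lambda>c d. \<phi> c * J0 (f * d)))"
      unfolding sw_cmult by (subst sw_swap) (simp add: mult_ac)
    also have "\<dots> = 0" by (simp add: B f)
    finally show ?thesis .
  qed
  obtain B co where bas: "\<And>i. lf (co i)" "\<And>x. (\<Sum>i\<in>B. sc (co i x) i) = x"
    by (rule dual_basis) blast
  have sum: "sw H t (\<lambda>a b. \<Sum>i\<in>B. f i a b) = (\<Sum>i\<in>B. sw H t (f i))" for t and f :: "_ \<Rightarrow> _ \<Rightarrow> _ \<Rightarrow> 'k"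
    by (induction B rule: infinite_finite_induct) (auto simp: sw_plus)
  have E: "\<phi> \<Lambda> * J0 y = 0" if f: "lf \<phi>" for \<phi> y
  proof -
    note l = lin_kap lf_comp[OF f] lf_comp[OF J0_lf]
    have "\<phi> \<Lambda> * J0 y = D \<Lambda> (\<lambda>c d. \<phi> c * (eps d * J0 (y * 1)))"
      using D_counit_r[OF f, of \<Lambda>] by (simp add: sw_cmult[symmetric] mult.assoc[symmetric])
    also have "\<dots> = D \<Lambda> (\<lambda>c d. \<phi> c * D d (\<lambda>e f. J0 (y * (S e * f))))"
      by (subst S_l, intro l) simp
    also have "\<dots> = D \<Lambda> (\<lambda>c d. D d (\<lambda>e f. \<phi> c * J0 (y * S e * f)))"
      by (simp add: sw_cmult mult.assoc)
    \<comment> \<open>The multiplier \<open>y * S e\<close> varies with the Sweedler component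
      \<open>e\<close>, whereas \<open>C\<close> is about a fixed multiplier. Expansion in a dual
      basis separates the two.\<close>
    also have "\<dots> = D \<Lambda> (\<lambda>c d. D d (\<lambda>e f. \<Sum>i\<in>B. \<phi> c * co i e * J0 (y * S i * f)))"
    proof (intro sw_cong)
      fix c d e f
      have "J0 (y * S e * f) = (\<Sum>i\<in>B. J0 (y * S i * f) * co i e)"
        by (intro lf_expand[where \<phi> = "\<lambda>e. J0 (y * S e * f)"] bas l)
      then show "\<phi> c * J0 (y * S e * f) = (\<Sum>i\<in>B. \<phi> c * co i e * J0 (y * S i * f))"
        by (simp add: sum_distrib_left mult_ac)
    qed
    also have "\<dots> = 0" by (simp add: sum C f bas)
    finally show ?thesis .
  qed
  obtain \<phi> where f: "lf \<phi>" "\<phi> \<Lambda> \<noteq> 0"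
    using lf_separate[of \<Lambda> 0] integral_nonzero lf_zero by metis
  then have "J0 y = 0" for y using E by auto
  \<comment> \<open>The functional \<open>J0\<close> recovers \<Lambda> through \<open>P\<close>, so
    it cannot be zero.\<close>
  then have "\<phi> \<Lambda> = 0" using kap_P[OF f(1), of \<Lambda>] by (simp add: J0_def)
  with f(2) show False by simp
qed

section \<open>The normalised integral and the snake identities\<close>

definition J :: "'h \<Rightarrow> 'k" where "J x = J0 x / J0 \<Lambda>"

lemma J_lf: "lf J"
  using J0_lf by (simp add: lf_iff J_def add_divide_distrib)

lemma J_Lam [simp]: "J \<Lambda> = 1" by (simp add: J_def J0_Lam_nonzero)

lemma J_ad: "J (ad h x) = eps h * J x" by (simp add: J_def J0_ad)

lemma J_BD:
  assumes f: "lf \<phi>"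
  shows "BD h (\<lambda>a b. J a * \<phi> b) = J h * \<phi> 1"
proof -
  have "BD h (\<lambda>a b. J a * \<phi> b) = inverse (J0 \<Lambda>) * BD h (\<lambda>a b. J0 a * \<phi> b)"
    by (simp add: J_def sw_cmult divide_inverse mult_ac)
  then show ?thesis unfolding J0_BD[OF f] by (simp add: J_def divide_inverse mult_ac)
qed

lemmas lin_J = lin_kap lf_comp[OF J_lf]

text \<open>Braided counterpart of \<open>J0_shift\<close>: the right integral property is applied
  to the product \<open>a b\<^sub>1\<close>, multiplicativity of the braided coproduct splits it,
  and \<open>b\<^sub>2 S b\<^sub>3\<close> cancels. The copy of \<R> is the braiding of
  \<open>a\<^sub>2\<close> past \<open>b\<^sub>1\<close>.\<close>

lemma J_sb:
  assumes f: "lf \<phi>"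
  shows "BD b (\<lambda>c d. J (a * c) * \<phi> (sb d)) = BD a (\<lambda>c d. RS (\<lambda>r s. J (c * ad s b) * \<phi> (ad r d)))"
proof -
  note l = lin_J lf_comp[OF f]
  have "BD b (\<lambda>c d. J (a * c) * \<phi> (sb d)) = BD b (\<lambda>c d. J (a * c) * \<phi> (1 * sb d))" by simp
  also have "\<dots> = BD b (\<lambda>c d. BD (a * c) (\<lambda>u v. J u * \<phi> (v * sb d)))"
    by (intro sw_cong J_BD[symmetric] l)
  also have "\<dots> = BD b (\<lambda>c d. BD a (\<lambda>u v. BD c (\<lambda>e f. RS (\<lambda>r s. J (u * ad s e) * \<phi> (ad r v * f * sb d)))))"
    by (intro sw_cong BD_mult l)
  also have "\<dots> = BD a (\<lambda>u v. BD b (\<lambda>c d. BD c (\<lambda>e f. RS (\<lambda>r s. J (u * ad s e) * \<phi> (ad r v * f * sb d)))))"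
    by (rule sw_swap)
  also have "\<dots> = BD a (\<lambda>u v. BD b (\<lambda>e x. BD x (\<lambda>f d. RS (\<lambda>r s. J (u * ad s e) * \<phi> (ad r v * f * sb d)))))"
    by (intro sw_cong BD_coassoc l)
  also have "\<dots> = BD a (\<lambda>u v. BD b (\<lambda>e x. RS (\<lambda>r s. BD x (\<lambda>f d. J (u * ad s e) * \<phi> (ad r v * (f * sb d))))))"
    by (subst (3) sw_swap) (simp add: mult.assoc)
  also have "\<dots> = BD a (\<lambda>u v. BD b (\<lambda>e x. RS (\<lambda>r s. eps x * (J (u * ad s e) * \<phi> (ad r v * 1)))))"
    by (intro sw_cong BD_sb_r[where \<phi> = "\<lambda>z. _ * \<phi> (_ * z)"] l)
  also have "\<dots> = BD a (\<lambda>u v. BD b (\<lambda>e x. RS (\<lambda>r s. J (u * ad s e) * \<phi> (ad r v)) * eps x))"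
    by (simp add: sw_cmult mult_ac)
  also have "\<dots> = BD a (\<lambda>c d. RS (\<lambda>r s. J (c * ad s b) * \<phi> (ad r d)))"
    by (intro sw_cong BD_counit_r l)
  finally show ?thesis .
qed

text \<open>This is \<open>J_sb\<close> at \<open>b = \<Lambda>\<close>: invariance of \<Lambda>
  reduces \<R> to its counit, and \<open>J (c * \<Lambda>)\<close> is \<open>eps c\<close>.\<close>

lemma J_Lam_snake:
  assumes f: "lf \<phi>"
  shows "BD \<Lambda> (\<lambda>c d. J (h * c) * \<phi> (sb d)) = \<phi> h"
proof -
  note l = lin_J lf_comp[OF f]
  have "BD \<Lambda> (\<lambda>c d. J (h * c) * \<phi> (sb d)) = BD h (\<lambda>c d. eps c * RS (\<lambda>r s. \<phi> (ad r d) * eps s))"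
    by (subst J_sb[OF f]) (simp add: ad_Lam Lam_l lfD[OF J_lf] sw_cmult mult_ac)
  also have "\<dots> = BD h (\<lambda>c d. eps c * \<phi> (ad 1 d))"
    by (subst R_eps2, intro l) simp
  also have "\<dots> = \<phi> (ad 1 h)" by (rule BD_counit_l) (intro l)
  finally show ?thesis by (simp add: ad_one)
qed

lemma sb_bij: "bij sb"
proof -
  \<comment> \<open>\<open>J_Lam_snake\<close> displays \<open>h\<close> as the image of an explicit
    element; injectivity follows by finite dimension.\<close>
  have "h = sb (BD \<Lambda> (\<lambda>c d. sc (J (h * c)) d))" for h
  proof (rule lf_separate)
    fix \<phi> assume f: "lf \<phi>"
    note g = lf_comp[OF f le_sb[OF le_id]]
    show "\<phi> h = \<phi> (sb (BD \<Lambda> (\<lambda>c d. sc (J (h * c)) d)))"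
      by (simp add: sw_lf[OF g] lfD[OF g] J_Lam_snake[OF f])
  qed
  then have "surj sb" by (metis surj_def)
  then show ?thesis using le_surj_inj[OF le_sb[OF le_id]] by (simp add: bij_def)
qed

text \<open>At \<open>sb h\<close> the previous snake identity reads \<open>sb N = sb h\<close>, and
  \<open>sb\<close> is injective.\<close>

lemma J_sb_Lam_snake:
  assumes f: "lf \<phi>"
  shows "BD \<Lambda> (\<lambda>c d. J (sb h * c) * \<phi> d) = \<phi> h"
proof -
  define N where "N = BD \<Lambda> (\<lambda>c d. sc (J (sb h * c)) d)"
  have N: "\<psi> N = BD \<Lambda> (\<lambda>c d. J (sb h * c) * \<psi> d)" if "lf \<psi>" for \<psi>
    by (simp add: N_def sw_lf that lfD)
  have "sb N = sb h"
    by (rule lf_separate) (simp add: N[OF lf_comp[OF _ le_sb[OF le_id]]] J_Lam_snake)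
  then have "N = h" using sb_bij by (simp add: bij_def inj_eq)
  then show ?thesis using N[OF f] by simp
qed

end

section \<open>Linear arrows\<close>

lemma linear_on_tsum_param:
  fixes F :: "'v::ab_group_add \<Rightarrow> 'w::ab_group_add \<Rightarrow> 'z::ab_group_add \<Rightarrow> 'u::ab_group_add"
  assumes U: "is_vspace U" and t: "t \<in> car (tprod V W)"
    and F: "\<And>v w. v \<in> car V \<Longrightarrow> w \<in> car W \<Longrightarrow> linear_on Z U (F v w)"
  shows "linear_on Z U (\<lambda>z. tsum V W t (\<lambda>v w. F v w z))"
proof (rule linear_onI)
  fix x assume x: "x \<in> car Z"
  show "tsum V W t (\<lambda>v w. F v w x) \<in> car U"
    by (rule tsum_closed[OF U t]) (simp add: linear_onD(1)[OF F x])
next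
  fix x y assume xy: "x \<in> car Z" "y \<in> car Z"
  have "tsum V W t (\<lambda>v w. F v w (x + y)) = tsum V W t (\<lambda>v w. F v w x + F v w y)"
    by (rule tsum_cong[OF t]) (simp add: linear_onD(2)[OF F xy])
  then show "tsum V W t (\<lambda>v w. F v w (x + y)) = tsum V W t (\<lambda>v w. F v w x) + tsum V W t (\<lambda>v w. F v w y)"
    by (simp only: tsum_plus)
next
  fix c x assume x: "x \<in> car Z"
  have "tsum V W t (\<lambda>v w. F v w (scl Z c x)) = tsum V W t (\<lambda>v w. scl U c (F v w x))"
    by (rule tsum_cong[OF t]) (simp add: linear_onD(3)[OF F x])
  also have "\<dots> = scl U c (tsum V W t (\<lambda>v w. F v w x))"
    by (rule tsum_additive[where F = "scl U c", symmetric]) (simp_all add: vspace_scl[OF U])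
  finally show "tsum V W t (\<lambda>v w. F v w (scl Z c x)) = scl U c (tsum V W t (\<lambda>v w. F v w x))" .
qed

text \<open>Modules and plain spaces are different records with the same carrier and scalars.
  Tensors depend on these two fields alone, which lets the Sweedler calculus over
  \<open>Hsp H\<close> be used for the module \<open>trm H\<close>.\<close>

lemma tens_cong:
  assumes "car V = car V'" "scl V = scl V'" "car W = car W'" "scl W = scl W'"
  shows "tens V W = tens V' W'"
  using assms by (simp add: tens_def bilinear_on_def linear_on_def fun_eq_iff)

lemma tsum_space_cong:
  assumes "car V = car V'" "scl V = scl V'" "car W = car W'" "scl W = scl W'"
  shows "tsum V W = tsum V' W'"
  by (intro ext) (simp add: tsum_def assms tens_cong[OF assms])

text \<open>Linear arrows, with the action left out. Equality of composites is decided at this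
  level; equivariance is then a matter of the structure maps themselves and never of associators or
  composites.\<close>

definition lar :: "('k::field, 'h, 'v::ab_group_add, 'w::ab_group_add) arrow \<Rightarrow> bool" where
  "lar f \<longleftrightarrow> is_vspace (dom f) \<and> is_vspace (cod f) \<and> app f \<in> extensional (car (dom f)) \<and>
    linear_on (dom f) (cod f) (app f)"

lemma arr_simps [simp]: "dom (arr V W \<phi>) = V" "cod (arr V W \<phi>) = W"
  "dom (ident V) = V" "cod (ident V) = V"
  "dom (g \<cdot> f) = dom f" "cod (g \<cdot> f) = cod g"
  by (simp_all add: arr_def ident_def compose_arr_def)

lemma app_arr [simp]: "x \<in> car V \<Longrightarrow> app (arr V W f) x = f x"
  by (simp add: arr_def)

lemma app_ident [simp]: "x \<in> car V \<Longrightarrow> app (ident V) x = x"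
  by (simp add: ident_def)

lemma app_comp [simp]: "x \<in> car (dom f) \<Longrightarrow> app (g \<cdot> f) x = app g (app f x)"
  by (simp add: compose_arr_def)

lemma lar_arr: "is_vspace V \<Longrightarrow> is_vspace W \<Longrightarrow> linear_on V W f \<Longrightarrow> lar (arr V W f)"
  by (simp add: lar_def arr_def) (simp add: linear_on_def vspace_closed)

lemma lar_ident [intro, simp]: "is_vspace V \<Longrightarrow> lar (ident V)"
  unfolding ident_def by (rule lar_arr) (auto simp: linear_on_def)

lemma lar_comp [intro, simp]: "lar f \<Longrightarrow> lar g \<Longrightarrow> dom g = cod f \<Longrightarrow> lar (g \<cdot> f)"
  unfolding compose_arr_def by (rule lar_arr) (auto simp: lar_def linear_on_def)

lemma arrow_eqI:
  assumes "lar f" "lar g" "dom f = dom g" "cod f = cod g" "\<And>x. x \<in> car (dom g) \<Longrightarrow> app f x = app g x"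
  shows "f = g"
proof -
  have "app f = app g"
    by (rule extensionalityI[of _ "car (dom g)"]) (use assms in \<open>simp_all add: lar_def\<close>)
  then show ?thesis using assms(3,4) by simp
qed

context quasitriangular_hopf
begin

section \<open>Tensor products and coherence maps on elements\<close>

abbreviation mtens :: "('k, 'v::ab_group_add, 'h) hmod \<Rightarrow> ('k, 'w::ab_group_add, 'h) hmod
    \<Rightarrow> ('k, ('v, 'w, 'k) tensor, 'h) hmod" (infixr "\<boxtimes>" 75)
  where "V \<boxtimes> W \<equiv> mod_tensor H V W"

abbreviation atens :: "('k, 'h, 'v::ab_group_add, 'v'::ab_group_add) arrow
    \<Rightarrow> ('k, 'h, 'w::ab_group_add, 'w'::ab_group_add) arrow
    \<Rightarrow> ('k, 'h, ('v, 'w, 'k) tensor, ('v', 'w', 'k) tensor) arrow" (infixr "\<otimes>" 75)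
  where "f \<otimes> g \<equiv> arr_tensor H f g"

abbreviation B :: "('k, 'h, 'h) hmod" where "B \<equiv> trm H"
abbreviation K :: "('k, 'k, 'h) hmod" where "K \<equiv> kmod H"

lemma B_simps [simp]: "car B = UNIV" "scl B = sc" "act B = ad"
  by (simp_all add: trm_def ad_def)

lemma K_simps [simp]: "car K = UNIV" "scl K = (*)" "act K h c = eps h * c"
  by (simp_all add: kmod_def)

lemma car_mod [simp]: "car (V \<boxtimes> W) = car (tprod V W)"
  and scl_mod [simp]: "scl (V \<boxtimes> W) = (\<lambda>c t \<beta>. c * t \<beta>)"
  by (simp_all add: mod_tensor_def)

lemma act_mod: "act (V \<boxtimes> W) h t = D h (\<lambda>a b. tsum V W t (\<lambda>v w. tens V W (act V a v) (act W b w)))"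
  by (simp add: mod_tensor_def)

lemma vspace_mod [simp]: "is_vspace V \<Longrightarrow> is_vspace (V \<boxtimes> W)"
  using is_vspace_tprod[of V W] by (simp add: is_vspace_def)

lemma vspace_B [simp]: "is_vspace B" using is_vspace_Hsp by (simp add: is_vspace_def)
lemma vspace_K [simp]: "is_vspace K" using is_vspace_kspace by (simp add: is_vspace_def)

lemma linear_on_mod: "linear_on (V \<boxtimes> W) U f = linear_on (tprod V W) U f"
  "linear_on U (V \<boxtimes> W) g = linear_on U (tprod V W) g"
  by (simp_all add: linear_on_def)

lemma linear_on_BK: "linear_on B = linear_on (Hsp H)" "linear_on V B = linear_on V (Hsp H)"
  "linear_on V K = linear_on V kspace"
  by (simp_all add: linear_on_def fun_eq_iff)

lemma tens_B: "tens B B = tens2 H" and tsum_B: "tsum B B = sw H"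
  unfolding tens2_def sw_def by (rule tens_cong tsum_space_cong; simp)+

lemma car_BB [simp]: "car (tprod B B) = car HH"
proof -
  have "tens B B = tens (Hsp H) (Hsp H)" by (rule tens_cong) simp_all
  then show ?thesis by (simp add: tprod_def)
qed

lemma bilinear_tens_mod: "bilinear_on V W (V \<boxtimes> W) (tens V W)"
  using bilinear_tens[of V W] by (simp add: bilinear_on_def linear_on_mod)

lemma linear_tens: "w \<in> car W \<Longrightarrow> linear_on V (V \<boxtimes> W) (\<lambda>v. tens V W v w)"
  "v \<in> car V \<Longrightarrow> linear_on W (V \<boxtimes> W) (tens V W v)"
  using bilinear_tens_mod[of V W] by (auto simp: bilinear_on_def)

lemma dom_tensor [simp]: "dom (f \<otimes> g) = dom f \<boxtimes> dom g" "cod (f \<otimes> g) = cod f \<boxtimes> cod g"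
  by (simp_all add: arr_tensor_def)

lemma bilinear_tensor:
  assumes "lar f" "lar g"
  shows "bilinear_on (dom f) (dom g) (cod f \<boxtimes> cod g) (\<lambda>v w. tens (cod f) (cod g) (app f v) (app g w))"
  by (rule bilinear_on_pre[OF bilinear_tens_mod]) (use assms in \<open>auto simp: lar_def\<close>)

lemma lar_tensor [intro, simp]:
  assumes "lar f" "lar g"
  shows "lar (f \<otimes> g)"
  unfolding arr_tensor_def
proof (rule lar_arr)
  show "linear_on (dom f \<boxtimes> dom g) (cod f \<boxtimes> cod g)
      (\<lambda>t. tsum (dom f) (dom g) t (\<lambda>v w. tens (cod f) (cod g) (app f v) (app g w)))"
    unfolding linear_on_mod(1)
    by (rule linear_on_tsum) (use assms bilinear_tensor in \<open>auto simp: lar_def\<close>)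
qed (use assms in \<open>auto simp: lar_def\<close>)

lemma app_tensor:
  "t \<in> car (tprod (dom f) (dom g)) \<Longrightarrow>
    app (f \<otimes> g) t = tsum (dom f) (dom g) t (\<lambda>v w. tens (cod f) (cod g) (app f v) (app g w))"
  by (simp add: arr_tensor_def)

lemma app_tensor_pure:
  assumes "lar f" "lar g" "dom f = V" "dom g = W" "v \<in> car V" "w \<in> car W"
  shows "app (f \<otimes> g) (tens V W v w) = tens (cod f) (cod g) (app f v) (app g w)"
proof -
  have "app (f \<otimes> g) (tens V W v w) =
      tsum (dom f) (dom g) (tens (dom f) (dom g) v w) (\<lambda>v w. tens (cod f) (cod g) (app f v) (app g w))"
    using assms(3-6) by (simp add: app_tensor tens_in_tprod)
  also have "\<dots> = tens (cod f) (cod g) (app f v) (app g w)"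
    by (rule tsum_pure[OF _ bilinear_tensor]) (use assms in \<open>auto simp: lar_def\<close>)
  finally show ?thesis .
qed

lemma app_push:
  assumes "lar F" "t \<in> car (tprod V W)" "\<And>v w. v \<in> car V \<Longrightarrow> w \<in> car W \<Longrightarrow> \<beta> v w \<in> car (dom F)"
  shows "app F (tsum V W t \<beta>) = tsum V W t (\<lambda>v w. app F (\<beta> v w))"
  by (rule tsum_linear_image[of "dom F" "cod F"]) (use assms in \<open>auto simp: lar_def\<close>)

lemma dom_structural [simp]:
  "dom (assoc H U V W) = (U \<boxtimes> V) \<boxtimes> W" "cod (assoc H U V W) = U \<boxtimes> (V \<boxtimes> W)"
  "dom (assoc_inv H U V W) = U \<boxtimes> (V \<boxtimes> W)" "cod (assoc_inv H U V W) = (U \<boxtimes> V) \<boxtimes> W"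
  "dom (lunit H V) = K \<boxtimes> V" "cod (lunit H V) = V"
  "dom (lunit_inv H V) = V" "cod (lunit_inv H V) = K \<boxtimes> V"
  "dom (runit H V) = V \<boxtimes> K" "cod (runit H V) = V"
  "dom (runit_inv H V) = V" "cod (runit_inv H V) = V \<boxtimes> K"
  "dom (braid H V W) = V \<boxtimes> W" "cod (braid H V W) = W \<boxtimes> V"
  by (simp_all add: assoc_def assoc_inv_def lunit_def lunit_inv_def runit_def runit_inv_def braid_def)

lemma bilinear_assoc:
  assumes "is_vspace U" "is_vspace V" "is_vspace W"
  shows "bilinear_on (U \<boxtimes> V) W (U \<boxtimes> (V \<boxtimes> W))
    (\<lambda>s w. tsum U V s (\<lambda>u v. tens U (V \<boxtimes> W) u (tens V W v w)))"
  unfolding bilinear_on_def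
proof (intro conjI ballI)
  fix s assume "s \<in> car (U \<boxtimes> V)"
  then show "linear_on W (U \<boxtimes> V \<boxtimes> W) (\<lambda>w. tsum U V s (\<lambda>u v. tens U (V \<boxtimes> W) u (tens V W v w)))"
    by (intro linear_on_tsum_param linear_on_comp[OF linear_tens(2) linear_tens(2)])
      (use assms in auto)
next
  fix w assume "w \<in> car W"
  then show "linear_on (U \<boxtimes> V) (U \<boxtimes> V \<boxtimes> W) (\<lambda>s. tsum U V s (\<lambda>u v. tens U (V \<boxtimes> W) u (tens V W v w)))"
    unfolding linear_on_mod(1)
    by (intro linear_on_tsum bilinear_on_pre[OF bilinear_tens_mod] linear_tens)
      (use assms in \<open>auto simp: linear_on_def\<close>)
qed

lemma lar_assoc [simp]: "is_vspace U \<Longrightarrow> is_vspace V \<Longrightarrow> is_vspace W \<Longrightarrow> lar (assoc H U V W)"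
  unfolding assoc_def
  by (rule lar_arr, simp, simp, unfold linear_on_mod(1), rule linear_on_tsum[OF _ _ bilinear_assoc]) simp_all

lemma app_assoc:
  assumes "is_vspace U" "is_vspace V" "is_vspace W" "s \<in> car (tprod U V)" "w \<in> car W"
  shows "app (assoc H U V W) (tens (U \<boxtimes> V) W s w) = tsum U V s (\<lambda>u v. tens U (V \<boxtimes> W) u (tens V W v w))"
  unfolding assoc_def using assms
  by (simp add: tens_in_tprod) (subst tsum_pure[OF _ bilinear_assoc]; simp)

lemma bilinear_assoc_inv:
  assumes "is_vspace U" "is_vspace V" "is_vspace W"
  shows "bilinear_on U (V \<boxtimes> W) ((U \<boxtimes> V) \<boxtimes> W)
    (\<lambda>u s. tsum V W s (\<lambda>v w. tens (U \<boxtimes> V) W (tens U V u v) w))"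
  unfolding bilinear_on_def
proof (intro conjI ballI)
  fix s assume "s \<in> car (V \<boxtimes> W)"
  then show "linear_on U ((U \<boxtimes> V) \<boxtimes> W) (\<lambda>u. tsum V W s (\<lambda>v w. tens (U \<boxtimes> V) W (tens U V u v) w))"
    by (intro linear_on_tsum_param linear_on_comp[OF linear_tens(1) linear_tens(1)])
      (use assms in auto)
next
  fix u assume "u \<in> car U"
  then show "linear_on (V \<boxtimes> W) ((U \<boxtimes> V) \<boxtimes> W) (\<lambda>s. tsum V W s (\<lambda>v w. tens (U \<boxtimes> V) W (tens U V u v) w))"
    unfolding linear_on_mod(1)
    by (intro linear_on_tsum bilinear_on_pre[OF bilinear_tens_mod] linear_tens)
      (use assms in \<open>auto simp: linear_on_def\<close>)
qed

lemma lar_assoc_inv [simp]: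
  "is_vspace U \<Longrightarrow> is_vspace V \<Longrightarrow> is_vspace W \<Longrightarrow> lar (assoc_inv H U V W)"
  unfolding assoc_inv_def
  by (rule lar_arr, simp, simp, unfold linear_on_mod(1), rule linear_on_tsum[OF _ _ bilinear_assoc_inv]) simp_all

lemma app_assoc_inv:
  assumes "is_vspace U" "is_vspace V" "is_vspace W" "u \<in> car U" "s \<in> car (tprod V W)"
  shows "app (assoc_inv H U V W) (tens U (V \<boxtimes> W) u s) = tsum V W s (\<lambda>v w. tens (U \<boxtimes> V) W (tens U V u v) w)"
  unfolding assoc_inv_def using assms
  by (simp add: tens_in_tprod) (subst tsum_pure[OF _ bilinear_assoc_inv]; simp)

lemma bilinear_units:
  assumes "is_vspace V"
  shows "bilinear_on K V V (scl V)" "bilinear_on V K V (\<lambda>v c. scl V c v)"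
  by (rule bilinear_onI;
      use assms in \<open>simp add: vspace_scl vspace_closed mult.commute\<close>)+

lemma lar_units [simp]:
  assumes V: "is_vspace V"
  shows "lar (lunit H V)" "lar (runit H V)" "lar (lunit_inv H V)" "lar (runit_inv H V)"
proof -
  show "lar (lunit H V)" "lar (runit H V)"
    unfolding lunit_def runit_def
    by (rule lar_arr, simp_all add: V linear_on_mod(1), rule linear_on_tsum[OF _ V];
        simp add: bilinear_units[OF V] V)+
  show "lar (lunit_inv H V)" "lar (runit_inv H V)"
    unfolding lunit_inv_def runit_inv_def
    by (rule lar_arr[OF V]; simp add: V linear_tens)+
qed

lemma app_units:
  assumes "is_vspace V" "v \<in> car V"
  shows "app (lunit H V) (tens K V c v) = scl V c v" "app (runit H V) (tens V K v c) = scl V c v"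
    "app (lunit_inv H V) v = tens K V 1 v" "app (runit_inv H V) v = tens V K v 1"
  using assms unfolding lunit_def runit_def lunit_inv_def runit_inv_def
  by (simp_all add: tens_in_tprod tsum_pure bilinear_units)

lemma bilinear_braid:
  "bilinear_on B B (B \<boxtimes> B) (\<lambda>v w. RS (\<lambda>r s. tens B B (ad s w) (ad r v)))"
proof -
  have l: "linear_on B B (ad h)" for h
    unfolding linear_on_BK using le_ad2[OF le_id] by (simp add: le_def)
  show ?thesis
    unfolding bilinear_on_def sw_def
    by (auto intro!: linear_on_tsum_param rmat_in linear_on_comp[OF l linear_tens(1)]
        linear_on_comp[OF l linear_tens(2)])
qed

lemma lar_braid [simp]: "lar (braid H B B)"
  unfolding braid_def
  by (rule lar_arr, simp, simp, unfold linear_on_mod(1), rule linear_on_tsum)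
    (simp_all add: bilinear_braid)

lemma app_braid: "app (braid H B B) (tens B B a b) = RS (\<lambda>r s. tens B B (ad s b) (ad r a))"
  unfolding braid_def
  by (simp add: tens_in_tprod[of _ B _ B, simplified]) (subst tsum_pure[OF _ bilinear_braid]; simp)

lemma lar_linear:
  assumes "lar f" "dom f = V" "cod f = U"
  shows "linear_on V U (app f)" "is_vspace U"
  using assms by (simp_all add: lar_def)

lemma arrow_eq_tensor:
  assumes f: "lar f" "dom f = V \<boxtimes> W" "cod f = U" and g: "lar g" "dom g = V \<boxtimes> W" "cod g = U"
    and V: "is_vspace V"
    and eq: "\<And>v w. v \<in> car V \<Longrightarrow> w \<in> car W \<Longrightarrow> app f (tens V W v w) = app g (tens V W v w)"
  shows "f = g"
proof (rule arrow_eqI[OF f(1) g(1)])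
  fix x assume "x \<in> car (dom g)"
  then have x: "x \<in> car (tprod V W)" by (simp add: g)
  show "app f x = app g x"
    by (rule linear_on_tprod_eq[OF V lar_linear(2)[OF f] _ _ _ x])
      (simp_all add: lar_linear(1)[OF f, unfolded linear_on_mod] lar_linear(1)[OF g, unfolded linear_on_mod] eq)
qed (simp_all add: f g)

lemma arrow_eq_tensor3:
  assumes f: "lar f" "dom f = (U \<boxtimes> V) \<boxtimes> W" "cod f = Z" and g: "lar g" "dom g = (U \<boxtimes> V) \<boxtimes> W" "cod g = Z"
    and U: "is_vspace U"
    and eq: "\<And>u v w. u \<in> car U \<Longrightarrow> v \<in> car V \<Longrightarrow> w \<in> car W \<Longrightarrow>
      app f (tens (U \<boxtimes> V) W (tens U V u v) w) = app g (tens (U \<boxtimes> V) W (tens U V u v) w)"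
  shows "f = g"
proof (rule arrow_eq_tensor[OF f g])
  show "is_vspace (U \<boxtimes> V)" by (simp add: U)
  fix s w assume s: "s \<in> car (U \<boxtimes> V)" and w': "w \<in> car W"
  have l: "linear_on (tprod U V) Z (\<lambda>s. app k (tens (U \<boxtimes> V) W s w))"
    if "lar k" "dom k = (U \<boxtimes> V) \<boxtimes> W" "cod k = Z" for k
    using linear_on_comp[OF linear_tens(1)[OF w', of "U \<boxtimes> V"] lar_linear(1)[OF that]]
    by (simp only: linear_on_mod)
  show "app f (tens (U \<boxtimes> V) W s w) = app g (tens (U \<boxtimes> V) W s w)"
    by (rule linear_on_tprod_eq[OF U lar_linear(2)[OF f] l[OF f] l[OF g]])
      (use eq w' s in simp_all)
qed

lemma arrow_eq_K:
  assumes f: "lar f" "dom f = K" "cod f = V" and g: "lar g" "dom g = K" "cod g = V"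
    and eq: "app f 1 = app g 1"
  shows "f = g"
proof (rule arrow_eqI[OF f(1) g(1)])
  show "app f x = app g x" for x
    using linear_onD(3)[OF lar_linear(1)[OF f], of 1 x] linear_onD(3)[OF lar_linear(1)[OF g], of 1 x] eq
    by simp
qed (simp_all add: f g)

section \<open>Module structures on the objects in use\<close>

lemma module_B [simp]: "is_module H B"
  unfolding is_module_def bilinear_on_def linear_on_BK le_def[symmetric]
  by (auto simp: ad_one ad_mult intro: le_ad1 le_ad2 le_id)

lemma module_K [simp]: "is_module H K"
proof -
  have "lf (\<lambda>v. eps v * c)" for c by (intro lin)
  moreover have "linear_on K K (act K h)" for h
    by (rule linear_onI) (simp_all add: distrib_left mult.left_commute)
  ultimately show ?thesis
    unfolding is_module_def bilinear_on_def by (auto simp: linear_on_BK lf_def)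
qed

lemma homI:
  assumes "lar f" "dom f = V" "cod f = W" "is_module H V" "is_module H W"
    "\<And>h v. v \<in> car V \<Longrightarrow> app f (act V h v) = act W h (app f v)"
  shows "f \<in> hom H V W"
  using assms by (auto simp: hom_def lar_def)

lemma act_BB_in: "act (B \<boxtimes> B) h t \<in> car HH" if "t \<in> car HH"
  unfolding act_mod tsum_B tens_B using that by (intro sw_in comult_in tens2_in)

lemma act_BB:
  assumes "t \<in> car HH" "bil \<beta>"
  shows "sw H (act (B \<boxtimes> B) h t) \<beta> = D h (\<lambda>a b. sw H t (\<lambda>v w. \<beta> (ad a v) (ad b w)))"
  unfolding act_mod tsum_B tens_B
  by (simp add: sw_sw comult_in assms sw_in tens2_in sw_tens2)

lemma sw_linear:
  assumes b: "bil \<beta>"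
  shows "linear_on HH kspace (\<lambda>t. sw H t \<beta>)"
  unfolding sw_def by (rule linear_on_tsum) (use b in \<open>simp_all add: bil_bilinear[symmetric]\<close>)

text \<open>Membership in \<open>hom\<close> includes that source and target are modules; products,
  coproducts, pairings and copairings all have this object at one end. The laws of the action follow
  from multiplicativity of the coproduct, tested on bilinear forms.\<close>

lemma module_BB [simp]: "is_module H (B \<boxtimes> B)"
  unfolding is_module_def
proof (intro conjI ballI allI)
  show "is_vspace (B \<boxtimes> B)" by simp
  have l1: "linear_on (Hsp H) B (\<lambda>a. ad a v)" and l2: "linear_on B B (ad a)" for a v
    using le_ad1[OF le_id] le_ad2[OF le_id] by (simp_all add: linear_on_BK le_def)
  have c: "linear_on (Hsp H) HH (comult H)" using hopf by (simp add: is_hopf_algebra_def)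
  let ?a = "\<lambda>t a b. tsum B B t (\<lambda>v w. tens B B (ad a v) (ad b w))"
  have act: "act (B \<boxtimes> B) h t = tsum (Hsp H) (Hsp H) (comult H h) (?a t)" for h t
    by (simp add: act_mod sw_def)
  show "bilinear_on (Hsp H) (B \<boxtimes> B) (B \<boxtimes> B) (act (B \<boxtimes> B))"
    unfolding bilinear_on_def
  proof (intro conjI ballI)
    fix h
    have "linear_on (B \<boxtimes> B) (B \<boxtimes> B) (\<lambda>t. ?a t a b)" for a b
      unfolding linear_on_mod(1)
      by (rule linear_on_tsum) (simp_all add: bilinear_on_pre[OF bilinear_tens_mod l2 l2])
    then have "linear_on (B \<boxtimes> B) (B \<boxtimes> B) (\<lambda>t. tsum (Hsp H) (Hsp H) (comult H h) (?a t))"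
      by (intro linear_on_tsum_param comult_in) simp_all
    then show "linear_on (B \<boxtimes> B) (B \<boxtimes> B) (act (B \<boxtimes> B) h)" by (simp add: act[abs_def])
  next
    fix t assume t: "t \<in> car (B \<boxtimes> B)"
    have "bilinear_on (Hsp H) (Hsp H) (B \<boxtimes> B) (?a t)"
      unfolding bilinear_on_def
      by (intro conjI ballI linear_on_tsum_param linear_on_comp[OF l1 linear_tens(1)] linear_on_comp[OF l1 linear_tens(2)])
        (use t in simp_all)
    then have "linear_on (Hsp H) (B \<boxtimes> B) (\<lambda>h. tsum (Hsp H) (Hsp H) (comult H h) (?a t))"
      by (intro linear_on_comp[OF c] linear_on_tsum) simp_all
    then show "linear_on (Hsp H) (B \<boxtimes> B) (\<lambda>h. act (B \<boxtimes> B) h t)" by (simp add: act)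
  qed
  fix t assume "t \<in> car (B \<boxtimes> B)"
  then have t: "t \<in> car HH" by simp
  show "act (B \<boxtimes> B) 1 t = t"
  proof (rule HH_eqI)
    fix \<beta> assume b: "bil \<beta>"
    note l = lin_ad bil_lin[OF b]
    show "sw H (act (B \<boxtimes> B) 1 t) \<beta> = sw H t \<beta>"
      by (subst act_BB[OF t b], subst D_one, intro l) (simp add: ad_one)
  qed (simp_all add: act_BB_in t)
  fix g h
  show "act (B \<boxtimes> B) (g * h) t = act (B \<boxtimes> B) g (act (B \<boxtimes> B) h t)"
  proof (rule HH_eqI)
    fix \<beta> assume b: "bil \<beta>"
    note l = lin_ad bil_lin[OF b]
    have "sw H (act (B \<boxtimes> B) (g * h) t) \<beta> = D g (\<lambda>a b. D h (\<lambda>c d. sw H t (\<lambda>v w. \<beta> (ad a (ad c v)) (ad b (ad d w)))))"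
      by (subst act_BB[OF t b], subst D_mult, intro l) (simp add: ad_mult)
    also have "\<dots> = sw H (act (B \<boxtimes> B) g (act (B \<boxtimes> B) h t)) \<beta>"
      by (subst act_BB[OF act_BB_in[OF t] b], subst act_BB[OF t], intro l) simp
    finally show "sw H (act (B \<boxtimes> B) (g * h) t) \<beta> = sw H (act (B \<boxtimes> B) g (act (B \<boxtimes> B) h t)) \<beta>" .
  qed (simp_all add: act_BB_in t)
qed

end

section \<open>Structure maps on the transmuted algebra\<close>

context quasitriangular_hopf
begin

text \<open>Together with \<open>elem_arr\<close> these shapes cover all structure maps in question.
  The predicates ending in \<open>_mor\<close> express by scalar forms what makes such an arrow a
  morphism, so that each categorical equation is reduced once to an equation about functions on
  \<open>H\<close>.\<close>

definition mulA :: "('h \<Rightarrow> 'h \<Rightarrow> 'h) \<Rightarrow> ('k, 'h, ('h, 'h, 'k) tensor, 'h) arrow" where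
  "mulA f = arr (B \<boxtimes> B) B (\<lambda>t. sw H t f)"
definition comA :: "('h \<Rightarrow> ('h, 'h, 'k) tensor) \<Rightarrow> ('k, 'h, 'h, ('h, 'h, 'k) tensor) arrow" where
  "comA d = arr B (B \<boxtimes> B) d"
definition formA :: "('h \<Rightarrow> 'h \<Rightarrow> 'k) \<Rightarrow> ('k, 'h, ('h, 'h, 'k) tensor, 'k) arrow" where
  "formA \<beta> = arr (B \<boxtimes> B) K (\<lambda>t. sw H t \<beta>)"
definition capA :: "('h, 'h, 'k) tensor \<Rightarrow> ('k, 'h, 'k, ('h, 'h, 'k) tensor) arrow" where
  "capA g = arr K (B \<boxtimes> B) (\<lambda>c \<beta>. c * g \<beta>)"
definition funA :: "('h \<Rightarrow> 'k) \<Rightarrow> ('k, 'h, 'h, 'k) arrow" where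
  "funA \<phi> = arr B K \<phi>"
definition endA :: "('h \<Rightarrow> 'h) \<Rightarrow> ('k, 'h, 'h, 'h) arrow" where
  "endA f = arr B B f"

definition mul_mor :: "('h \<Rightarrow> 'h \<Rightarrow> 'h) \<Rightarrow> bool" where
  "mul_mor f \<longleftrightarrow> (\<forall>y. le (\<lambda>x. f x y)) \<and> (\<forall>x. le (\<lambda>y. f x y)) \<and>
     (\<forall>\<phi> h a b. lf \<phi> \<longrightarrow> \<phi> (ad h (f a b)) = D h (\<lambda>p q. \<phi> (f (ad p a) (ad q b))))"
definition com_mor :: "('h \<Rightarrow> ('h, 'h, 'k) tensor) \<Rightarrow> bool" where
  "com_mor d \<longleftrightarrow> linear_on (Hsp H) HH d \<and>
     (\<forall>\<beta> h x. bil \<beta> \<longrightarrow> sw H (d (ad h x)) \<beta> = D h (\<lambda>p q. sw H (d x) (\<lambda>a b. \<beta> (ad p a) (ad q b))))"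
definition form_mor :: "('h \<Rightarrow> 'h \<Rightarrow> 'k) \<Rightarrow> bool" where
  "form_mor \<beta> \<longleftrightarrow> bil \<beta> \<and> (\<forall>h a b. D h (\<lambda>p q. \<beta> (ad p a) (ad q b)) = eps h * \<beta> a b)"
definition cap_mor :: "('h, 'h, 'k) tensor \<Rightarrow> bool" where
  "cap_mor g \<longleftrightarrow> g \<in> car HH \<and>
     (\<forall>\<beta> h. bil \<beta> \<longrightarrow> D h (\<lambda>p q. sw H g (\<lambda>a b. \<beta> (ad p a) (ad q b))) = eps h * sw H g \<beta>)"
definition fun_mor :: "('h \<Rightarrow> 'k) \<Rightarrow> bool" where
  "fun_mor \<phi> \<longleftrightarrow> lf \<phi> \<and> (\<forall>h x. \<phi> (ad h x) = eps h * \<phi> x)"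
definition end_mor :: "('h \<Rightarrow> 'h) \<Rightarrow> bool" where
  "end_mor f \<longleftrightarrow> le f \<and> (\<forall>h x. f (ad h x) = ad h (f x))"
definition el_mor :: "'h \<Rightarrow> bool" where
  "el_mor u \<longleftrightarrow> (\<forall>h. ad h u = sc (eps h) u)"

lemma dom_normal [simp]:
  "dom (mulA f) = B \<boxtimes> B" "cod (mulA f) = B" "dom (comA d) = B" "cod (comA d) = B \<boxtimes> B"
  "dom (formA \<beta>) = B \<boxtimes> B" "cod (formA \<beta>) = K" "dom (capA g) = K" "cod (capA g) = B \<boxtimes> B"
  "dom (funA \<phi>) = B" "cod (funA \<phi>) = K" "dom (endA s) = B" "cod (endA s) = B"
  "dom (elem_arr H u) = K" "cod (elem_arr H u) = B"
  by (simp_all add: mulA_def comA_def formA_def capA_def funA_def endA_def elem_arr_def)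

lemma mul_mor_lin: "mul_mor f \<Longrightarrow> le g \<Longrightarrow> le (\<lambda>x. f (g x) c)" "mul_mor f \<Longrightarrow> le g \<Longrightarrow> le (\<lambda>x. f c (g x))"
  using le_comp[of "\<lambda>x. f x c" g] le_comp[of "f c" g] by (auto simp: mul_mor_def)

lemma com_morD:
  assumes "com_mor d"
  shows "d x \<in> car HH" "bil \<beta> \<Longrightarrow> le f \<Longrightarrow> lf (\<lambda>x. sw H (d (f x)) \<beta>)"
proof -
  have d: "linear_on (Hsp H) HH d" using assms by (simp add: com_mor_def)
  show "d x \<in> car HH" using linear_onD(1)[OF d] by simp
  show "lf (\<lambda>x. sw H (d (f x)) \<beta>)" if "bil \<beta>" "le f"
    using lf_comp[OF linear_on_comp[OF d sw_linear, folded lf_def] that(2)] that(1) by simp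
qed

lemma tens_BB_in [simp]: "tens B B a b \<in> car HH" by (simp add: tens_B tens2_in)

lemma tens_in_mod [simp]: "v \<in> car V \<Longrightarrow> w \<in> car W \<Longrightarrow> tens V W v w \<in> car (tprod V W)"
  by (rule tens_in_tprod)

lemma sw_tens_BB: "t \<in> car HH \<Longrightarrow> sw H t (tens B B) = t"
  by (simp add: tens_B sw_tensor)

lemma lar_normal [simp]:
  "mul_mor f \<Longrightarrow> lar (mulA f)" "com_mor d \<Longrightarrow> lar (comA d)" "form_mor \<beta> \<Longrightarrow> lar (formA \<beta>)"
  "cap_mor g \<Longrightarrow> lar (capA g)" "fun_mor \<phi> \<Longrightarrow> lar (funA \<phi>)" "end_mor s \<Longrightarrow> lar (endA s)"
  "lar (elem_arr H u)"
proof -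
  show "lar (mulA f)" if "mul_mor f"
    unfolding mulA_def
  proof (rule lar_arr)
    have "linear_on HH (Hsp H) (\<lambda>t. sw H t f)"
      unfolding sw_def by (rule linear_on_tsum)
        (use that in \<open>simp_all add: bilinear_on_def mul_mor_def le_def\<close>)
    then show "linear_on (B \<boxtimes> B) B (\<lambda>t. sw H t f)" by (simp add: linear_on_def)
  qed simp_all
  show "lar (comA d)" if "com_mor d"
    unfolding comA_def by (rule lar_arr) (use that in \<open>simp_all add: com_mor_def linear_on_def\<close>)
  show "lar (formA \<beta>)" if "form_mor \<beta>"
    unfolding formA_def
    by (rule lar_arr) (use that sw_linear[of \<beta>] in \<open>simp_all add: form_mor_def linear_on_def\<close>)
  show "lar (capA g)" if "cap_mor g"
    unfolding capA_def
  proof (rule lar_arr)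
    show "linear_on K (B \<boxtimes> B) (\<lambda>c \<beta>. c * g \<beta>)"
      using that vspace_closed(3)[OF is_vspace_tprod[OF is_vspace_Hsp, of "Hsp H"], of g]
      by (simp add: linear_on_def cap_mor_def fun_eq_iff algebra_simps)
  qed simp_all
  show "lar (funA \<phi>)" if "fun_mor \<phi>"
    unfolding funA_def by (rule lar_arr) (use that in \<open>simp_all add: fun_mor_def lf_iff linear_on_def\<close>)
  show "lar (endA s)" if "end_mor s"
    unfolding endA_def by (rule lar_arr) (use that in \<open>simp_all add: end_mor_def le_iff linear_on_def\<close>)
  show "lar (elem_arr H u)"
    unfolding elem_arr_def by (rule lar_arr) (simp_all add: linear_on_def scale_left_distrib)
qed

lemma app_normal [simp]:
  "t \<in> car HH \<Longrightarrow> app (mulA f) t = sw H t f" "app (comA d) x = d x"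
  "t \<in> car HH \<Longrightarrow> app (formA \<beta>) t = sw H t \<beta>" "app (capA g) 1 = g"
  "app (funA \<phi>) x = \<phi> x" "app (endA s) x = s x" "app (elem_arr H u) c = sc c u"
  by (simp_all add: mulA_def comA_def formA_def capA_def funA_def endA_def elem_arr_def)

lemma sw_mul: "mul_mor f \<Longrightarrow> sw H (tens B B a b) f = f a b"
proof (rule lf_separate)
  fix \<phi> assume f: "mul_mor f" and p: "lf \<phi>"
  have "bil (\<lambda>a b. \<phi> (f a b))" by (intro lin lf_comp[OF p] mul_mor_lin[OF f])
  then show "\<phi> (sw H (tens B B a b) f) = \<phi> (f a b)" by (simp add: sw_lf p tens_B sw_tens2)
qed

lemma sw_form: "form_mor \<beta> \<Longrightarrow> sw H (tens B B a b) \<beta> = \<beta> a b"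
  by (simp add: form_mor_def tens_B sw_tens2)

lemma mulA_hom: "mul_mor f \<Longrightarrow> mulA f \<in> hom H (B \<boxtimes> B) B"
proof (rule homI)
  assume f: "mul_mor f"
  show "lar (mulA f)" using f by simp
  fix h t assume "t \<in> car (B \<boxtimes> B)"
  then have t: "t \<in> car HH" by simp
  show "app (mulA f) (act (B \<boxtimes> B) h t) = act B h (app (mulA f) t)"
  proof (rule lf_separate)
    fix \<phi> assume p: "lf \<phi>"
    note l = lin_ad lf_comp[OF p] mul_mor_lin[OF f]
    have "sw H (act (B \<boxtimes> B) h t) (\<lambda>a b. \<phi> (f a b)) = D h (\<lambda>a b. sw H t (\<lambda>v w. \<phi> (f (ad a v) (ad b w))))"
      by (rule act_BB[OF t]) (intro l)
    also have "\<dots> = sw H t (\<lambda>v w. D h (\<lambda>a b. \<phi> (f (ad a v) (ad b w))))" by (rule sw_swap)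
    also have "\<dots> = sw H t (\<lambda>v w. \<phi> (ad h (f v w)))"
      using f p by (simp add: mul_mor_def)
    also have "\<dots> = \<phi> (ad h (sw H t f))"
      by (rule sw_lf[symmetric]) (intro l)
    finally show "\<phi> (app (mulA f) (act (B \<boxtimes> B) h t)) = \<phi> (act B h (app (mulA f) t))"
      using t by (simp add: act_BB_in sw_lf[OF p])
  qed
qed simp_all

lemma comA_hom: "com_mor d \<Longrightarrow> comA d \<in> hom H B (B \<boxtimes> B)"
proof (rule homI)
  assume d: "com_mor d"
  show "lar (comA d)" using d by simp
  fix h x
  show "app (comA d) (act B h x) = act (B \<boxtimes> B) h (app (comA d) x)"
    by (rule HH_eqI) (use d in \<open>simp_all add: com_morD[OF d] act_BB_in act_BB, simp add: com_mor_def\<close>)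
qed simp_all

lemma formA_hom: "form_mor \<beta> \<Longrightarrow> formA \<beta> \<in> hom H (B \<boxtimes> B) K"
proof (rule homI)
  assume b: "form_mor \<beta>"
  show "lar (formA \<beta>)" using b by simp
  fix h t assume "t \<in> car (B \<boxtimes> B)"
  then have t: "t \<in> car HH" by simp
  have "sw H (act (B \<boxtimes> B) h t) \<beta> = sw H t (\<lambda>v w. D h (\<lambda>a b. \<beta> (ad a v) (ad b w)))"
    using b by (subst sw_swap) (simp add: act_BB t form_mor_def)
  also have "\<dots> = eps h * sw H t \<beta>"
    using b by (simp add: form_mor_def sw_cmult)
  finally show "app (formA \<beta>) (act (B \<boxtimes> B) h t) = act K h (app (formA \<beta>) t)"
    using t by (simp add: act_BB_in)
qed simp_all

lemma capA_hom: "cap_mor g \<Longrightarrow> capA g \<in> hom H K (B \<boxtimes> B)"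
proof (rule homI)
  assume g: "cap_mor g"
  then have gin: "g \<in> car HH" by (simp add: cap_mor_def)
  have cg: "app (capA g) c = (\<lambda>\<beta>. c * g \<beta>)" for c by (simp add: capA_def)
  have cin: "(\<lambda>\<beta>. c * g \<beta>) \<in> car HH" for c
    using vspace_closed(3)[OF is_vspace_tprod[OF is_vspace_Hsp, of "Hsp H"] gin] by simp
  have sc: "sw H (\<lambda>\<beta>. c * g \<beta>) \<beta> = c * sw H g \<beta>" if "bil \<beta>" for c \<beta>
    using linear_onD(3)[OF sw_linear[OF that] gin, of c] by simp
  show "lar (capA g)" using g by simp
  fix h c
  show "app (capA g) (act K h c) = act (B \<boxtimes> B) h (app (capA g) c)"
  proof (rule HH_eqI)
    fix \<beta> assume b: "bil \<beta>"
    have bb: "bil (\<lambda>v w. \<beta> (ad x v) (ad y w))" for x y by (intro lin_ad bil_lin[OF b])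
    show "sw H (app (capA g) (act K h c)) \<beta> = sw H (act (B \<boxtimes> B) h (app (capA g) c)) \<beta>"
      using g b by (simp add: cg cin act_BB sc bb sw_cmult(1)[symmetric] cap_mor_def)
  qed (simp_all only: cg cin act_BB_in)
qed simp_all

lemma funA_hom: "fun_mor \<phi> \<Longrightarrow> funA \<phi> \<in> hom H B K"
  by (rule homI) (simp_all, simp add: fun_mor_def)

lemma endA_hom: "end_mor f \<Longrightarrow> endA f \<in> hom H B B"
  by (rule homI) (simp_all, simp add: end_mor_def)

lemma elem_hom: "el_mor u \<Longrightarrow> elem_arr H u \<in> hom H K B"
  by (rule homI) (simp_all add: leD(2)[OF le_ad2[OF le_id]] el_mor_def mult.commute)

section \<open>Evaluation of composite arrows\<close>

lemma app_tensor_BB: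
  "dom f = B \<Longrightarrow> dom g = B \<Longrightarrow> t \<in> car HH \<Longrightarrow>
    app (f \<otimes> g) t = sw H t (\<lambda>v w. tens (cod f) (cod g) (app f v) (app g w))"
  using app_tensor[of t f g] by (simp add: tsum_B)

lemma app_sw:
  assumes "lar F" "t \<in> car HH" "\<And>v w. \<beta> v w \<in> car (dom F)"
  shows "app F (sw H t \<beta>) = sw H t (\<lambda>v w. app F (\<beta> v w))"
  using app_push[of F t "Hsp H" "Hsp H" \<beta>] assms by (simp add: sw_def)

lemma tens_sw:
  fixes V :: "('k, 'v::ab_group_add, 'h) hmod" and W :: "('k, 'w::ab_group_add, 'h) hmod"
  assumes "is_vspace V" "is_vspace W" "t \<in> car HH"
  shows "w \<in> car W \<Longrightarrow> (\<And>a b. f a b \<in> car V) \<Longrightarrow> tens V W (sw H t f) w = sw H t (\<lambda>a b. tens V W (f a b) w)"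
    and "v \<in> car V \<Longrightarrow> (\<And>a b. g a b \<in> car W) \<Longrightarrow> tens V W v (sw H t g) = sw H t (\<lambda>a b. tens V W v (g a b))"
  using assms unfolding sw_def
  by (auto intro!: tsum_linear_image[of V "V \<boxtimes> W"] tsum_linear_image[of W "V \<boxtimes> W"] linear_tens)

lemma sw_mod_in: "is_vspace V \<Longrightarrow> t \<in> car HH \<Longrightarrow> (\<And>a b. f a b \<in> car V) \<Longrightarrow> sw H t f \<in> car V"
  unfolding sw_def by (rule tsum_closed) auto

lemma sw_tprod_in:
  "is_vspace V \<Longrightarrow> t \<in> car HH \<Longrightarrow> (\<And>a b. f a b \<in> car (tprod V W)) \<Longrightarrow> sw H t f \<in> car (tprod V W)"
  unfolding sw_def by (rule tsum_closed) auto

lemma app_assoc_pure: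
  assumes "is_vspace U" "is_vspace V" "is_vspace W" "u \<in> car U" "v \<in> car V" "w \<in> car W"
  shows "app (assoc H U V W) (tens (U \<boxtimes> V) W (tens U V u v) w) = tens U (V \<boxtimes> W) u (tens V W v w)"
proof -
  have "bilinear_on U V (U \<boxtimes> (V \<boxtimes> W)) (\<lambda>u v. tens U (V \<boxtimes> W) u (tens V W v w))"
    by (rule bilinear_on_pre[OF bilinear_tens_mod _ linear_tens(1)]) (use assms in \<open>auto simp: linear_on_def\<close>)
  then show ?thesis
    using assms tsum_pure[of "U \<boxtimes> V \<boxtimes> W"] by (simp add: app_assoc)
qed

lemma app_assoc_inv_pure:
  assumes "is_vspace U" "is_vspace V" "is_vspace W" "u \<in> car U" "v \<in> car V" "w \<in> car W"
  shows "app (assoc_inv H U V W) (tens U (V \<boxtimes> W) u (tens V W v w)) = tens (U \<boxtimes> V) W (tens U V u v) w"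
proof -
  have "bilinear_on V W ((U \<boxtimes> V) \<boxtimes> W) (\<lambda>v w. tens (U \<boxtimes> V) W (tens U V u v) w)"
    by (rule bilinear_on_pre[OF bilinear_tens_mod linear_tens(2)]) (use assms in \<open>auto simp: linear_on_def\<close>)
  then show ?thesis
    using assms tsum_pure[of "(U \<boxtimes> V) \<boxtimes> W"] by (simp add: app_assoc_inv)
qed

lemma app_assoc_BB: "s \<in> car HH \<Longrightarrow>
    app (assoc H B B B) (tens (B \<boxtimes> B) B s w) = sw H s (\<lambda>u v. tens B (B \<boxtimes> B) u (tens B B v w))"
  using app_assoc[of B B B s w] by (simp add: tsum_B)

lemma app_assoc_inv_BB: "s \<in> car HH \<Longrightarrow>
    app (assoc_inv H B B B) (tens B (B \<boxtimes> B) u s) = sw H s (\<lambda>v w. tens (B \<boxtimes> B) B (tens B B u v) w)"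
  using app_assoc_inv[of B B B u s] by (simp add: tsum_B)

lemma lar_mid_braid: "lar (mid_braid H B)" "dom (mid_braid H B) = (B \<boxtimes> B) \<boxtimes> (B \<boxtimes> B)"
    "cod (mid_braid H B) = (B \<boxtimes> B) \<boxtimes> (B \<boxtimes> B)"
  unfolding mid_braid_def by simp_all

text \<open>The five equations follow a pure tensor through the five factors of
  \<open>mid_braid\<close>; all but the third are rebracketings.\<close>

lemma app_mid_braid:
  "app (mid_braid H B) (tens (B \<boxtimes> B) (B \<boxtimes> B) (tens B B a b) (tens B B c d)) =
    RS (\<lambda>r s. tens (B \<boxtimes> B) (B \<boxtimes> B) (tens B B a (ad s c)) (tens B B (ad r b) d))"
proof -
  let ?t = "tens (B \<boxtimes> B) (B \<boxtimes> B) (tens B B a b) (tens B B c d)"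
  have 1: "app (assoc H B B (B \<boxtimes> B)) ?t = tens B (B \<boxtimes> B \<boxtimes> B) a (tens B (B \<boxtimes> B) b (tens B B c d))"
    by (rule app_assoc_pure) simp_all
  have 2: "app (ident B \<otimes> assoc_inv H B B B) (tens B (B \<boxtimes> B \<boxtimes> B) a (tens B (B \<boxtimes> B) b (tens B B c d))) =
      tens B ((B \<boxtimes> B) \<boxtimes> B) a (tens (B \<boxtimes> B) B (tens B B b c) d)"
    by (subst app_tensor_pure) (simp_all add: app_assoc_inv_pure)
  have 3: "app (ident B \<otimes> (braid H B B \<otimes> ident B)) (tens B ((B \<boxtimes> B) \<boxtimes> B) a (tens (B \<boxtimes> B) B (tens B B b c) d)) =
      RS (\<lambda>r s. tens B ((B \<boxtimes> B) \<boxtimes> B) a (tens (B \<boxtimes> B) B (tens B B (ad s c) (ad r b)) d))"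
    by (subst app_tensor_pure, simp_all, subst app_tensor_pure, simp_all)
      (simp add: app_braid tens_sw rmat_in)
  have 4: "app (ident B \<otimes> assoc H B B B) (RS (\<lambda>r s. tens B ((B \<boxtimes> B) \<boxtimes> B) a (tens (B \<boxtimes> B) B (tens B B (ad s c) (ad r b)) d))) =
      RS (\<lambda>r s. tens B (B \<boxtimes> B \<boxtimes> B) a (tens B (B \<boxtimes> B) (ad s c) (tens B B (ad r b) d)))"
    by (subst app_sw, simp_all add: rmat_in, subst app_tensor_pure) (simp_all add: app_assoc_pure)
  have 5: "app (assoc_inv H B B (B \<boxtimes> B)) (RS (\<lambda>r s. tens B (B \<boxtimes> B \<boxtimes> B) a (tens B (B \<boxtimes> B) (ad s c) (tens B B (ad r b) d)))) =
      RS (\<lambda>r s. tens (B \<boxtimes> B) (B \<boxtimes> B) (tens B B a (ad s c)) (tens B B (ad r b) d))"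
    by (subst app_sw, simp_all add: rmat_in app_assoc_inv_pure)
  have in1: "?t \<in> car (tprod (B \<boxtimes> B) (B \<boxtimes> B))" by simp
  have in2: "tens B (B \<boxtimes> B \<boxtimes> B) a (tens B (B \<boxtimes> B) b (tens B B c d)) \<in> car (tprod B (B \<boxtimes> B \<boxtimes> B))" by simp
  have in3: "tens B ((B \<boxtimes> B) \<boxtimes> B) a (tens (B \<boxtimes> B) B (tens B B b c) d) \<in> car (tprod B ((B \<boxtimes> B) \<boxtimes> B))" by simp
  show ?thesis
    unfolding mid_braid_def using in1 in2 in3 by (simp add: 1 2 3 4 5)
qed

lemma app_mid_braid_tensor:
  assumes "s \<in> car HH" "t \<in> car HH"
  shows "app (mid_braid H B) (tens (B \<boxtimes> B) (B \<boxtimes> B) s t) =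
    sw H s (\<lambda>a b. sw H t (\<lambda>c d. RS (\<lambda>r q. tens (B \<boxtimes> B) (B \<boxtimes> B) (tens B B a (ad q c)) (tens B B (ad r b) d))))"
proof -
  have "tens (B \<boxtimes> B) (B \<boxtimes> B) s t = tens (B \<boxtimes> B) (B \<boxtimes> B) (sw H s (tens B B)) (sw H t (tens B B))"
    by (simp add: sw_tens_BB assms)
  also have "\<dots> = sw H s (\<lambda>a b. sw H t (\<lambda>c d. tens (B \<boxtimes> B) (B \<boxtimes> B) (tens B B a b) (tens B B c d)))"
    using assms by (subst tens_sw(1); (subst tens_sw(2))?; simp add: sw_tens_BB)
  finally have eq: "tens (B \<boxtimes> B) (B \<boxtimes> B) s t = \<dots>" .
  show ?thesis
    unfolding eq using assms
    by (subst app_sw; simp add: lar_mid_braid sw_mod_in)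
      (subst app_sw; simp add: lar_mid_braid app_mid_braid)
qed

text \<open>Converse to \<open>tens3_eval\<close>: a bilinear form on \<open>H\<close> and
  \<open>H \<otimes> H\<close>, restricted to pure tensors, is a trilinear form that determines its
  values.\<close>

lemma eval3:
  assumes G: "bilinear_on B (B \<boxtimes> B) kspace \<Gamma>"
  shows "tri (\<lambda>x y z. \<Gamma> x (tens B B y z))"
    and "t \<in> car HH \<Longrightarrow> tens B (B \<boxtimes> B) x t \<Gamma> = sw H t (\<lambda>y z. \<Gamma> x (tens B B y z))"
proof -
  have g1: "linear_on B kspace (\<lambda>x. \<Gamma> x t)" if "t \<in> car HH" for t
    using G that by (simp add: bilinear_on_def)
  have g2: "linear_on (B \<boxtimes> B) kspace (\<Gamma> x)" for x
    using G by (simp add: bilinear_on_def)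
  show "tri (\<lambda>x y z. \<Gamma> x (tens B B y z))"
    using g1 linear_on_comp[OF linear_tens(1)[where V = B and W = B] g2]
      linear_on_comp[OF linear_tens(2)[where V = B and W = B] g2]
    by (intro triI) (simp_all add: lf_def linear_on_BK)
  assume t: "t \<in> car HH"
  have "tens B (B \<boxtimes> B) x t \<Gamma> = \<Gamma> x t" using G by (simp add: tens_def)
  also have "\<dots> = \<Gamma> x (sw H t (tens B B))" by (simp add: sw_tens_BB t)
  also have "\<dots> = sw H t (\<lambda>y z. \<Gamma> x (tens B B y z))"
    unfolding sw_def by (rule tsum_linear_image[OF _ _ g2]) (simp_all add: t)
  finally show "tens B (B \<boxtimes> B) x t \<Gamma> = sw H t (\<lambda>y z. \<Gamma> x (tens B B y z))" .
qed

lemma B3_eqI: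
  assumes "s \<in> car (tprod B (B \<boxtimes> B))" "t \<in> car (tprod B (B \<boxtimes> B))"
    "\<And>\<Gamma>. bilinear_on B (B \<boxtimes> B) kspace \<Gamma> \<Longrightarrow> s \<Gamma> = t \<Gamma>"
  shows "s = t"
  by (rule tensor_eqI[OF assms])

section \<open>Criteria in terms of scalar test functionals\<close>

lemma algebra_inI:
  assumes f: "mul_mor f" and u: "el_mor u"
    and assoc: "\<And>a b c. f (f a b) c = f a (f b c)" and unit: "\<And>a. f u a = a" "\<And>a. f a u = a"
  shows "algebra_in H B (mulA f) (elem_arr H u)"
  unfolding algebra_in_def
proof (intro conjI mulA_hom elem_hom f u)
  note s = f app_tensor_pure sw_mul app_assoc_pure app_units
  show "mulA f \<cdot> (mulA f \<otimes> ident B) = mulA f \<cdot> (ident B \<otimes> mulA f) \<cdot> assoc H B B B"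
    by (rule arrow_eq_tensor3[where U = B and V = B and W = B and Z = B]) (simp_all add: s assoc)
  show "mulA f \<cdot> (elem_arr H u \<otimes> ident B) = lunit H B"
    by (rule arrow_eq_tensor[where V = K and W = B and U = B])
      (simp_all add: s leD(2)[OF mul_mor_lin(1)[OF f le_id]] unit)
  show "mulA f \<cdot> (ident B \<otimes> elem_arr H u) = runit H B"
    by (rule arrow_eq_tensor[where V = B and W = K and U = B])
      (simp_all add: s leD(2)[OF mul_mor_lin(2)[OF f le_id]] unit)
qed

lemma comp_comult_left:
  assumes d: "com_mor d" and t: "t \<in> car HH"
  shows "app (assoc H B B B \<cdot> (comA d \<otimes> ident B)) t =
    sw H t (\<lambda>v w. sw H (d v) (\<lambda>x y. tens B (B \<boxtimes> B) x (tens B B y w)))"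
  using t
  by (simp add: app_tensor_BB, subst app_sw) (simp_all add: app_assoc_BB com_morD[OF d])

lemma comp_comult_right:
  assumes d: "com_mor d" and t: "t \<in> car HH"
  shows "app (ident B \<otimes> comA d) t = sw H t (\<lambda>v w. tens B (B \<boxtimes> B) v (d w))"
  using t by (simp add: app_tensor_BB)

text \<open>Stated for a tensor \<open>t\<close> because it serves twice: with
  \<open>t = d h\<close> it is coassociativity, with \<open>t\<close> a copairing it is the
  Frobenius condition on a coalgebra.\<close>

lemma coassoc_eq:
  assumes d: "com_mor d" and t: "t \<in> car HH"
    and eq: "\<And>\<gamma>. tri \<gamma> \<Longrightarrow> sw H t (\<lambda>a b. sw H (d a) (\<lambda>x y. \<gamma> x y b)) = sw H t (\<lambda>a b. sw H (d b) (\<lambda>x y. \<gamma> a x y))"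
  shows "app (assoc H B B B \<cdot> (comA d \<otimes> ident B)) t = app (ident B \<otimes> comA d) t"
  unfolding comp_comult_left[OF d t] comp_comult_right[OF d t]
proof (rule B3_eqI)
  have v: "is_vspace (B \<boxtimes> B \<boxtimes> B)" by simp
  show "sw H t (\<lambda>v w. sw H (d v) (\<lambda>x y. tens B (B \<boxtimes> B) x (tens B B y w))) \<in> car (tprod B (B \<boxtimes> B))"
    using sw_mod_in[OF v] by (simp add: t com_morD[OF d])
  show "sw H t (\<lambda>v w. tens B (B \<boxtimes> B) v (d w)) \<in> car (tprod B (B \<boxtimes> B))"
    using sw_mod_in[OF v] by (simp add: t com_morD[OF d])
  fix \<Gamma> assume G: "bilinear_on B (B \<boxtimes> B) kspace \<Gamma>"
  have e: "tens B (B \<boxtimes> B) x (tens B B y z) \<Gamma> = \<Gamma> x (tens B B y z)" for x y z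
    using G by (simp add: tens_def)
  show "sw H t (\<lambda>v w. sw H (d v) (\<lambda>x y. tens B (B \<boxtimes> B) x (tens B B y w))) \<Gamma> =
      sw H t (\<lambda>v w. tens B (B \<boxtimes> B) v (d w)) \<Gamma>"
    using eq[OF eval3(1)[OF G]] by (simp add: sw_apply e eval3(2)[OF G] com_morD[OF d])
qed

lemma coalgebra_inI:
  assumes d: "com_mor d" and n: "fun_mor n"
    and coassoc: "\<And>\<gamma> h. tri \<gamma> \<Longrightarrow> sw H (d h) (\<lambda>a b. sw H (d a) (\<lambda>x y. \<gamma> x y b)) = sw H (d h) (\<lambda>a b. sw H (d b) (\<lambda>x y. \<gamma> a x y))"
    and counit: "\<And>\<phi> h. lf \<phi> \<Longrightarrow> sw H (d h) (\<lambda>a b. n a * \<phi> b) = \<phi> h"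
       "\<And>\<phi> h. lf \<phi> \<Longrightarrow> sw H (d h) (\<lambda>a b. \<phi> a * n b) = \<phi> h"
  shows "coalgebra_in H B (comA d) (funA n)"
  unfolding coalgebra_in_def
proof (intro conjI comA_hom funA_hom d n)
  show "assoc H B B B \<cdot> (comA d \<otimes> ident B) \<cdot> comA d = (ident B \<otimes> comA d) \<cdot> comA d"
  proof (rule arrow_eqI)
    fix x
    show "app (assoc H B B B \<cdot> (comA d \<otimes> ident B) \<cdot> comA d) x = app ((ident B \<otimes> comA d) \<cdot> comA d) x"
      using coassoc_eq[OF d com_morD(1)[OF d] coassoc, of x] by (simp add: com_morD[OF d])
  qed (simp_all add: d)
  show "(funA n \<otimes> ident B) \<cdot> comA d = lunit_inv H B"
  proof (rule arrow_eqI)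
    fix x
    have "sw H (d x) (\<lambda>v w. tens K B (n v) w) = tens K B 1 x"
    proof (rule tensor_eqI)
      show "sw H (d x) (\<lambda>v w. tens K B (n v) w) \<in> car (tprod K B)"
        using sw_mod_in[of "K \<boxtimes> B"] by (simp add: com_morD[OF d])
      show "tens K B 1 x \<in> car (tprod K B)" by simp
      fix \<Gamma> assume G: "bilinear_on K B kspace \<Gamma>"
      then have lf: "lf (\<Gamma> 1)" by (simp add: bilinear_on_def lf_def linear_on_BK)
      have "\<Gamma> (n v) b = n v * \<Gamma> 1 b" for v b
        using bilinear_onD(4)[OF G, of 1 b "n v"] by simp
      then show "sw H (d x) (\<lambda>v w. tens K B (n v) w) \<Gamma> = tens K B 1 x \<Gamma>"
        using counit(1)[OF lf, of x] G by (simp add: sw_apply tens_def)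
    qed
    then show "app ((funA n \<otimes> ident B) \<cdot> comA d) x = app (lunit_inv H B) x"
      by (simp add: app_tensor_BB com_morD[OF d] app_units)
  qed (simp_all add: d n)
  show "(ident B \<otimes> funA n) \<cdot> comA d = runit_inv H B"
  proof (rule arrow_eqI)
    fix x
    have "sw H (d x) (\<lambda>v w. tens B K v (n w)) = tens B K x 1"
    proof (rule tensor_eqI)
      show "sw H (d x) (\<lambda>v w. tens B K v (n w)) \<in> car (tprod B K)"
        using sw_mod_in[of "B \<boxtimes> K"] by (simp add: com_morD[OF d])
      show "tens B K x 1 \<in> car (tprod B K)" by simp
      fix \<Gamma> assume G: "bilinear_on B K kspace \<Gamma>"
      then have lf: "lf (\<lambda>v. \<Gamma> v 1)" by (simp add: bilinear_on_def lf_def linear_on_BK)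
      have "\<Gamma> v (n b) = \<Gamma> v 1 * n b" for b v
        using bilinear_onD(5)[OF G, of v 1 "n b"] by (simp add: mult.commute)
      then show "sw H (d x) (\<lambda>v w. tens B K v (n w)) \<Gamma> = tens B K x 1 \<Gamma>"
        using counit(2)[OF lf, of x] G by (simp add: sw_apply tens_def)
    qed
    then show "app ((ident B \<otimes> funA n) \<cdot> comA d) x = app (runit_inv H B) x"
      by (simp add: app_tensor_BB com_morD[OF d] app_units)
  qed (simp_all add: d n)
qed

lemma hopf_inI:
  assumes alg: "algebra_in H B (mulA f) (elem_arr H u)" and coalg: "coalgebra_in H B (comA d) (funA n)"
    and f: "mul_mor f" and u: "el_mor u" and d: "com_mor d" and n: "fun_mor n" and s: "end_mor s"
    and mult: "\<And>\<beta> x y. bil \<beta> \<Longrightarrow> sw H (d (f x y)) \<beta> =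
      sw H (d x) (\<lambda>a b. sw H (d y) (\<lambda>c e. RS (\<lambda>r q. \<beta> (f a (ad q c)) (f (ad r b) e))))"
    and du: "\<And>\<beta>. bil \<beta> \<Longrightarrow> sw H (d u) \<beta> = \<beta> u u"
    and nf: "\<And>x y. n (f x y) = n x * n y" and nu: "n u = 1"
    and anti: "\<And>\<phi> h. lf \<phi> \<Longrightarrow> sw H (d h) (\<lambda>a b. \<phi> (f (s a) b)) = n h * \<phi> u"
      "\<And>\<phi> h. lf \<phi> \<Longrightarrow> sw H (d h) (\<lambda>a b. \<phi> (f a (s b))) = n h * \<phi> u"
  shows "hopf_in H B (mulA f) (elem_arr H u) (comA d) (funA n) (endA s)"
  unfolding hopf_in_def
proof (intro conjI alg coalg endA_hom s)
  note l = f u d n s com_morD[OF d] lar_mid_braid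
  show "comA d \<cdot> mulA f = (mulA f \<otimes> mulA f) \<cdot> mid_braid H B \<cdot> (comA d \<otimes> comA d)"
  proof (rule arrow_eq_tensor[where V = B and W = B and U = "B \<boxtimes> B"])
    fix x y
    have "app ((mulA f \<otimes> mulA f) \<cdot> mid_braid H B \<cdot> (comA d \<otimes> comA d)) (tens B B x y) =
        app (mulA f \<otimes> mulA f) (app (mid_braid H B) (tens (B \<boxtimes> B) (B \<boxtimes> B) (d x) (d y)))"
      by (simp add: l app_tensor_pure)
    also have "\<dots> = sw H (d x) (\<lambda>a b. sw H (d y) (\<lambda>c e. RS (\<lambda>r q. tens B B (f a (ad q c)) (f (ad r b) e))))"
      unfolding app_mid_braid_tensor[OF com_morD(1)[OF d] com_morD(1)[OF d]]
      by (simp add: app_sw sw_tprod_in l rmat_in app_tensor_pure sw_mul)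
    also have "\<dots> = d (f x y)"
    proof (rule HH_eqI)
      show "sw H (d x) (\<lambda>a b. sw H (d y) (\<lambda>c e. RS (\<lambda>r q. tens B B (f a (ad q c)) (f (ad r b) e)))) \<in> car HH"
        by (intro sw_in l rmat_in tens_BB_in)
      fix \<beta> assume b: "bil \<beta>"
      show "sw H (sw H (d x) (\<lambda>a b. sw H (d y) (\<lambda>c e. RS (\<lambda>r q. tens B B (f a (ad q c)) (f (ad r b) e))))) \<beta> =
          sw H (d (f x y)) \<beta>"
        unfolding mult[OF b] using b
        by (simp add: sw_sw sw_in l rmat_in) (simp add: tens_B sw_tens2)
    qed (rule l)
    finally show "app (comA d \<cdot> mulA f) (tens B B x y) =
        app ((mulA f \<otimes> mulA f) \<cdot> mid_braid H B \<cdot> (comA d \<otimes> comA d)) (tens B B x y)"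
      by (simp add: sw_mul f)
  qed (simp_all add: l)
  show "comA d \<cdot> elem_arr H u = (elem_arr H u \<otimes> elem_arr H u) \<cdot> lunit_inv H K"
  proof (rule arrow_eq_K)
    have "d u = tens B B u u"
      by (rule HH_eqI) (simp_all add: l du tens_B tens2_in sw_tens2)
    then show "app (comA d \<cdot> elem_arr H u) 1 = app ((elem_arr H u \<otimes> elem_arr H u) \<cdot> lunit_inv H K) 1"
      by (simp add: app_units app_tensor_pure)
  qed (simp_all add: l)
  show "funA n \<cdot> mulA f = lunit H K \<cdot> (funA n \<otimes> funA n)"
    by (rule arrow_eq_tensor[where V = B and W = B and U = K])
      (simp_all add: l sw_mul app_tensor_pure app_units nf)
  show "funA n \<cdot> elem_arr H u = ident K"
    by (rule arrow_eq_K) (simp_all add: l nu)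
  show "mulA f \<cdot> (endA s \<otimes> ident B) \<cdot> comA d = elem_arr H u \<cdot> funA n"
  proof (rule arrow_eqI)
    fix x
    have "sw H (d x) (\<lambda>a b. f (s a) b) = sc (n x) u"
      by (rule lf_separate) (simp add: sw_lf anti lfD)
    then show "app (mulA f \<cdot> (endA s \<otimes> ident B) \<cdot> comA d) x = app (elem_arr H u \<cdot> funA n) x"
      by (simp add: l app_tensor_BB) (subst app_sw; simp add: l sw_mul)
  qed (simp_all add: l)
  show "mulA f \<cdot> (ident B \<otimes> endA s) \<cdot> comA d = elem_arr H u \<cdot> funA n"
  proof (rule arrow_eqI)
    fix x
    have "sw H (d x) (\<lambda>a b. f a (s b)) = sc (n x) u"
      by (rule lf_separate) (simp add: sw_lf anti lfD)
    then show "app (mulA f \<cdot> (ident B \<otimes> endA s) \<cdot> comA d) x = app (elem_arr H u \<cdot> funA n) x"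
      by (simp add: l app_tensor_BB) (subst app_sw; simp add: l sw_mul)
  qed (simp_all add: l)
qed

lemma cap_mor_in: "cap_mor g \<Longrightarrow> g \<in> car HH" by (simp add: cap_mor_def)
lemma form_mor_bil: "form_mor \<beta> \<Longrightarrow> bil \<beta>" by (simp add: form_mor_def)

text \<open>Form and copairing are unrelated here. For a matching pair the result is the identity,
  but the mixed pair \<open>form_g\<close>, \<open>cap_r\<close> must give the antipode.\<close>

lemma cup_cap_normal:
  assumes b: "form_mor \<beta>" and g: "cap_mor g"
  shows "cup_cap H B (formA \<beta>) (capA g) = arr B B (\<lambda>h. sw H g (\<lambda>x y. sc (\<beta> h x) y))"
proof (rule arrow_eqI)
  note l = b g cap_mor_in[OF g] sw_form
  show lar: "lar (cup_cap H B (formA \<beta>) (capA g))" by (simp add: cup_cap_def l)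
  have "le (\<lambda>h. sw H g (\<lambda>x y. sc (\<beta> h x) y))"
    by (intro lin bil_lin[OF form_mor_bil[OF b]])
  then show "lar (arr B B (\<lambda>h. sw H g (\<lambda>x y. sc (\<beta> h x) y)))"
    by (intro lar_arr) (simp_all add: linear_on_BK le_def)
  fix h
  have "app (cup_cap H B (formA \<beta>) (capA g)) h =
      app (lunit H B) (app (formA \<beta> \<otimes> ident B) (app (assoc_inv H B B B) (tens B (B \<boxtimes> B) h g)))"
    by (simp add: cup_cap_def app_units app_tensor_pure l)
  also have "\<dots> = sw H g (\<lambda>x y. sc (\<beta> h x) y)"
    by (simp add: app_assoc_inv_BB l, subst app_sw, simp_all add: l, subst app_sw)
      (simp_all add: l app_tensor_pure app_units)
  finally show "app (cup_cap H B (formA \<beta>) (capA g)) h = app (arr B B (\<lambda>h. sw H g (\<lambda>x y. sc (\<beta> h x) y))) h"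
    by simp
qed (simp_all add: cup_cap_def)

lemma cap_cup_normal:
  assumes b: "form_mor \<beta>" and g: "cap_mor g"
  shows "cap_cup H B (formA \<beta>) (capA g) = arr B B (\<lambda>h. sw H g (\<lambda>x y. sc (\<beta> y h) x))"
proof (rule arrow_eqI)
  note l = b g cap_mor_in[OF g] sw_form
  show lar: "lar (cap_cup H B (formA \<beta>) (capA g))" by (simp add: cap_cup_def l)
  have "le (\<lambda>h. sw H g (\<lambda>x y. sc (\<beta> y h) x))"
    by (intro lin bil_lin[OF form_mor_bil[OF b]])
  then show "lar (arr B B (\<lambda>h. sw H g (\<lambda>x y. sc (\<beta> y h) x)))"
    by (intro lar_arr) (simp_all add: linear_on_BK le_def)
  fix h
  have "app (cap_cup H B (formA \<beta>) (capA g)) h =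
      app (runit H B) (app (ident B \<otimes> formA \<beta>) (app (assoc H B B B) (tens (B \<boxtimes> B) B g h)))"
    by (simp add: cap_cup_def app_units app_tensor_pure l)
  also have "\<dots> = sw H g (\<lambda>x y. sc (\<beta> y h) x)"
    by (simp add: app_assoc_BB l, subst app_sw, simp_all add: l, subst app_sw)
      (simp_all add: l app_tensor_pure app_units)
  finally show "app (cap_cup H B (formA \<beta>) (capA g)) h = app (arr B B (\<lambda>h. sw H g (\<lambda>x y. sc (\<beta> y h) x))) h"
    by simp
qed (simp_all add: cap_cup_def)

lemma snakes_ident:
  assumes b: "form_mor \<beta>" and g: "cap_mor g"
    and s: "\<And>h \<phi>. lf \<phi> \<Longrightarrow> sw H g (\<lambda>x y. \<beta> h x * \<phi> y) = \<phi> h"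
      "\<And>h \<phi>. lf \<phi> \<Longrightarrow> sw H g (\<lambda>x y. \<beta> y h * \<phi> x) = \<phi> h"
  shows "cup_cap H B (formA \<beta>) (capA g) = ident B" "cap_cup H B (formA \<beta>) (capA g) = ident B"
proof -
  have "sw H g (\<lambda>x y. sc (\<beta> h x) y) = h" "sw H g (\<lambda>x y. sc (\<beta> y h) x) = h" for h
    by (rule lf_separate, simp add: sw_lf lfD s)+
  then show "cup_cap H B (formA \<beta>) (capA g) = ident B" "cap_cup H B (formA \<beta>) (capA g) = ident B"
    by (simp_all add: cup_cap_normal cap_cup_normal b g ident_def)
qed

lemma frobenius_algebra_inI:
  assumes alg: "algebra_in H B (mulA f) (elem_arr H u)" and f: "mul_mor f" and b: "form_mor \<beta>" and g: "cap_mor g"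
    and frob: "\<And>x y z. \<beta> (f x y) z = \<beta> x (f y z)"
    and s: "\<And>h \<phi>. lf \<phi> \<Longrightarrow> sw H g (\<lambda>x y. \<beta> h x * \<phi> y) = \<phi> h"
      "\<And>h \<phi>. lf \<phi> \<Longrightarrow> sw H g (\<lambda>x y. \<beta> y h * \<phi> x) = \<phi> h"
  shows "frobenius_algebra_in H B (mulA f) (elem_arr H u) (formA \<beta>) (capA g)"
  unfolding frobenius_algebra_in_def
proof (intro conjI alg formA_hom capA_hom b g snakes_ident s)
  show "formA \<beta> \<cdot> (mulA f \<otimes> ident B) = formA \<beta> \<cdot> (ident B \<otimes> mulA f) \<cdot> assoc H B B B"
    by (rule arrow_eq_tensor3[where U = B and V = B and W = B and Z = K])
      (simp_all add: f b app_tensor_pure sw_mul sw_form app_assoc_pure frob)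
qed

lemma frobenius_coalgebra_inI:
  assumes coalg: "coalgebra_in H B (comA d) (funA n)" and d: "com_mor d" and b: "form_mor \<beta>" and g: "cap_mor g"
    and frob: "\<And>\<gamma>. tri \<gamma> \<Longrightarrow> sw H g (\<lambda>a b. sw H (d a) (\<lambda>x y. \<gamma> x y b)) = sw H g (\<lambda>a b. sw H (d b) (\<lambda>x y. \<gamma> a x y))"
    and s: "\<And>h \<phi>. lf \<phi> \<Longrightarrow> sw H g (\<lambda>x y. \<beta> h x * \<phi> y) = \<phi> h"
      "\<And>h \<phi>. lf \<phi> \<Longrightarrow> sw H g (\<lambda>x y. \<beta> y h * \<phi> x) = \<phi> h"
  shows "frobenius_coalgebra_in H B (comA d) (funA n) (formA \<beta>) (capA g)"
  unfolding frobenius_coalgebra_in_def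
proof (intro conjI coalg formA_hom capA_hom b g snakes_ident s)
  show "assoc H B B B \<cdot> (comA d \<otimes> ident B) \<cdot> capA g = (ident B \<otimes> comA d) \<cdot> capA g"
    by (rule arrow_eq_K)
      (use coassoc_eq[OF d cap_mor_in[OF g] frob] in \<open>simp_all add: d g cap_mor_in[OF g]\<close>)
qed

lemma F_algebra_inI:
  assumes alg: "algebra_in H B (mulA f) (elem_arr H u)" and coalg: "coalgebra_in H B (comA d) (funA n)"
    and f: "mul_mor f" and d: "com_mor d"
    and F: "\<And>\<beta> a b. bil \<beta> \<Longrightarrow> sw H (d a) (\<lambda>x y. \<beta> x (f y b)) = sw H (d (f a b)) \<beta>"
      "\<And>\<beta> a b. bil \<beta> \<Longrightarrow> sw H (d b) (\<lambda>x y. \<beta> (f a x) y) = sw H (d (f a b)) \<beta>"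
  shows "F_algebra_in H B (mulA f) (elem_arr H u) (comA d) (funA n)"
  unfolding F_algebra_in_def
proof (intro conjI alg coalg)
  note l = f d com_morD[OF d]
  show "(ident B \<otimes> mulA f) \<cdot> assoc H B B B \<cdot> (comA d \<otimes> ident B) = comA d \<cdot> mulA f"
  proof (rule arrow_eq_tensor[where V = B and W = B and U = "B \<boxtimes> B"])
    fix a b
    have "sw H (d a) (\<lambda>x y. tens B B x (f y b)) = d (f a b)"
      by (rule HH_eqI) (simp_all add: l sw_in sw_sw, simp add: tens_B sw_tens2 F)
    moreover have "app ((ident B \<otimes> mulA f) \<cdot> assoc H B B B \<cdot> (comA d \<otimes> ident B)) (tens B B a b) =
        sw H (d a) (\<lambda>x y. tens B B x (f y b))"
      by (simp add: l app_tensor_pure app_assoc_BB, subst app_sw) (simp_all add: l app_tensor_pure sw_mul)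
    ultimately show "app ((ident B \<otimes> mulA f) \<cdot> assoc H B B B \<cdot> (comA d \<otimes> ident B)) (tens B B a b) =
        app (comA d \<cdot> mulA f) (tens B B a b)"
      by (simp add: l sw_mul)
  qed (simp_all add: l)
  show "(mulA f \<otimes> ident B) \<cdot> assoc_inv H B B B \<cdot> (ident B \<otimes> comA d) = comA d \<cdot> mulA f"
  proof (rule arrow_eq_tensor[where V = B and W = B and U = "B \<boxtimes> B"])
    fix a b
    have "sw H (d b) (\<lambda>x y. tens B B (f a x) y) = d (f a b)"
      by (rule HH_eqI) (simp_all add: l sw_in sw_sw, simp add: tens_B sw_tens2 F)
    moreover have "app ((mulA f \<otimes> ident B) \<cdot> assoc_inv H B B B \<cdot> (ident B \<otimes> comA d)) (tens B B a b) =
        sw H (d b) (\<lambda>x y. tens B B (f a x) y)"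
      by (simp add: l app_tensor_pure app_assoc_inv_BB, subst app_sw) (simp_all add: l app_tensor_pure sw_mul)
    ultimately show "app ((mulA f \<otimes> ident B) \<cdot> assoc_inv H B B B \<cdot> (ident B \<otimes> comA d)) (tens B B a b) =
        app (comA d \<cdot> mulA f) (tens B B a b)"
      by (simp add: l sw_mul)
  qed (simp_all add: l)
qed

section \<open>The associated structures as maps on elements\<close>

lemma frob_comult_normal:
  assumes f: "mul_mor f" and g: "cap_mor g" and d: "com_mor (\<lambda>h. sw H g (\<lambda>x y. tens2 H x (f y h)))"
  shows "frob_comult H B (mulA f) (capA g) = comA (\<lambda>h. sw H g (\<lambda>x y. tens2 H x (f y h)))"
proof (rule arrow_eqI)
  note l = f g d cap_mor_in[OF g]
  fix h
  have "app (frob_comult H B (mulA f) (capA g)) h = app (ident B \<otimes> mulA f) (app (assoc H B B B) (tens (B \<boxtimes> B) B g h))"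
    by (simp add: frob_comult_def app_units app_tensor_pure l)
  also have "\<dots> = sw H g (\<lambda>x y. tens B B x (f y h))"
    by (simp add: app_assoc_BB l, subst app_sw) (simp_all add: l app_tensor_pure sw_mul)
  finally show "app (frob_comult H B (mulA f) (capA g)) h = app (comA (\<lambda>h. sw H g (\<lambda>x y. tens2 H x (f y h)))) h"
    by (simp add: tens_B)
qed (simp_all add: frob_comult_def f g d)

lemma frob_counit_normal:
  assumes b: "form_mor \<beta>" and n: "fun_mor (\<lambda>h. \<beta> h u)"
  shows "frob_counit H B (elem_arr H u) (formA \<beta>) = funA (\<lambda>h. \<beta> h u)"
  by (rule arrow_eqI) (simp_all add: frob_counit_def b n app_units app_tensor_pure sw_form)

lemma frob_mult_normal:
  assumes d: "com_mor d" and b: "form_mor \<beta>" and f: "mul_mor (\<lambda>a b. sw H (d a) (\<lambda>p q. sc (\<beta> q b) p))"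
  shows "frob_mult H B (comA d) (formA \<beta>) = mulA (\<lambda>a b. sw H (d a) (\<lambda>p q. sc (\<beta> q b) p))"
proof (rule arrow_eq_tensor[where V = B and W = B and U = B])
  note l = d b f com_morD[OF d]
  fix a h
  have "app (frob_mult H B (comA d) (formA \<beta>)) (tens B B a h) =
      app (runit H B) (app (ident B \<otimes> formA \<beta>) (app (assoc H B B B) (tens (B \<boxtimes> B) B (d a) h)))"
    by (simp add: frob_mult_def app_tensor_pure l)
  also have "\<dots> = sw H (d a) (\<lambda>p q. sc (\<beta> q h) p)"
    by (simp add: app_assoc_BB l, subst app_sw, simp_all add: l, subst app_sw)
      (simp_all add: l app_tensor_pure app_units sw_form)
  finally show "app (frob_mult H B (comA d) (formA \<beta>)) (tens B B a h) =
      app (mulA (\<lambda>a b. sw H (d a) (\<lambda>p q. sc (\<beta> q b) p))) (tens B B a h)"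
    by (simp add: sw_mul f)
qed (simp_all add: frob_mult_def d b f)

lemma frob_unit_normal:
  assumes n: "fun_mor n" and g: "cap_mor g"
  shows "frob_unit H B (funA n) (capA g) = elem_arr H (sw H g (\<lambda>x y. sc (n y) x))"
proof (rule arrow_eq_K)
  note l = n g cap_mor_in[OF g]
  show "app (frob_unit H B (funA n) (capA g)) 1 = app (elem_arr H (sw H g (\<lambda>x y. sc (n y) x))) 1"
    by (simp add: frob_unit_def l app_tensor_BB, subst app_sw) (simp_all add: l app_units)
qed (simp_all add: frob_unit_def n g)

lemma mult_braid_normal:
  assumes f: "mul_mor f" and f': "mul_mor (\<lambda>a b. RS (\<lambda>r s. f (ad s b) (ad r a)))"
  shows "mulA f \<cdot> braid H B B = mulA (\<lambda>a b. RS (\<lambda>r s. f (ad s b) (ad r a)))"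
proof (rule arrow_eq_tensor[where V = B and W = B and U = B])
  fix a b
  have "app (mulA f \<cdot> braid H B B) (tens B B a b) = app (mulA f) (RS (\<lambda>r s. tens B B (ad s b) (ad r a)))"
    by (simp add: app_braid)
  also have "\<dots> = RS (\<lambda>r s. f (ad s b) (ad r a))"
    by (subst app_sw) (simp_all add: f rmat_in sw_mul)
  finally show "app (mulA f \<cdot> braid H B B) (tens B B a b) =
      app (mulA (\<lambda>a b. RS (\<lambda>r s. f (ad s b) (ad r a)))) (tens B B a b)"
    by (simp add: sw_mul f')
qed (simp_all add: f f')

end

section \<open>Frobenius algebras and coalgebras\<close>

context quasitriangular_hopf
begin

lemma le_from_lf:
  assumes "\<And>\<phi>. lf \<phi> \<Longrightarrow> lf (\<lambda>x. \<phi> (f x))"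
  shows "le f"
  unfolding le_iff
proof (intro conjI allI)
  show "f (x + y) = f x + f y" for x y
    by (rule lf_separate) (use lfD(1)[OF assms] in \<open>simp add: lfD(1)\<close>)
  show "f (sc c x) = sc c (f x)" for c x
    by (rule lf_separate) (use lfD(2)[OF assms] in \<open>simp add: lfD(2)\<close>)
qed

lemma mul_morD: "mul_mor f \<Longrightarrow> lf \<phi> \<Longrightarrow> \<phi> (ad h (f a b)) = D h (\<lambda>p q. \<phi> (f (ad p a) (ad q b)))"
  by (simp add: mul_mor_def)

lemma cap_morD: "cap_mor g \<Longrightarrow> bil \<beta> \<Longrightarrow> D h (\<lambda>p q. sw H g (\<lambda>a b. \<beta> (ad p a) (ad q b))) = eps h * sw H g \<beta>"
  by (simp add: cap_mor_def)

lemma form_morD: "form_mor \<beta> \<Longrightarrow> D h (\<lambda>p q. \<beta> (ad p a) (ad q b)) = eps h * \<beta> a b"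
  by (simp add: form_mor_def)

lemma com_mor_ad: "com_mor d \<Longrightarrow> bil \<beta> \<Longrightarrow>
    sw H (d (ad h x)) \<beta> = D h (\<lambda>p q. sw H (d x) (\<lambda>a b. \<beta> (ad p a) (ad q b)))"
  by (simp add: com_mor_def)

lemma com_morI:
  assumes "\<And>x. d x \<in> car HH" "\<And>\<beta>. bil \<beta> \<Longrightarrow> lf (\<lambda>x. sw H (d x) \<beta>)"
    and "\<And>\<beta> h x. bil \<beta> \<Longrightarrow> sw H (d (ad h x)) \<beta> = D h (\<lambda>p q. sw H (d x) (\<lambda>a b. \<beta> (ad p a) (ad q b)))"
  shows "com_mor d"
proof -
  note c = vspace_closed[OF is_vspace_tprod[OF is_vspace_Hsp, of "Hsp H"]]
  have "linear_on (Hsp H) HH d"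
  proof (rule linear_onI)
    fix x y and k :: 'k
    show "d x \<in> car HH" by (rule assms)
    show "d (x + y) = d x + d y"
    proof (rule HH_eqI)
      fix \<beta> assume b: "bil \<beta>"
      show "sw H (d (x + y)) \<beta> = sw H (d x + d y) \<beta>"
        using lfD(1)[OF assms(2)[OF b]] linear_onD(2)[OF sw_linear[OF b] assms(1) assms(1), of x y] by simp
    qed (simp_all add: assms(1) c)
    show "d (scl (Hsp H) k x) = scl HH k (d x)"
    proof (rule HH_eqI)
      fix \<beta> assume b: "bil \<beta>"
      show "sw H (d (scl (Hsp H) k x)) \<beta> = sw H (scl HH k (d x)) \<beta>"
        using lfD(2)[OF assms(2)[OF b]] linear_onD(3)[OF sw_linear[OF b] assms(1), of k x] by simp
    qed (use c(3)[OF assms(1)] in \<open>simp_all add: assms(1)\<close>)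
  qed
  then show ?thesis using assms(3) by (simp add: com_mor_def)
qed

section \<open>The coalgebra of a Frobenius algebra\<close>

context
  fixes f u \<beta> g
  assumes f: "mul_mor f" and u: "el_mor u" and b: "form_mor \<beta>" and g: "cap_mor g"
    and assoc: "\<And>a b c. f (f a b) c = f a (f b c)" and unit: "\<And>a. f u a = a" "\<And>a. f a u = a"
    and frob: "\<And>x y z. \<beta> (f x y) z = \<beta> x (f y z)"
    and s1: "\<And>h \<phi>. lf \<phi> \<Longrightarrow> sw H g (\<lambda>x y. \<beta> h x * \<phi> y) = \<phi> h"
    and s2: "\<And>h \<phi>. lf \<phi> \<Longrightarrow> sw H g (\<lambda>x y. \<beta> y h * \<phi> x) = \<phi> h"
begin

abbreviation "fr_comult h \<equiv> sw H g (\<lambda>x y. tens2 H x (f y h))"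

lemma fr_comult_in: "fr_comult h \<in> car HH"
  by (intro sw_in tens2_in cap_mor_in[OF g])

lemma fr_comult_sw:
  assumes "bil \<beta>'" shows "sw H (fr_comult h) \<beta>' = sw H g (\<lambda>x y. \<beta>' x (f y h))"
  by (simp add: sw_sw cap_mor_in[OF g] tens2_in assms sw_tens2)

text \<open>A second copy of the copairing is inserted by one snake identity, associativity of the
  form moves \<open>h\<close> across, and the other snake identity removes the first copy.\<close>

lemma fr_swap:
  assumes c: "bil \<gamma>" shows "sw H g (\<lambda>x y. \<gamma> x (f y h)) = sw H g (\<lambda>x y. \<gamma> (f h x) y)"
proof -
  note l = lin_ad bil_lin[OF c] bil_lin[OF form_mor_bil[OF b]] mul_mor_lin[OF f]
  have "sw H g (\<lambda>x y. \<gamma> x (f y h)) = sw H g (\<lambda>x y. sw H g (\<lambda>x' y'. \<beta> (f y h) x' * \<gamma> x y'))"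
    by (subst s1, intro l) simp
  also have "\<dots> = sw H g (\<lambda>x' y'. sw H g (\<lambda>x y. \<beta> y (f h x') * \<gamma> x y'))"
    by (subst sw_swap) (simp add: frob)
  also have "\<dots> = sw H g (\<lambda>x y. \<gamma> (f h x) y)"
    by (subst s2, intro l) simp
  finally show ?thesis .
qed

lemma fr_com_mor: "com_mor fr_comult"
proof (rule com_morI[OF fr_comult_in])
  fix \<beta>' assume b': "bil \<beta>'"
  note l = lin_ad bil_lin[OF b'] mul_mor_lin[OF f]
  show "lf (\<lambda>x. sw H (fr_comult x) \<beta>')"
    unfolding fr_comult_sw[OF b'] by (intro l)
  fix h x
  have "D h (\<lambda>p q. sw H (fr_comult x) (\<lambda>a b. \<beta>' (ad p a) (ad q b))) =
      D h (\<lambda>p q. sw H g (\<lambda>a b. \<beta>' (ad p a) (ad q (f b x))))"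
    by (subst fr_comult_sw, intro l) simp
  also have "\<dots> = D h (\<lambda>p q. sw H g (\<lambda>a b. D q (\<lambda>v w. \<beta>' (ad p a) (f (ad v b) (ad w x)))))"
    by (intro sw_cong mul_morD[OF f] l)
  also have "\<dots> = D h (\<lambda>p q. D q (\<lambda>v w. sw H g (\<lambda>a b. \<beta>' (ad p a) (f (ad v b) (ad w x)))))"
    by (subst (2) sw_swap) (rule refl)
  also have "\<dots> = D h (\<lambda>q w. D q (\<lambda>p v. sw H g (\<lambda>a b. \<beta>' (ad p a) (f (ad v b) (ad w x)))))"
    by (rule D_coassoc[symmetric]) (intro l)
  also have "\<dots> = D h (\<lambda>q w. eps q * sw H g (\<lambda>a b. \<beta>' a (f b (ad w x))))"
    by (intro sw_cong cap_morD[OF g] l)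
  also have "\<dots> = sw H g (\<lambda>a b. \<beta>' a (f b (ad h x)))"
    by (rule D_counit_l) (intro l)
  finally show "sw H (fr_comult (ad h x)) \<beta>' = D h (\<lambda>p q. sw H (fr_comult x) (\<lambda>a b. \<beta>' (ad p a) (ad q b)))"
    by (simp add: fr_comult_sw b')
qed

lemma fr_fun_mor: "fun_mor (\<lambda>h. \<beta> h u)"
  unfolding fun_mor_def
proof (intro conjI allI)
  note l = lin_ad bil_lin[OF form_mor_bil[OF b]]
  show "lf (\<lambda>h. \<beta> h u)" by (intro l)
  fix h x
  have "\<beta> (ad h x) u = D h (\<lambda>p q. \<beta> (ad p x) u * eps q)"
    by (rule D_counit_r[symmetric]) (intro l)
  also have "\<dots> = D h (\<lambda>p q. \<beta> (ad p x) (ad q u))"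
    using u form_mor_bil[OF b] by (simp add: el_mor_def bil_def lf_iff mult.commute)
  also have "\<dots> = eps h * \<beta> x u" by (rule form_morD[OF b])
  finally show "\<beta> (ad h x) u = eps h * \<beta> x u" .
qed

lemma fr_coalgebra: "coalgebra_in H B (comA fr_comult) (funA (\<lambda>h. \<beta> h u))"
proof (rule coalgebra_inI[OF fr_com_mor fr_fun_mor])
  fix \<gamma> h assume t: "tri \<gamma>"
  note l = lin_ad tri_lin[OF t] mul_mor_lin[OF f]
  have "sw H (fr_comult h) (\<lambda>a b. sw H (fr_comult a) (\<lambda>x y. \<gamma> x y b)) =
      sw H g (\<lambda>a b. sw H g (\<lambda>x y. \<gamma> x (f y a) (f b h)))"
    by (subst fr_comult_sw, intro l com_morD[OF fr_com_mor])
      (intro sw_cong fr_comult_sw l)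
  also have "\<dots> = sw H g (\<lambda>x y. sw H g (\<lambda>a b. \<gamma> x (f y a) (f b h)))"
    by (rule sw_swap)
  also have "\<dots> = sw H g (\<lambda>x y. sw H g (\<lambda>a b. \<gamma> x a (f (f b y) h)))"
    by (intro sw_cong fr_swap[symmetric] l)
  also have "\<dots> = sw H (fr_comult h) (\<lambda>x y. sw H g (\<lambda>a b. \<gamma> x a (f b y)))"
    by (subst fr_comult_sw, intro l) (simp add: assoc)
  also have "\<dots> = sw H (fr_comult h) (\<lambda>a b. sw H (fr_comult b) (\<lambda>x y. \<gamma> a x y))"
    by (intro sw_cong fr_comult_sw[symmetric] l)
  finally show "sw H (fr_comult h) (\<lambda>a b. sw H (fr_comult a) (\<lambda>x y. \<gamma> x y b)) =
      sw H (fr_comult h) (\<lambda>a b. sw H (fr_comult b) (\<lambda>x y. \<gamma> a x y))" .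
next
  fix \<phi> h assume p: "lf \<phi>"
  note l = lin_ad lf_comp[OF p] mul_mor_lin[OF f] bil_lin[OF form_mor_bil[OF b]]
  \<comment> \<open>The form is not assumed symmetric; its associativity with units on both sides
    still makes the two functionals obtained from \<open>u\<close> agree.\<close>
  have bu: "\<beta> a u = \<beta> u a" for a using frob[of u a u] by (simp add: unit)
  show "sw H (fr_comult h) (\<lambda>a b. \<beta> a u * \<phi> b) = \<phi> h"
    by (subst fr_comult_sw, intro l, simp only: bu, subst s1, intro l) (simp add: unit)
  show "sw H (fr_comult h) (\<lambda>a b. \<phi> a * \<beta> b u) = \<phi> h"
    using s2[OF p, of h] by (subst fr_comult_sw, intro l) (simp add: frob unit mult.commute)
qed

lemma fr_F_algebra: "F_algebra_in H B (mulA f) (elem_arr H u) (comA fr_comult) (funA (\<lambda>h. \<beta> h u))"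
proof (rule F_algebra_inI[OF algebra_inI[OF f u assoc unit] fr_coalgebra f fr_com_mor])
  fix \<beta>' a c assume b': "bil \<beta>'"
  note l = lin_ad bil_lin[OF b'] mul_mor_lin[OF f]
  show "sw H (fr_comult a) (\<lambda>x y. \<beta>' x (f y c)) = sw H (fr_comult (f a c)) \<beta>'"
    by (subst fr_comult_sw, intro l, subst fr_comult_sw[OF b']) (simp add: assoc)
  have "sw H (fr_comult c) (\<lambda>x y. \<beta>' (f a x) y) = sw H g (\<lambda>x y. \<beta>' (f a x) (f y c))"
    by (rule fr_comult_sw) (intro l)
  also have "\<dots> = sw H g (\<lambda>x y. \<beta>' x (f (f y a) c))"
    by (rule fr_swap[symmetric]) (intro l)
  finally show "sw H (fr_comult c) (\<lambda>x y. \<beta>' (f a x) y) = sw H (fr_comult (f a c)) \<beta>'"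
    by (simp add: fr_comult_sw[OF b'] assoc)
qed

end

section \<open>The algebra of a Frobenius coalgebra\<close>

context
  fixes d n \<beta> g
  assumes d: "com_mor d" and n: "fun_mor n" and b: "form_mor \<beta>" and g: "cap_mor g"
    and coassoc: "\<And>\<gamma> h. tri \<gamma> \<Longrightarrow> sw H (d h) (\<lambda>a b. sw H (d a) (\<lambda>x y. \<gamma> x y b)) = sw H (d h) (\<lambda>a b. sw H (d b) (\<lambda>x y. \<gamma> a x y))"
    and counit: "\<And>\<phi> h. lf \<phi> \<Longrightarrow> sw H (d h) (\<lambda>a b. n a * \<phi> b) = \<phi> h"
       "\<And>\<phi> h. lf \<phi> \<Longrightarrow> sw H (d h) (\<lambda>a b. \<phi> a * n b) = \<phi> h"
    and frob: "\<And>\<gamma>. tri \<gamma> \<Longrightarrow> sw H g (\<lambda>a b. sw H (d a) (\<lambda>x y. \<gamma> x y b)) = sw H g (\<lambda>a b. sw H (d b) (\<lambda>x y. \<gamma> a x y))"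
    and s1: "\<And>h \<phi>. lf \<phi> \<Longrightarrow> sw H g (\<lambda>x y. \<beta> h x * \<phi> y) = \<phi> h"
    and s2: "\<And>h \<phi>. lf \<phi> \<Longrightarrow> sw H g (\<lambda>x y. \<beta> y h * \<phi> x) = \<phi> h"
begin

abbreviation "fr_mult a c \<equiv> sw H (d a) (\<lambda>p q. sc (\<beta> q c) p)"
abbreviation "fr_unit \<equiv> sw H g (\<lambda>x y. sc (n y) x)"

lemmas fr_lin = lin_ad com_morD(2)[OF d] bil_lin[OF form_mor_bil[OF b]]

lemma fr_lfn: "lf n" using n by (simp add: fun_mor_def)

lemma fr_mult_lf: "lf \<phi> \<Longrightarrow> \<phi> (fr_mult a c) = sw H (d a) (\<lambda>p q. \<beta> q c * \<phi> p)"
  by (simp add: sw_lf lfD(2))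

lemma fr_unit_lf: "lf \<phi> \<Longrightarrow> \<phi> fr_unit = sw H g (\<lambda>x y. n y * \<phi> x)"
  by (simp add: sw_lf lfD(2))

text \<open>The product can be read from the coproduct of either argument: \<open>c\<close> is
  written through a snake, the Frobenius condition moves the coproduct to the other leg of the
  copairing, and the second snake puts \<open>a\<close> there.\<close>

lemma fr_mult_lf':
  assumes p: "lf \<phi>"
  shows "\<phi> (fr_mult a c) = sw H (d c) (\<lambda>p q. \<beta> a p * \<phi> q)"
proof -
  note l = fr_lin lf_comp[OF p]
  have "sw H (d c) (\<lambda>p q. \<beta> a p * \<phi> q) = sw H g (\<lambda>x y. \<beta> y c * sw H (d x) (\<lambda>p q. \<beta> a p * \<phi> q))"
    by (rule s2[symmetric]) (intro l)
  also have "\<dots> = sw H g (\<lambda>x y. sw H (d x) (\<lambda>p q. \<beta> a p * \<phi> q * \<beta> y c))"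
    by (simp add: sw_cmult mult_ac)
  also have "\<dots> = sw H g (\<lambda>x y. sw H (d y) (\<lambda>p q. \<beta> a x * \<phi> p * \<beta> q c))"
    by (rule frob) (intro l)
  also have "\<dots> = sw H g (\<lambda>x y. \<beta> a x * sw H (d y) (\<lambda>p q. \<beta> q c * \<phi> p))"
    by (simp add: sw_cmult mult_ac)
  also have "\<dots> = sw H (d a) (\<lambda>p q. \<beta> q c * \<phi> p)"
    by (rule s1) (intro l)
  finally show ?thesis by (simp add: fr_mult_lf p)
qed

lemma fr_mul_mor: "mul_mor fr_mult"
  unfolding mul_mor_def
proof (intro conjI allI impI)
  show "le (\<lambda>x. fr_mult x y)" for y
  proof (rule le_from_lf)
    fix \<phi> assume p: "lf \<phi>"
    show "lf (\<lambda>x. \<phi> (fr_mult x y))"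
      unfolding fr_mult_lf[OF p] by (intro fr_lin lf_comp[OF p])
  qed
  show "le (\<lambda>y. fr_mult x y)" for x by (intro fr_lin)
  fix \<phi> h a c assume p: "lf \<phi>"
  note l = fr_lin lf_comp[OF p]
  have "D h (\<lambda>r s. \<phi> (fr_mult (ad r a) (ad s c))) =
      D h (\<lambda>r s. D r (\<lambda>v w. sw H (d a) (\<lambda>p q. \<beta> (ad w q) (ad s c) * \<phi> (ad v p))))"
    unfolding fr_mult_lf[OF p] by (intro sw_cong com_mor_ad[OF d] l)
  also have "\<dots> = D h (\<lambda>v r. D r (\<lambda>w s. sw H (d a) (\<lambda>p q. \<beta> (ad w q) (ad s c) * \<phi> (ad v p))))"
    by (rule D_coassoc) (intro l)
  also have "\<dots> = D h (\<lambda>v r. sw H (d a) (\<lambda>p q. D r (\<lambda>w s. \<beta> (ad w q) (ad s c)) * \<phi> (ad v p)))"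
    by (subst sw_swap[where t = "d a"]) (simp add: sw_cmult)
  also have "\<dots> = D h (\<lambda>v r. sw H (d a) (\<lambda>p q. \<beta> q c * \<phi> (ad v p)) * eps r)"
    by (simp add: form_morD[OF b] sw_cmult mult_ac)
  also have "\<dots> = sw H (d a) (\<lambda>p q. \<beta> q c * \<phi> (ad h p))"
    by (rule D_counit_r) (intro l)
  also have "\<dots> = \<phi> (ad h (fr_mult a c))"
    by (rule fr_mult_lf[symmetric]) (intro l)
  finally show "\<phi> (ad h (fr_mult a c)) = D h (\<lambda>r s. \<phi> (fr_mult (ad r a) (ad s c)))" ..
qed

lemma fr_el_mor: "el_mor fr_unit"
  unfolding el_mor_def
proof (intro allI, rule lf_separate)
  fix h \<phi> assume p: "lf \<phi>"
  note l = fr_lin lf_comp[OF p] lf_comp[OF fr_lfn]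
  have "\<phi> (ad h fr_unit) = sw H g (\<lambda>x y. n y * \<phi> (ad h x))"
    by (rule fr_unit_lf) (intro l)
  also have "\<dots> = D h (\<lambda>p q. sw H g (\<lambda>x y. n y * \<phi> (ad p x)) * eps q)"
    by (rule D_counit_r[symmetric]) (intro l)
  also have "\<dots> = D h (\<lambda>p q. sw H g (\<lambda>x y. n (ad q y) * \<phi> (ad p x)))"
    using n by (simp add: fun_mor_def sw_cmult mult_ac)
  also have "\<dots> = eps h * sw H g (\<lambda>x y. n y * \<phi> x)"
    by (rule cap_morD[OF g]) (intro l)
  also have "\<dots> = \<phi> (sc (eps h) fr_unit)" by (simp add: lfD(2)[OF p] fr_unit_lf[OF p])
  finally show "\<phi> (ad h fr_unit) = \<phi> (sc (eps h) fr_unit)" .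
qed

lemma fr_algebra: "algebra_in H B (mulA fr_mult) (elem_arr H fr_unit)"
proof (rule algebra_inI[OF fr_mul_mor fr_el_mor])
  fix x y z
  show "fr_mult (fr_mult x y) z = fr_mult x (fr_mult y z)"
  proof (rule lf_separate)
    fix \<phi> assume p: "lf \<phi>"
    note l = fr_lin lf_comp[OF p] mul_mor_lin[OF fr_mul_mor]
    have "\<phi> (fr_mult (fr_mult x y) z) = sw H (d x) (\<lambda>p q. \<beta> q y * \<phi> (fr_mult p z))"
      by (rule fr_mult_lf[where \<phi> = "\<lambda>w. \<phi> (fr_mult w z)"]) (intro l)
    also have "\<dots> = sw H (d x) (\<lambda>p q. sw H (d p) (\<lambda>v w. \<beta> w z * \<phi> v * \<beta> q y))"
      by (simp add: fr_mult_lf[OF p] sw_cmult mult_ac)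
    also have "\<dots> = sw H (d x) (\<lambda>p q. sw H (d q) (\<lambda>v w. \<beta> v z * \<phi> p * \<beta> w y))"
      by (rule coassoc) (intro l)
    also have "\<dots> = sw H (d x) (\<lambda>p q. \<beta> (fr_mult q y) z * \<phi> p)"
      by (subst fr_mult_lf[where \<phi> = "\<lambda>w. \<beta> w z"], intro l) (simp add: sw_cmult mult_ac)
    \<comment> \<open>The form is associative for the product it defines: both values are sums over
      the coproduct of \<open>y\<close>, one by \<open>fr_mult_lf'\<close> and one by
      \<open>fr_mult_lf\<close>.\<close>
    also have "\<dots> = sw H (d x) (\<lambda>p q. \<beta> q (fr_mult y z) * \<phi> p)"
    proof -
      have "\<beta> (fr_mult q y) z = \<beta> q (fr_mult y z)" for q
      proof -
        have "\<beta> (fr_mult q y) z = sw H (d y) (\<lambda>p r. \<beta> q p * \<beta> r z)"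
          by (rule fr_mult_lf') (intro l)
        also have "\<dots> = \<beta> q (fr_mult y z)"
          by (subst fr_mult_lf[where \<phi> = "\<beta> q"], intro l) (simp add: mult.commute)
        finally show ?thesis .
      qed
      then show ?thesis by simp
    qed
    also have "\<dots> = \<phi> (fr_mult x (fr_mult y z))"
      by (rule fr_mult_lf[OF p, symmetric])
    finally show "\<phi> (fr_mult (fr_mult x y) z) = \<phi> (fr_mult x (fr_mult y z))" .
  qed
next
  fix a
  show "fr_mult fr_unit a = a"
  proof (rule lf_separate)
    fix \<phi> assume p: "lf \<phi>"
    note l = fr_lin lf_comp[OF p] lf_comp[OF fr_lfn] mul_mor_lin[OF fr_mul_mor]
    have "\<phi> (fr_mult fr_unit a) = sw H g (\<lambda>x y. n y * \<phi> (fr_mult x a))"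
      by (rule fr_unit_lf[where \<phi> = "\<lambda>w. \<phi> (fr_mult w a)"]) (intro l)
    also have "\<dots> = sw H g (\<lambda>x y. sw H (d x) (\<lambda>p q. \<beta> q a * \<phi> p * n y))"
      by (simp add: fr_mult_lf[OF p] sw_cmult mult_ac)
    also have "\<dots> = sw H g (\<lambda>x y. sw H (d y) (\<lambda>p q. \<beta> p a * \<phi> x * n q))"
      by (rule frob) (intro l)
    also have "\<dots> = sw H g (\<lambda>x y. \<beta> y a * \<phi> x)"
      by (intro sw_cong counit(2) l)
    also have "\<dots> = \<phi> a" by (rule s2[OF p])
    finally show "\<phi> (fr_mult fr_unit a) = \<phi> a" .
  qed
  show "fr_mult a fr_unit = a"
  proof (rule lf_separate)
    fix \<phi> assume p: "lf \<phi>"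
    note l = fr_lin lf_comp[OF p] lf_comp[OF fr_lfn] mul_mor_lin[OF fr_mul_mor]
    have "\<phi> (fr_mult a fr_unit) = sw H g (\<lambda>x y. n y * \<phi> (fr_mult a x))"
      by (rule fr_unit_lf[where \<phi> = "\<lambda>w. \<phi> (fr_mult a w)"]) (intro l)
    also have "\<dots> = sw H g (\<lambda>x y. sw H (d x) (\<lambda>p q. \<beta> a p * \<phi> q * n y))"
      by (simp add: fr_mult_lf'[OF p] sw_cmult mult_ac)
    also have "\<dots> = sw H g (\<lambda>x y. sw H (d y) (\<lambda>p q. \<beta> a x * \<phi> p * n q))"
      by (rule frob) (intro l)
    also have "\<dots> = sw H g (\<lambda>x y. \<beta> a x * \<phi> y)"
      by (intro sw_cong counit(2) l)
    also have "\<dots> = \<phi> a" by (rule s1[OF p])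
    finally show "\<phi> (fr_mult a fr_unit) = \<phi> a" .
  qed
qed

text \<open>Each of the two Frobenius identities is coassociativity, once the product is expanded
  along the matching argument by \<open>fr_mult_lf\<close> or \<open>fr_mult_lf'\<close>.\<close>

lemma fr_F_coalgebra: "F_algebra_in H B (mulA fr_mult) (elem_arr H fr_unit) (comA d) (funA n)"
proof (rule F_algebra_inI[OF fr_algebra coalgebra_inI[OF d n coassoc counit] fr_mul_mor d])
  fix \<beta>' a c assume b': "bil \<beta>'"
  note l = fr_lin bil_lin[OF b'] mul_mor_lin[OF fr_mul_mor]
  have "sw H (d a) (\<lambda>x y. \<beta>' x (fr_mult y c)) = sw H (d a) (\<lambda>x y. sw H (d y) (\<lambda>p q. \<beta>' x p * \<beta> q c))"
    by (subst fr_mult_lf[where \<phi> = "\<beta>' _"], intro l) (simp add: mult.commute)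
  also have "\<dots> = sw H (d a) (\<lambda>x y. sw H (d x) (\<lambda>p q. \<beta>' p q * \<beta> y c))"
    by (rule coassoc[symmetric]) (intro l)
  also have "\<dots> = sw H (d a) (\<lambda>p q. \<beta> q c * sw H (d p) \<beta>')"
    by (simp add: sw_cmult mult.commute)
  also have "\<dots> = sw H (d (fr_mult a c)) \<beta>'"
    by (rule fr_mult_lf[symmetric]) (intro l b')
  finally show "sw H (d a) (\<lambda>x y. \<beta>' x (fr_mult y c)) = sw H (d (fr_mult a c)) \<beta>'" .
  have "sw H (d c) (\<lambda>x y. \<beta>' (fr_mult a x) y) = sw H (d c) (\<lambda>x y. sw H (d x) (\<lambda>p q. \<beta> a p * \<beta>' q y))"
    by (subst fr_mult_lf'[where \<phi> = "\<lambda>w. \<beta>' w _"], intro l) simp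
  also have "\<dots> = sw H (d c) (\<lambda>x y. sw H (d y) (\<lambda>p q. \<beta> a x * \<beta>' p q))"
    by (rule coassoc) (intro l)
  also have "\<dots> = sw H (d c) (\<lambda>p q. \<beta> a p * sw H (d q) \<beta>')"
    by (simp add: sw_cmult)
  also have "\<dots> = sw H (d (fr_mult a c)) \<beta>'"
    by (rule fr_mult_lf'[symmetric]) (intro l b')
  finally show "sw H (d c) (\<lambda>x y. \<beta>' (fr_mult a x) y) = sw H (d (fr_mult a c)) \<beta>'" .
qed

end

section \<open>The structure maps of the transmutation\<close>

lemma trm_normal:
  "trm_mult H = mulA (*)" "trm_unit H = elem_arr H 1" "trm_counit H = funA eps"
  "trm_comult H = comA dc" "trm_antipode H = endA sb"
  unfolding trm_mult_def mulA_def trm_unit_def trm_counit_def funA_def trm_comult_def comA_def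
    trm_antipode_def endA_def dc_def sb_def ad_def
  by (rule refl)+

lemma mul_mor_times: "mul_mor (*)"
  unfolding mul_mor_def by (auto simp: ad_times intro: lin)

lemma el_mor_one: "el_mor 1" by (simp add: el_mor_def ad_unit)

lemma fun_mor_eps: "fun_mor eps" unfolding fun_mor_def by (auto intro: lin)

lemma end_mor_sb: "end_mor sb" unfolding end_mor_def by (auto simp: sb_ad intro: le_sb le_id)

lemma trm_algebra: "algebra_in H B (mulA (*)) (elem_arr H 1)"
  by (rule algebra_inI[OF mul_mor_times el_mor_one]) (simp_all add: mult.assoc)

end

section \<open>The braided F-Hopf algebra\<close>

context factorisable_hopf
begin

lemma com_mor_dc: "com_mor dc"
  by (rule com_morI[OF dc_in]) (auto intro: lf_BD le_id BD_ad)

lemma trm_coalgebra: "coalgebra_in H B (comA dc) (funA eps)"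
  by (rule coalgebra_inI[OF com_mor_dc fun_mor_eps BD_coassoc BD_counit_l BD_counit_r])

lemma trm_hopf: "hopf_in H B (mulA (*)) (elem_arr H 1) (comA dc) (funA eps) (endA sb)"
  by (rule hopf_inI[OF trm_algebra trm_coalgebra mul_mor_times el_mor_one com_mor_dc fun_mor_eps end_mor_sb])
    (simp_all add: BD_mult BD_one BD_sb_l BD_sb_r)

end

context factorisable_hopf_integral
begin

definition form_r :: "'h \<Rightarrow> 'h \<Rightarrow> 'k" where "form_r x y = J (x * y)"
definition form_g :: "'h \<Rightarrow> 'h \<Rightarrow> 'k" where "form_g x y = J (sb x * y)"
definition cap_r :: "('h, 'h, 'k) tensor" where "cap_r = BD \<Lambda> (\<lambda>c d. tens2 H c (sb d))"

lemma form_mor_r: "form_mor form_r"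
  unfolding form_mor_def form_r_def
  by (auto simp: ad_times J_lf J_ad intro!: lin_J)

lemma form_mor_g: "form_mor form_g"
  unfolding form_mor_def form_g_def
  by (auto simp: sb_ad ad_times J_lf J_ad intro!: lin_J)

lemma BD_Lam_ad: "bil \<beta> \<Longrightarrow> D h (\<lambda>p q. BD \<Lambda> (\<lambda>a b. \<beta> (ad p a) (ad q b))) = eps h * BD \<Lambda> \<beta>"
  using lfD(2)[OF lf_BD[OF le_id], of \<beta> "eps h" \<Lambda>] by (simp add: BD_ad[symmetric] ad_Lam)

lemma cap_mor_g: "cap_mor (dc \<Lambda>)"
  unfolding cap_mor_def by (simp add: dc_in BD_Lam_ad)

lemma sw_cap_r: "bil \<beta> \<Longrightarrow> sw H cap_r \<beta> = BD \<Lambda> (\<lambda>c d. \<beta> c (sb d))"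
  by (simp add: cap_r_def sw_sw dc_in tens2_in sw_tens2)

lemma cap_mor_r: "cap_mor cap_r"
  unfolding cap_mor_def
proof (intro conjI allI impI)
  show "cap_r \<in> car HH" unfolding cap_r_def by (intro sw_in dc_in tens2_in)
  fix \<beta> h assume b: "bil \<beta>"
  note l = lin_J bil_lin[OF b]
  have "D h (\<lambda>p q. sw H cap_r (\<lambda>a b. \<beta> (ad p a) (ad q b))) = D h (\<lambda>p q. BD \<Lambda> (\<lambda>a b. \<beta> (ad p a) (sb (ad q b))))"
    by (subst sw_cap_r, intro l) (simp add: sb_ad)
  also have "\<dots> = eps h * BD \<Lambda> (\<lambda>a b. \<beta> a (sb b))"
    by (rule BD_Lam_ad) (intro l)
  finally show "D h (\<lambda>p q. sw H cap_r (\<lambda>a b. \<beta> (ad p a) (ad q b))) = eps h * sw H cap_r \<beta>"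
    by (simp add: sw_cap_r b)
qed

lemma snake_r1: "lf \<phi> \<Longrightarrow> sw H cap_r (\<lambda>x y. form_r h x * \<phi> y) = \<phi> h"
proof -
  assume p: "lf \<phi>"
  show ?thesis
    unfolding form_r_def by (subst sw_cap_r, intro lin_J lf_comp[OF p]) (rule J_Lam_snake[OF p])
qed

lemma snake_r2: "lf \<phi> \<Longrightarrow> sw H cap_r (\<lambda>x y. form_r y h * \<phi> x) = \<phi> h"
  by (rule snake_flip[OF form_mor_bil[OF form_mor_r] snake_r1])

lemma snake_g1: "lf \<phi> \<Longrightarrow> sw H (dc \<Lambda>) (\<lambda>x y. form_g h x * \<phi> y) = \<phi> h"
  unfolding form_g_def by (rule J_sb_Lam_snake)

lemma snake_g2: "lf \<phi> \<Longrightarrow> sw H (dc \<Lambda>) (\<lambda>x y. form_g y h * \<phi> x) = \<phi> h"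
  by (rule snake_flip[OF form_mor_bil[OF form_mor_g] snake_g1])

lemma frob_r: "form_r (x * y) z = form_r x (y * z)" by (simp add: form_r_def mult.assoc)

lemma frobenius_r: "frobenius_algebra_in H B (mulA (*)) (elem_arr H 1) (formA form_r) (capA cap_r)"
  by (rule frobenius_algebra_inI[OF trm_algebra mul_mor_times form_mor_r cap_mor_r frob_r snake_r1 snake_r2])

text \<open>The copairing is the coproduct of \<Lambda>, so the Frobenius condition is
  coassociativity at \<Lambda>.\<close>

lemma frobenius_g: "frobenius_coalgebra_in H B (comA dc) (funA eps) (formA form_g) (capA (dc \<Lambda>))"
  by (rule frobenius_coalgebra_inI[OF trm_coalgebra com_mor_dc form_mor_g cap_mor_g BD_coassoc snake_g1 snake_g2])

text \<open>The form \<open>form_g\<close> is \<open>form_r\<close> with \<open>sb\<close> on its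
  first argument, so the snake of \<open>form_r\<close> returns \<open>sb h\<close>.\<close>

lemma sb_cup_cap: "endA sb = cup_cap H B (formA form_g) (capA cap_r)"
proof -
  have "sb h = sw H cap_r (\<lambda>x y. sc (form_g h x) y)" for h
  proof (rule lf_separate)
    fix \<phi> assume p: "lf \<phi>"
    have "form_g h = form_r (sb h)" by (simp add: fun_eq_iff form_r_def form_g_def)
    then show "\<phi> (sb h) = \<phi> (sw H cap_r (\<lambda>x y. sc (form_g h x) y))"
      by (simp add: sw_lf[OF p] lfD(2)[OF p] snake_r1[OF p])
  qed
  then have "sb = (\<lambda>h. sw H cap_r (\<lambda>x y. sc (form_g h x) y))" by (rule ext)
  then show ?thesis
    unfolding cup_cap_normal[OF form_mor_g cap_mor_r] endA_def by (rule arg_cong)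
qed

definition com_r :: "'h \<Rightarrow> ('h, 'h, 'k) tensor" where "com_r h = sw H cap_r (\<lambda>x y. tens2 H x (y * h))"
definition cou_r :: "'h \<Rightarrow> 'k" where "cou_r h = form_r h 1"
definition mul_g :: "'h \<Rightarrow> 'h \<Rightarrow> 'h" where "mul_g a c = BD a (\<lambda>p q. sc (form_g q c) p)"
text \<open>The product \<open>\<mu>\<^sub>g \<circ> \<Psi>\<close> on elements.\<close>

definition star :: "'h \<Rightarrow> 'h \<Rightarrow> 'h" where "star a c = RS (\<lambda>r s. mul_g (ad s c) (ad r a))"

lemmas fr_r = mul_mor_times el_mor_one form_mor_r cap_mor_r mult.assoc mult_1_left mult_1_right frob_r snake_r1 snake_r2
lemmas fr_g = com_mor_dc fun_mor_eps form_mor_g cap_mor_g BD_coassoc BD_counit_l BD_counit_r BD_coassoc snake_g1 snake_g2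

lemma com_mor_r: "com_mor com_r"
  using fr_com_mor[OF fr_r] by (simp add: com_r_def[abs_def])

lemma fun_mor_r: "fun_mor cou_r"
  using fr_fun_mor[OF fr_r] by (simp add: cou_r_def[abs_def])

lemma coalgebra_r: "coalgebra_in H B (comA com_r) (funA cou_r)"
  using fr_coalgebra[OF fr_r] by (simp add: com_r_def[abs_def] cou_r_def[abs_def])

lemma F_algebra_r: "F_algebra_in H B (mulA (*)) (elem_arr H 1) (comA com_r) (funA cou_r)"
  using fr_F_algebra[OF fr_r] by (simp add: com_r_def[abs_def] cou_r_def[abs_def])

lemma mul_mor_g: "mul_mor mul_g"
  using fr_mul_mor[OF fr_g] by (simp add: mul_g_def[abs_def])

lemma unit_g: "BD \<Lambda> (\<lambda>x y. sc (eps y) x) = \<Lambda>"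
proof (rule lf_separate)
  fix \<phi> assume p: "lf \<phi>"
  show "\<phi> (BD \<Lambda> (\<lambda>x y. sc (eps y) x)) = \<phi> \<Lambda>"
    using BD_counit_r[OF p, of \<Lambda>] by (simp add: sw_lf[OF p] lfD(2)[OF p] mult.commute)
qed

lemma F_algebra_g: "F_algebra_in H B (mulA mul_g) (elem_arr H \<Lambda>) (comA dc) (funA eps)"
  using fr_F_coalgebra[OF fr_g] by (simp add: mul_g_def[abs_def] unit_g)

lemma sw_com_r: "bil \<beta> \<Longrightarrow> sw H (com_r h) \<beta> = sw H cap_r (\<lambda>x y. \<beta> x (y * h))"
  using fr_comult_sw[OF fr_r] by (simp add: com_r_def)

subsection \<open>The dual Hopf algebra\<close>

text \<open>Under the pairing \<open>\<langle>x, y\<rangle> = J (x y)\<close>, evaluated on nested tensor factors, \<open>star\<close> is dual to the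
  braided coproduct and \<open>com_r\<close> to the product.\<close>

lemma J_ad_left: "J (ad h x * y) = J (x * ad (S h) y)"
proof -
  note l = lin_J
  have "J (x * ad (S h) y) = D h (\<lambda>a b. eps a * J (x * ad (S b) y))"
    by (rule D_counit_l[symmetric]) (intro l)
  also have "\<dots> = D h (\<lambda>a b. D a (\<lambda>c d. J (ad c x * ad d (ad (S b) y))))"
    by (simp add: ad_times J_lf J_ad)
  also have "\<dots> = D h (\<lambda>c b. D b (\<lambda>d b. J (ad c x * ad (d * S b) y)))"
    by (subst D_coassoc, intro l) (simp add: ad_mult)
  also have "\<dots> = D h (\<lambda>c b. J (ad c x * ad 1 y) * eps b)"
    by (subst S_r, intro l) (simp add: mult.commute)
  also have "\<dots> = J (ad h x * ad 1 y)"
    by (rule D_counit_r) (intro l)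
  finally show ?thesis by (simp add: ad_one)
qed

lemma star_lf: "lf \<phi> \<Longrightarrow> \<phi> (star a c) = RS (\<lambda>r s. \<phi> (mul_g (ad s c) (ad r a)))"
  by (simp add: star_def sw_lf)

lemma J_mul_g: "J (x * mul_g a c) = BD x (\<lambda>p q. RS (\<lambda>r s. J (p * ad s a) * J (ad r q * c)))"
proof -
  have "J (x * mul_g a c) = BD a (\<lambda>p q. J (x * p) * J (sb q * c))"
    unfolding mul_g_def form_g_def
    by (subst sw_lf[where \<phi> = "\<lambda>z. J (x * z)"], intro lin_J) (simp add: lfD[OF J_lf] mult.commute)
  also have "\<dots> = BD x (\<lambda>p q. RS (\<lambda>r s. J (p * ad s a) * J (ad r q * c)))"
    by (rule J_sb) (intro lin_J)
  finally show ?thesis .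
qed

text \<open>Pairing with \<open>mul_g\<close> leaves a copy of \<R> by \<open>J_mul_g\<close>, and
  the braiding in \<open>star\<close> adds another. An action changes sides of the pairing at the
  cost of \<open>S\<close>, so the two copies are inverse to each other.\<close>

lemma J_star: "J (x * star a c) = BD x (\<lambda>p q. J (q * a) * J (p * c))"
proof -
  note l = lin_J
  have "J (x * star a c) = RS (\<lambda>r s. J (x * mul_g (ad s c) (ad r a)))"
    by (rule star_lf) (intro l)
  also have "\<dots> = BD x (\<lambda>p q. RS (\<lambda>r s. RS (\<lambda>r' s'. J (p * ad (s * s') c) * J (q * ad (S r * r') a))))"
    unfolding J_mul_g by (subst sw_swap, subst (2) sw_swap) (simp add: J_ad_left ad_mult)
  also have "\<dots> = BD x (\<lambda>p q. J (p * ad 1 c) * J (q * ad 1 a))"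
    by (intro sw_cong SR_R[where \<beta> = "\<lambda>u v. J (_ * ad v _) * J (_ * ad u _)"] l)
  finally show ?thesis by (simp add: ad_one mult.commute)
qed

lemma J_com_r: "sw H (com_r h) (\<lambda>p q. J (x * p) * J (y * q)) = J (y * (x * h))"
proof -
  have "sw H (com_r h) (\<lambda>p q. J (x * p) * J (y * q)) = sw H cap_r (\<lambda>p q. form_r x p * J (y * (q * h)))"
    unfolding form_r_def by (rule sw_com_r) (intro lin_J)
  also have "\<dots> = J (y * (x * h))" by (rule snake_r1) (intro lin_J)
  finally show ?thesis .
qed

lemma J_nondegenerate: "(\<And>x. J (x * a) = J (x * c)) \<Longrightarrow> a = c"
  using snake_nondegenerate[OF form_mor_bil[OF form_mor_r] snake_r1] by (simp add: form_r_def)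

lemma J_represents:
  assumes p: "lf \<phi>"
  shows "\<exists>x. \<phi> = (\<lambda>y. J (x * y))"
proof
  \<comment> \<open>The representing element is \<phi> applied to the first leg of the copairing, as
    dictated by \<open>snake_r2\<close>.\<close>
  show "\<phi> = (\<lambda>y. J (sw H cap_r (\<lambda>a b. sc (\<phi> a) b) * y))"
  proof
    fix h
    have "J (sw H cap_r (\<lambda>a b. sc (\<phi> a) b) * h) = sw H cap_r (\<lambda>a b. form_r b h * \<phi> a)"
      unfolding form_r_def
      by (subst sw_lf[where \<phi> = "\<lambda>z. J (z * h)"], intro lin_J) (simp add: lfD[OF J_lf] mult.commute)
    then show "\<phi> h = J (sw H cap_r (\<lambda>a b. sc (\<phi> a) b) * h)" by (simp add: snake_r2[OF p])
  qed
qed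

lemma J_mult_Lam: "J (x * \<Lambda>) = eps x" by (simp add: Lam_l lfD[OF J_lf])

lemma mul_mor_star: "mul_mor star"
  unfolding mul_mor_def
proof (intro conjI allI impI)
  note m = mul_mor_lin[OF mul_mor_g]
  show "le (\<lambda>x. star x y)" "le (\<lambda>y. star x y)" for x y
    unfolding star_def by (intro lin_J m)+
  fix \<phi> h a c assume p: "lf \<phi>"
  note l = lin_J lf_comp[OF p] m
  have "\<phi> (ad h (star a c)) = RS (\<lambda>r s. \<phi> (ad h (mul_g (ad s c) (ad r a))))"
    by (rule star_lf) (intro l)
  also have "\<dots> = RS (\<lambda>r s. D h (\<lambda>u v. \<phi> (mul_g (ad (u * s) c) (ad (v * r) a))))"
    by (simp add: mul_morD[OF mul_mor_g p] ad_mult)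
  also have "\<dots> = D h (\<lambda>u v. RS (\<lambda>r s. \<phi> (mul_g (ad (u * s) c) (ad (v * r) a))))"
    by (rule sw_swap)
  also have "\<dots> = RS (\<lambda>r s. D h (\<lambda>u v. \<phi> (mul_g (ad (s * v) c) (ad (r * u) a))))"
    by (rule R_intertwines) (intro l)
  also have "\<dots> = D h (\<lambda>u v. RS (\<lambda>r s. \<phi> (mul_g (ad (s * v) c) (ad (r * u) a))))"
    by (rule sw_swap)
  also have "\<dots> = D h (\<lambda>u v. \<phi> (star (ad u a) (ad v c)))"
    by (simp add: star_lf[OF p] ad_mult)
  finally show "\<phi> (ad h (star a c)) = D h (\<lambda>u v. \<phi> (star (ad u a) (ad v c)))" .
qed

lemma el_mor_Lam: "el_mor \<Lambda>" by (simp add: el_mor_def ad_Lam)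

lemma algebra_star: "algebra_in H B (mulA star) (elem_arr H \<Lambda>)"
proof (rule algebra_inI[OF mul_mor_star el_mor_Lam])
  fix a c e
  show "star (star a c) e = star a (star c e)"
  proof (rule J_nondegenerate)
    fix x
    have "J (x * star (star a c) e) = BD x (\<lambda>p q. BD q (\<lambda>q r. J (r * a) * J (q * c) * J (p * e)))"
      by (simp add: J_star sw_cmult)
    also have "\<dots> = BD x (\<lambda>p q. BD p (\<lambda>p r. J (q * a) * J (r * c) * J (p * e)))"
      by (rule BD_coassoc[symmetric]) (intro lin_J)
    also have "\<dots> = J (x * star a (star c e))"
      by (simp add: J_star sw_cmult mult.assoc)
    finally show "J (x * star (star a c) e) = J (x * star a (star c e))" .
  qed
next
  fix a
  show "star \<Lambda> a = a"
  proof (rule J_nondegenerate)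
    fix x
    have "BD x (\<lambda>p q. J (p * a) * eps q) = J (x * a)" by (rule BD_counit_r) (intro lin_J)
    then show "J (x * star \<Lambda> a) = J (x * a)" by (simp add: J_star J_mult_Lam mult.commute)
  qed
  show "star a \<Lambda> = a"
  proof (rule J_nondegenerate)
    fix x
    have "BD x (\<lambda>p q. eps p * J (q * a)) = J (x * a)" by (rule BD_counit_l) (intro lin_J)
    then show "J (x * star a \<Lambda>) = J (x * a)" by (simp add: J_star J_mult_Lam mult.commute)
  qed
qed

text \<open>The transpose of \<open>sb\<close> under \<open>J (x y)\<close>, obtained by bending
  with the copairing; it is the antipode whose existence is claimed for the dual.\<close>

definition dual_sb :: "'h \<Rightarrow> 'h" where "dual_sb a = sw H cap_r (\<lambda>c d. sc (J (sb d * a)) c)"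

lemma J_dual_sb: "J (x * dual_sb a) = J (sb x * a)"
proof -
  have "J (x * dual_sb a) = sw H cap_r (\<lambda>c d. form_r x c * J (sb d * a))"
    unfolding dual_sb_def form_r_def
    by (subst sw_lf[where \<phi> = "\<lambda>z. J (x * z)"], intro lin_J) (simp add: lfD[OF J_lf] mult.commute)
  also have "\<dots> = J (sb x * a)" by (rule snake_r1) (intro lin_J)
  finally show ?thesis .
qed

lemma end_mor_dual_sb: "end_mor dual_sb"
  unfolding end_mor_def
proof (intro conjI allI)
  show "le dual_sb" unfolding dual_sb_def by (intro lin_J)
  fix h a
  \<comment> \<open>The transpose of \<open>ad k\<close> is \<open>ad (S k)\<close>, so
    \<open>h\<close> is put in the form \<open>S k\<close>.\<close>
  obtain k where k: "h = S k" using bij_is_surj[OF S_bij] by (rule surjE)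
  show "dual_sb (ad h a) = ad h (dual_sb a)"
    by (rule J_nondegenerate) (simp add: k J_dual_sb J_ad_left[symmetric] sb_ad)
qed

text \<open>All axioms are tested on functionals \<open>J (x _)\<close>. Multiplicativity of
  \<open>com_r\<close> becomes multiplicativity of the braided coproduct at \<open>y * x\<close>,
  its value at \<Lambda> that of the counit on products, and multiplicativity of
  \<open>cou_r\<close> the coproduct of \<open>1\<close>.\<close>

lemma hopf_star: "hopf_in H B (mulA star) (elem_arr H \<Lambda>) (comA com_r) (funA cou_r) (endA dual_sb)"
proof (rule hopf_inI[OF algebra_star coalgebra_r mul_mor_star el_mor_Lam com_mor_r fun_mor_r end_mor_dual_sb])
  note m = mul_mor_lin[OF mul_mor_star]
  have cou: "cou_r x = J x" for x by (simp add: cou_r_def form_r_def)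
  {
    fix \<beta> a c assume b: "bil \<beta>"
    show "sw H (com_r (star a c)) \<beta> =
        sw H (com_r a) (\<lambda>p q. sw H (com_r c) (\<lambda>t e. RS (\<lambda>r s. \<beta> (star p (ad s t)) (star (ad r q) e))))"
    proof (rule bil_ext[where F = "\<lambda>\<beta>. sw H (com_r (star a c)) \<beta>"
          and G = "\<lambda>\<beta>. sw H (com_r a) (\<lambda>p q. sw H (com_r c) (\<lambda>t e. RS (\<lambda>r s. \<beta> (star p (ad s t)) (star (ad r q) e))))"
          and \<beta> = \<beta>])
      fix \<phi> \<psi> assume lf: "lf \<phi>" "lf \<psi>"
      obtain x y where xy: "\<phi> = (\<lambda>z. J (x * z))" "\<psi> = (\<lambda>z. J (y * z))"
        using J_represents[OF lf(1)] J_represents[OF lf(2)] by (elim exE)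
      have "sw H (com_r (star a c)) (\<lambda>u v. J (x * u) * J (y * v)) = BD (y * x) (\<lambda>p q. J (q * a) * J (p * c))"
        by (simp add: J_com_r J_star mult.assoc[symmetric])
      also have "\<dots> = BD y (\<lambda>p q. BD x (\<lambda>t e. RS (\<lambda>r s. J (ad r q * e * a) * J (p * ad s t * c))))"
        by (rule BD_mult) (intro lin_J)
      also have "\<dots> = BD y (\<lambda>p q. BD x (\<lambda>t e. RS (\<lambda>r s.
          sw H (com_r a) (\<lambda>u v. J (e * u) * J (ad r q * v)) * sw H (com_r c) (\<lambda>u v. J (ad s t * u) * J (p * v)))))"
        by (simp add: J_com_r mult.assoc)
      also have "\<dots> = BD y (\<lambda>p q. BD x (\<lambda>t e. RS (\<lambda>r s.
          sw H (com_r a) (\<lambda>u v. J (e * u) * J (q * ad (S r) v)) * sw H (com_r c) (\<lambda>u v. J (t * ad (S s) u) * J (p * v)))))"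
        by (simp add: J_ad_left)
      \<comment> \<open>Moving both actions across the pairing has put \<open>S\<close> on both legs
        of \<R>, and \<open>S \<otimes> S\<close> fixes \<R>.\<close>
      also have "\<dots> = BD y (\<lambda>p q. BD x (\<lambda>t e. RS (\<lambda>r s.
          sw H (com_r a) (\<lambda>u v. J (e * u) * J (q * ad r v)) * sw H (com_r c) (\<lambda>u v. J (t * ad s u) * J (p * v)))))"
        by (intro sw_cong R_SS[where \<beta> = "\<lambda>r s. sw H (com_r a) (\<lambda>u v. J (_ * u) * J (_ * ad r v)) * sw H (com_r c) (\<lambda>u v. J (_ * ad s u) * J (_ * v))"] lin_J)
      also have "\<dots> = BD y (\<lambda>p q. BD x (\<lambda>t e. RS (\<lambda>r s. sw H (com_r a) (\<lambda>u v. sw H (com_r c) (\<lambda>u' v'.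
          J (e * u) * J (q * ad r v) * (J (t * ad s u') * J (p * v')))))))"
        by (simp only: sw_cmult(2)) (simp only: sw_cmult(1))
      also have "\<dots> = BD y (\<lambda>p q. sw H (com_r a) (\<lambda>u v. sw H (com_r c) (\<lambda>u' v'. RS (\<lambda>r s. BD x (\<lambda>t e.
          J (e * u) * J (q * ad r v) * (J (t * ad s u') * J (p * v')))))))"
        by (subst sw_swap[of "rmat H" "com_r a"], subst sw_swap[of "rmat H" "com_r c"],
            subst sw_swap[of "dc x" "com_r a"], subst sw_swap[of "dc x" "com_r c"],
            subst sw_swap[of "dc x" "rmat H"]) (rule refl)
      also have "\<dots> = sw H (com_r a) (\<lambda>u v. sw H (com_r c) (\<lambda>u' v'. RS (\<lambda>r s. BD y (\<lambda>p q. BD x (\<lambda>t e.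
          J (e * u) * J (q * ad r v) * (J (t * ad s u') * J (p * v')))))))"
        by (subst sw_swap[of "dc y" "com_r a"], subst sw_swap[of "dc y" "com_r c"],
            subst sw_swap[of "dc y" "rmat H"]) (rule refl)
      also have "\<dots> = sw H (com_r a) (\<lambda>p q. sw H (com_r c) (\<lambda>t e. RS (\<lambda>r s.
          BD x (\<lambda>u v. J (v * p) * J (u * ad s t)) * BD y (\<lambda>u v. J (v * ad r q) * J (u * e)))))"
      proof (intro sw_cong)
        fix u v u' v' r s
        have "BD x (\<lambda>t e. J (e * u) * J (t * ad s u')) * BD y (\<lambda>p q. J (q * ad r v) * J (p * v')) =
            BD y (\<lambda>p q. BD x (\<lambda>t e. J (e * u) * J (t * ad s u')) * (J (q * ad r v) * J (p * v')))"
          by (rule sw_cmult(1))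
        also have "\<dots> = BD y (\<lambda>p q. BD x (\<lambda>t e. J (e * u) * J (t * ad s u') * (J (q * ad r v) * J (p * v'))))"
          by (simp only: sw_cmult(2))
        finally show "BD y (\<lambda>p q. BD x (\<lambda>t e. J (e * u) * J (q * ad r v) * (J (t * ad s u') * J (p * v')))) =
            BD x (\<lambda>t e. J (e * u) * J (t * ad s u')) * BD y (\<lambda>p q. J (q * ad r v) * J (p * v'))"
          by (simp add: mult_ac)
      qed
      also have "\<dots> = sw H (com_r a) (\<lambda>p q. sw H (com_r c) (\<lambda>t e. RS (\<lambda>r s. J (x * star p (ad s t)) * J (y * star (ad r q) e))))"
        by (simp only: J_star)
      finally show "sw H (com_r (star a c)) (\<lambda>u v. \<phi> u * \<psi> v) =
          sw H (com_r a) (\<lambda>p q. sw H (com_r c) (\<lambda>t e. RS (\<lambda>r s. \<phi> (star p (ad s t)) * \<psi> (star (ad r q) e))))"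
        by (simp only: xy)
    qed (simp_all add: sw_plus b)
  next
    fix \<beta> assume b: "bil \<beta>"
    show "sw H (com_r \<Lambda>) \<beta> = \<beta> \<Lambda> \<Lambda>"
    proof (rule bil_ext[where F = "\<lambda>\<beta>. sw H (com_r \<Lambda>) \<beta>" and G = "\<lambda>\<beta>. \<beta> \<Lambda> \<Lambda>" and \<beta> = \<beta>])
      fix \<phi> \<psi> assume lf: "lf \<phi>" "lf \<psi>"
      obtain x y where xy: "\<phi> = (\<lambda>z. J (x * z))" "\<psi> = (\<lambda>z. J (y * z))"
        using J_represents[OF lf(1)] J_represents[OF lf(2)] by (elim exE)
      show "sw H (com_r \<Lambda>) (\<lambda>a b. \<phi> a * \<psi> b) = \<phi> \<Lambda> * \<psi> \<Lambda>"
        using J_mult_Lam[of "y * x"] by (simp add: xy J_com_r J_mult_Lam mult.assoc mult.commute)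
    qed (simp_all add: sw_plus b)
  next
    fix x y
    have "J (1 * star x y) = J (1 * x) * J (1 * y)"
      unfolding J_star by (rule BD_one) (intro lin_J)
    then show "cou_r (star x y) = cou_r x * cou_r y" by (simp add: cou)
  next
    show "cou_r \<Lambda> = 1" by (simp add: cou)
  next
    fix \<phi> h assume lf: "lf \<phi>"
    obtain x where x: "\<phi> = (\<lambda>z. J (x * z))" using J_represents[OF lf] by (elim exE)
    have "sw H (com_r h) (\<lambda>a b. J (x * star (dual_sb a) b)) =
        BD x (\<lambda>p q. sw H (com_r h) (\<lambda>a b. J (sb q * a) * J (p * b)))"
      unfolding J_star J_dual_sb by (rule sw_swap)
    also have "\<dots> = BD x (\<lambda>p q. J (p * sb q * h))" by (simp add: J_com_r mult.assoc)
    \<comment> \<open>Nested pairing reverses the order of factors, so the left antipode axiom here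
      is the right one for \<open>sb\<close>, and conversely below.\<close>
    also have "\<dots> = eps x * J (1 * h)" by (rule BD_sb_r) (intro lin_J)
    finally show "sw H (com_r h) (\<lambda>a b. \<phi> (star (dual_sb a) b)) = cou_r h * \<phi> \<Lambda>"
      by (simp add: x cou J_mult_Lam mult.commute)
    have "sw H (com_r h) (\<lambda>a b. J (x * star a (dual_sb b))) =
        BD x (\<lambda>p q. sw H (com_r h) (\<lambda>a b. J (q * a) * J (sb p * b)))"
      unfolding J_star J_dual_sb by (rule sw_swap)
    also have "\<dots> = BD x (\<lambda>p q. J (sb p * q * h))" by (simp add: J_com_r mult.assoc)
    also have "\<dots> = eps x * J (1 * h)" by (rule BD_sb_l) (intro lin_J)
    finally show "sw H (com_r h) (\<lambda>a b. \<phi> (star a (dual_sb b))) = cou_r h * \<phi> \<Lambda>"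
      by (simp add: x cou J_mult_Lam mult.commute)
  }
qed

lemma associated_structures:
  "frob_mult H B (comA dc) (formA form_g) = mulA mul_g"
  "frob_unit H B (funA eps) (capA (dc \<Lambda>)) = elem_arr H \<Lambda>"
  "frob_comult H B (mulA (*)) (capA cap_r) = comA com_r"
  "frob_counit H B (elem_arr H 1) (formA form_r) = funA cou_r"
  "mulA mul_g \<cdot> braid H B B = mulA star"
  using frob_mult_normal[OF com_mor_dc form_mor_g mul_mor_g[unfolded mul_g_def[abs_def]]]
    frob_unit_normal[OF fun_mor_eps cap_mor_g]
    frob_comult_normal[OF mul_mor_times cap_mor_r com_mor_r[unfolded com_r_def[abs_def]]]
    frob_counit_normal[OF form_mor_r fun_mor_r[unfolded cou_r_def[abs_def]]]
    mult_braid_normal[OF mul_mor_g mul_mor_star[unfolded star_def[abs_def]]]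
  by (simp_all add: mul_g_def[abs_def] com_r_def[abs_def] cou_r_def[abs_def] star_def[abs_def] unit_g)

section \<open>Invertible antipode and integrals as morphisms\<close>

lemma antipode_invertible:
  "\<exists>T \<in> hom H B B. T \<cdot> endA sb = ident B \<and> endA sb \<cdot> T = ident B"
proof
  let ?T = "inv sb"
  have TS: "?T (sb x) = x" and ST: "sb (?T x) = x" for x
    using sb_bij by (simp_all add: bij_def surj_f_inv_f)
  have T: "end_mor ?T"
    unfolding end_mor_def le_iff using leD[OF le_sb[OF le_id]] sb_ad TS ST by metis
  show "endA ?T \<in> hom H B B" by (rule endA_hom[OF T])
  show "endA ?T \<cdot> endA sb = ident B \<and> endA sb \<cdot> endA ?T = ident B"
    by (intro conjI arrow_eqI) (simp_all add: T end_mor_sb TS ST)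
qed

lemma left_integral_Lam: "left_integral_on H B (mulA (*)) (funA eps) (elem_arr H \<Lambda>)"
  unfolding left_integral_on_def
proof (intro conjI elem_hom el_mor_Lam)
  show "mulA (*) \<cdot> (ident B \<otimes> elem_arr H \<Lambda>) = elem_arr H \<Lambda> \<cdot> funA eps \<cdot> runit H B"
    by (rule arrow_eq_tensor[where V = B and W = K and U = B])
      (simp_all add: mul_mor_times fun_mor_eps app_tensor_pure app_units sw_mul Lam_l lfD(2)[OF lf_eps[OF le_id]] mult.commute)
qed

lemma right_integral_J: "right_integral_on H B (elem_arr H 1) (comA dc) (funA J)"
proof -
  have fJ: "fun_mor J" by (simp add: fun_mor_def J_lf J_ad)
  show ?thesis
    unfolding right_integral_on_def
  proof (intro conjI funA_hom fJ arrow_eqI)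
    fix x
    have "BD x (\<lambda>a b. sc (J a) b) = sc (J x) 1"
      by (rule lf_separate) (simp add: sw_lf lfD(2) J_BD)
    then show "app (lunit H B \<cdot> (funA J \<otimes> ident B) \<cdot> comA dc) x = app (elem_arr H 1 \<cdot> funA J) x"
      by (simp add: app_tensor_BB dc_in) (subst app_sw; simp add: dc_in app_units)
  qed (simp_all add: fJ com_mor_dc)
qed

end

theorem proposition4p4:
  fixes H :: "('k::field, 'h::ring_1) qtha" and \<Lambda> :: 'h
  assumes "is_quasitriangular H"
    and "is_finite_dimensional H"
    and "is_factorisable H"
    and "is_left_integral_in H \<Lambda>"
    and "\<Lambda> \<noteq> 0"
    and "antipode H \<Lambda> = \<Lambda>"
  shows
    "(\<exists>T \<in> hom H (trm H) (trm H).
        T \<cdot> trm_antipode H = ident (trm H) \<and> trm_antipode H \<cdot> T = ident (trm H)) \<and>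
     left_integral_on H (trm H) (trm_mult H) (trm_counit H) (elem_arr H \<Lambda>) \<and>
     (\<exists>J. right_integral_on H (trm H) (trm_unit H) (trm_comult H) J \<and> app J \<Lambda> = 1) \<and>
     (\<exists>cup\<^sub>r g\<^sub>r cup\<^sub>g g\<^sub>g.
        frobenius_algebra_in H (trm H) (trm_mult H) (trm_unit H) cup\<^sub>r g\<^sub>r \<and>
        frobenius_coalgebra_in H (trm H) (trm_comult H) (trm_counit H) cup\<^sub>g g\<^sub>g \<and>
        trm_antipode H = cup_cap H (trm H) cup\<^sub>g g\<^sub>r \<and>
        (let m\<^sub>r = trm_mult H; e\<^sub>r = trm_unit H; d\<^sub>g = trm_comult H; n\<^sub>g = trm_counit H;
             m\<^sub>g = frob_mult H (trm H) d\<^sub>g cup\<^sub>g; e\<^sub>g = frob_unit H (trm H) n\<^sub>g g\<^sub>g;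
             d\<^sub>r = frob_comult H (trm H) m\<^sub>r g\<^sub>r; n\<^sub>r = frob_counit H (trm H) e\<^sub>r cup\<^sub>r
         in F_algebra_in H (trm H) m\<^sub>r e\<^sub>r d\<^sub>r n\<^sub>r \<and>
            F_algebra_in H (trm H) m\<^sub>g e\<^sub>g d\<^sub>g n\<^sub>g \<and>
            hopf_in H (trm H) m\<^sub>r e\<^sub>r d\<^sub>g n\<^sub>g (trm_antipode H) \<and>
            (\<exists>s. hopf_in H (trm H) (m\<^sub>g \<cdot> braid H (trm H) (trm H)) e\<^sub>g d\<^sub>r n\<^sub>r s)))"
proof -
  interpret factorisable_hopf_integral H \<Lambda>
    by unfold_locales (use assms in auto)
  show ?thesis
    unfolding trm_normal Let_def
    using antipode_invertible left_integral_Lam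
    by (intro conjI exI[of _ "funA J"] exI[of _ "formA form_r"] exI[of _ "capA cap_r"]
        exI[of _ "formA form_g"] exI[of _ "capA (dc \<Lambda>)"] exI[of _ "endA dual_sb"])
      (simp_all add: right_integral_J frobenius_r frobenius_g sb_cup_cap[symmetric] associated_structures
        F_algebra_r F_algebra_g trm_hopf hopf_star)
qed

end
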